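(* Let $0<M_1\le M_2$ and $\Theta=\{\Sigma\succeq0:\lambda_{\max}(\Sigma)\le M_2,\ \lambda_{\min}(\Sigma)\ge M_1\}$. Let $P_{\Sigma^*}=\mathcal{N}(0,\Sigma^* )$ with $\Sigma^*\in\Theta$, let $P$ satisfy $W(P,P_{\Sigma^*})\le\epsilon$, and let $X_1,\dots,X_n\stackrel{i.i.d.}{\sim}P$. Let $L\ge2$, $B=1/M_1$, and let $\widehat\Sigma$ be the W-GAN estimator over $\{\mathcal{N}(0,\Sigma):\Sigma\in\Theta\}$ with function class $\mathcal{D}(B,L)$. There are constants $c>0$ (sufficiently small) and $C'>0$, with $C'$ depending on $M_1,M_2$, such that if $2^L\cdot\frac pn+\epsilon^2\le c$, then with probability at least $1-e^{-(p+n\epsilon^2)}$, $$\|\widehat\Sigma-\Sigma^*\|_2\le C'\left(2^L\sqrt{\frac pn}\vee\epsilon\right).$$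
   Context: $\|\cdot\|_2$ on matrices is the spectral norm; $W$ is the Wasserstein-1 distance. $\mathcal{D}(B,L)$: networks $f:\mathbb{R}^p\to\mathbb{R}$ whose first-layer nodes are $x\mapsto\sigma(w^Tx+b)$, $\sigma(u)=1/(1+e^{-u})$, $\|w\|_2\le B$, $b\in\mathbb{R}$; for $1\le l<L-1$, nodes of layer $l+1$ are $\max(\sum_iw_if^{(l)}_i(x),0)$ with $f_i^{(l)}$ nodes of layer $l$ (finite width) and $\sum_i|w_i|\le1$; output $\sum_iw_if_i^{(L-1)}(x)$ with $\sum_i|w_i|\le1$. W-GAN estimator: $\widehat\Sigma\in\arg\min_{\Sigma\in\Theta}\sup_{f\in\mathcal{D}}\{\frac1n\sum_if(X_i)-\mathbb{E}_{\mathcal{N}(0,\Sigma)}f(X)\}$ (assumed attained). *)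

theory Defs
  imports "HOL-Probability.Probability"
begin

text \<open>Vectors in R^p are functions nat => real, only coordinates < p matter;
 the measurable space of R^p is the product space on the index set {..<p}.
 Matrices are functions nat => nat => real, only entries with indices < p matter.\<close>

definition Rp :: "nat \<Rightarrow> (nat \<Rightarrow> real) measure" where
  "Rp p = PiM {..<p} (\<lambda>_. borel)"

definition enorm :: "nat \<Rightarrow> (nat \<Rightarrow> real) \<Rightarrow> real" where
  "enorm p x = sqrt (\<Sum>i<p. (x i)\<^sup>2)"

definition mat_vec :: "nat \<Rightarrow> (nat \<Rightarrow> nat \<Rightarrow> real) \<Rightarrow> (nat \<Rightarrow> real) \<Rightarrow> (nat \<Rightarrow> real)" where
  "mat_vec p A x = restrict (\<lambda>i. \<Sum>j<p. A i j * x j) {..<p}"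

definition mat_diff :: "(nat \<Rightarrow> nat \<Rightarrow> real) \<Rightarrow> (nat \<Rightarrow> nat \<Rightarrow> real) \<Rightarrow> (nat \<Rightarrow> nat \<Rightarrow> real)" where
  "mat_diff A C = (\<lambda>i j. A i j - C i j)"

definition spec_norm :: "nat \<Rightarrow> (nat \<Rightarrow> nat \<Rightarrow> real) \<Rightarrow> real" where
  "spec_norm p A = Sup {enorm p (mat_vec p A x) | x. enorm p x \<le> 1}"

definition symmetric_mat :: "nat \<Rightarrow> (nat \<Rightarrow> nat \<Rightarrow> real) \<Rightarrow> bool" where
  "symmetric_mat p A \<longleftrightarrow> (\<forall>i<p. \<forall>j<p. A i j = A j i)"

definition psd :: "nat \<Rightarrow> (nat \<Rightarrow> nat \<Rightarrow> real) \<Rightarrow> bool" where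
  "psd p A \<longleftrightarrow> symmetric_mat p A \<and>
     (\<forall>x. (\<Sum>i<p. \<Sum>j<p. x i * A i j * x j) \<ge> 0)"

definition is_eigenvalue :: "nat \<Rightarrow> (nat \<Rightarrow> nat \<Rightarrow> real) \<Rightarrow> real \<Rightarrow> bool" where
  "is_eigenvalue p A lam \<longleftrightarrow>
     (\<exists>x. (\<exists>i<p. x i \<noteq> 0) \<and> (\<forall>i<p. (\<Sum>j<p. A i j * x j) = lam * x i))"

definition Theta :: "nat \<Rightarrow> real \<Rightarrow> real \<Rightarrow> (nat \<Rightarrow> nat \<Rightarrow> real) set" where
  "Theta p M1 M2 = {S. psd p S \<and> (\<forall>lam. is_eigenvalue p S lam \<longrightarrow> M1 \<le> lam \<and> lam \<le> M2)}"

definition std_gauss :: "nat \<Rightarrow> (nat \<Rightarrow> real) measure" where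
  "std_gauss p = PiM {..<p} (\<lambda>_. density lborel std_normal_density)"

definition mat_sqrt :: "nat \<Rightarrow> (nat \<Rightarrow> nat \<Rightarrow> real) \<Rightarrow> (nat \<Rightarrow> nat \<Rightarrow> real)" where
  "mat_sqrt p S = (SOME A. \<forall>i<p. \<forall>j<p. (\<Sum>k<p. A i k * A j k) = S i j)"

definition gaussian :: "nat \<Rightarrow> (nat \<Rightarrow> nat \<Rightarrow> real) \<Rightarrow> (nat \<Rightarrow> real) measure" where
  "gaussian p S = distr (std_gauss p) (Rp p) (mat_vec p (mat_sqrt p S))"

definition couplings :: "nat \<Rightarrow> (nat \<Rightarrow> real) measure \<Rightarrow> (nat \<Rightarrow> real) measure
    \<Rightarrow> ((nat \<Rightarrow> real) \<times> (nat \<Rightarrow> real)) measure set" where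
  "couplings p P Q = {\<pi>. sets \<pi> = sets (Rp p \<Otimes>\<^sub>M Rp p) \<and> prob_space \<pi> \<and>
       distr \<pi> (Rp p) fst = P \<and> distr \<pi> (Rp p) snd = Q}"

definition wasserstein1 :: "nat \<Rightarrow> (nat \<Rightarrow> real) measure \<Rightarrow> (nat \<Rightarrow> real) measure \<Rightarrow> ennreal" where
  "wasserstein1 p P Q =
     (INF \<pi> \<in> couplings p P Q. \<integral>\<^sup>+ z. ennreal (enorm p (\<lambda>i. fst z i - snd z i)) \<partial>\<pi>)"

definition sigmoid :: "real \<Rightarrow> real" where
  "sigmoid u = 1 / (1 + exp (- u))"

text \<open>Nodes of layer l of networks in D(B,L) (finite widths, finite linear combinations
 represented as lists of (weight, node) pairs).\<close>
fun layer :: "nat \<Rightarrow> real \<Rightarrow> nat \<Rightarrow> ((nat \<Rightarrow> real) \<Rightarrow> real) set" where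
  "layer p B 0 = {}"
| "layer p B (Suc 0) =
     {(\<lambda>x. sigmoid ((\<Sum>j<p. w j * x j) + b)) | w b. sqrt (\<Sum>j<p. (w j)\<^sup>2) \<le> B}"
| "layer p B (Suc (Suc l)) =
     {(\<lambda>x. max (\<Sum>(a, g)\<leftarrow>ws. a * g x) 0) | ws.
        set (map snd ws) \<subseteq> layer p B (Suc l) \<and> (\<Sum>(a, g)\<leftarrow>ws. \<bar>a\<bar>) \<le> 1}"

definition DNN :: "nat \<Rightarrow> real \<Rightarrow> nat \<Rightarrow> ((nat \<Rightarrow> real) \<Rightarrow> real) set" where
  "DNN p B L = {(\<lambda>x. \<Sum>(a, g)\<leftarrow>ws. a * g x) | ws.
        set (map snd ws) \<subseteq> layer p B (L - 1) \<and> (\<Sum>(a, g)\<leftarrow>ws. \<bar>a\<bar>) \<le> 1}"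

definition wgan_obj :: "nat \<Rightarrow> real \<Rightarrow> nat \<Rightarrow> nat \<Rightarrow> (nat \<Rightarrow> nat \<Rightarrow> real) \<Rightarrow>
    (nat \<Rightarrow> nat \<Rightarrow> real) \<Rightarrow> real" where
  "wgan_obj p B L n X S =
     (SUP f \<in> DNN p B L. (\<Sum>i<n. f (X i)) / real n - (\<integral>x. f x \<partial>gaussian p S))"

definition is_wgan_estimate :: "nat \<Rightarrow> real \<Rightarrow> real \<Rightarrow> real \<Rightarrow> nat \<Rightarrow> nat \<Rightarrow>
    (nat \<Rightarrow> nat \<Rightarrow> real) \<Rightarrow> (nat \<Rightarrow> nat \<Rightarrow> real) \<Rightarrow> bool" where
  "is_wgan_estimate p M1 M2 B L n X S \<longleftrightarrow>
     S \<in> Theta p M1 M2 \<and> (\<forall>S' \<in> Theta p M1 M2. wgan_obj p B L n X S \<le> wgan_obj p B L n X S')"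

end

theory Submission
  imports Defs
begin

text \<open>
  Write \<open>P\<^sub>n\<close> for the empirical distribution and \<open>F = sup {\<bar>P\<^sub>n f - E\<^sub>\<Sigma>\<^sub>* f\<bar> | f \<in> D}\<close>.  Minimality of the estimator gives
  \<open>sup {E\<^sub>\<Sigma>\<^sub>* f - E\<^sub>\<Sigma> f | f \<in> D} \<le> 2 F\<close>.

  Lower bound: \<open>D\<close> contains the single neurons \<open>sigmoid (w \<bullet> x - 1)\<close>, and the expectation of such a neuron
  under a centred Gaussian is strictly increasing in the variance of \<open>w \<bullet> x\<close>, with slope bounded below
  as long as the variance is bounded.  Hence all \<open>u \<bullet> (\<Sigma> - \<Sigma>*) u\<close> with \<open>u\<close> a unit vector are \<open>O(F)\<close>.

  Upper bound: by bounded differences \<open>F\<close> is close to its mean, and by the Lipschitz property of \<open>D\<close> and a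
  coupling, the mean under \<open>P\<close> differs by \<open>O(\<epsilon>)\<close> from the mean under the Gaussian.  The latter is bounded by a
  Rademacher average, in which every ReLU layer costs a factor 2 by contraction.  For the first layer, where the
  bias is unbounded, the biases are split into dyadic blocks: for \<open>\<bar>b\<bar>\<close> of size \<open>R \<ge> sqrt p\<close> the slope of
  \<open>sigmoid\<close> at \<open>w \<bullet> x + b\<close> is \<open>O((1 + B\<^sup>2 \<bar>x\<bar>\<^sup>2) / R\<^sup>2)\<close>, so contraction makes the blocks summable, and
  only \<open>E \<bar>x\<bar>\<^sup>4 = O(p\<^sup>2)\<close> is needed.
\<close>

section \<open>Rademacher averages and contraction\<close>

text \<open>The suprema run over uncountable classes, so their measurability is not automatic: the
  Lipschitz bound, uniform over the class, makes each of them continuous in the sample. Random signs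
  never live on the probability space; they are averaged by the finite recursion \<open>rad\<close>,
  so that contraction is an induction on one sign and symmetrization can be proved separately for
  every sign vector. The bias of a first-layer neuron is unbounded, hence neuron arguments admit no
  uniform bound; what rescues large biases is that the sigmoid is flat there unless the sample point
  itself is long.

  The bias must also be nonzero in the lower bound. Since
  \<open>sigmoid u + sigmoid (- u) = 1\<close>, a neuron with zero bias has mean 1/2 under every
  centred Gaussian and sees no variance; the bias -1 breaks this symmetry. The weight vector is B u
  for a unit vector u, so the variances to be compared stay below B^2 M_2, and on this bounded range
  the slope is bounded below.\<close>

fun rad :: "nat \<Rightarrow> ((nat \<Rightarrow> real) \<Rightarrow> real) \<Rightarrow> real" where
  "rad 0 H = H (\<lambda>_. 0)"
| "rad (Suc n) H = (rad n (\<lambda>s. H (s(n := 1))) + rad n (\<lambda>s. H (s(n := -1)))) / 2"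

definition signs :: "nat \<Rightarrow> (nat \<Rightarrow> real) set" where
  "signs n = {s. \<forall>i<n. s i = 1 \<or> s i = -1}"

lemma signs_upd: "s \<in> signs n \<Longrightarrow> s(n := 1) \<in> signs (Suc n)"
  "s \<in> signs n \<Longrightarrow> s(n := -1) \<in> signs (Suc n)"
  by (auto simp: signs_def less_Suc_eq)

lemma rad_mono:
  "(\<And>s. s \<in> signs n \<Longrightarrow> H s \<le> H' s) \<Longrightarrow> rad n H \<le> rad n H'"
proof (induction n arbitrary: H H')
  case (Suc n)
  have "rad n (\<lambda>s. H (s(n := 1))) \<le> rad n (\<lambda>s. H' (s(n := 1)))"
    by (rule Suc.IH) (use Suc.prems signs_upd in blast)
  moreover have "rad n (\<lambda>s. H (s(n := -1))) \<le> rad n (\<lambda>s. H' (s(n := -1)))"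
    by (rule Suc.IH) (use Suc.prems signs_upd in blast)
  ultimately show ?case by simp
qed (auto simp: signs_def)

lemma rad_const [simp]: "rad n (\<lambda>_. c) = c"
  by (induction n) auto

lemma rad_add: "rad n (\<lambda>s. H s + H' s) = rad n H + rad n H'"
  by (induction n arbitrary: H H') (auto simp: field_simps)

lemma rad_cmult: "rad n (\<lambda>s. c * H s) = c * rad n H"
  by (induction n arbitrary: H) (auto simp: field_simps)

lemma rad_sum: "finite A \<Longrightarrow> rad n (\<lambda>s. \<Sum>k\<in>A. H k s) = (\<Sum>k\<in>A. rad n (H k))"
  by (induction A rule: finite_induct) (auto simp: rad_add)

lemma rad_neg: "rad n (\<lambda>s. H (\<lambda>i. - s i)) = rad n H"
proof (induction n arbitrary: H)
  case (Suc n)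
  have *: "(\<lambda>i. - (s(n := c)) i) = (\<lambda>i. - s i)(n := - c)" for s :: "nat \<Rightarrow> real" and c
    by auto
  show ?case
    unfolding rad.simps * using Suc.IH[of "\<lambda>s. H (s(n := -1))"] Suc.IH[of "\<lambda>s. H (s(n := 1))"]
    by simp
qed simp

text \<open>A finite average commutes with limits; this later removes the truncation of the
  biases.\<close>

lemma rad_tendsto:
  "(\<And>s. s \<in> signs n \<Longrightarrow> (\<lambda>N. H N s) \<longlonglongrightarrow> G s) \<Longrightarrow> (\<lambda>N. rad n (H N)) \<longlonglongrightarrow> rad n G"
proof (induction n arbitrary: H G)
  case (Suc n)
  show ?case unfolding rad.simps
    by (intro tendsto_divide tendsto_add tendsto_const Suc.IH)
       (use Suc.prems signs_upd in \<open>blast | simp\<close>)+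
qed (auto simp: signs_def)

lemma rad_square: "(rad n H)\<^sup>2 \<le> rad n (\<lambda>s. (H s)\<^sup>2)"
proof (induction n arbitrary: H)
  case (Suc n)
  define a b where "a = rad n (\<lambda>s. H (s(n := 1)))" "b = rad n (\<lambda>s. H (s(n := -1)))"
  have "((a + b) / 2)\<^sup>2 \<le> (a\<^sup>2 + b\<^sup>2) / 2"
    using zero_le_power2[of "a - b"] by (simp add: power_divide power2_sum power2_diff)
  also have "\<dots> \<le> (rad n (\<lambda>s. (H (s(n := 1)))\<^sup>2) + rad n (\<lambda>s. (H (s(n := -1)))\<^sup>2)) / 2"
    unfolding a_b_def by (intro divide_right_mono add_mono Suc.IH) auto
  finally show ?case by (simp add: a_b_def)
qed simp

text \<open>Distinct signs are uncorrelated, so the cross terms vanish. The offset \<open>g\<close>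
  absorbs the coordinate that the induction peels off.\<close>

lemma rad_linear_square: "rad n (\<lambda>s. (g + (\<Sum>i<n. s i * x i))\<^sup>2) = g\<^sup>2 + (\<Sum>i<n. (x i)\<^sup>2)"
proof (induction n arbitrary: g)
  case (Suc n)
  have *: "g + (\<Sum>i<Suc n. (s(n := c)) i * x i) = (g + c * x n) + (\<Sum>i<n. s i * x i)"
    for s :: "nat \<Rightarrow> real" and c by simp
  show ?case
    unfolding rad.simps * Suc.IH by (simp add: power2_eq_square algebra_simps)
qed simp

lemma rad_abs_linear_le: "rad n (\<lambda>s. \<bar>\<Sum>i<n. s i * x i\<bar>) \<le> sqrt (\<Sum>i<n. (x i)\<^sup>2)"
proof (rule real_le_rsqrt)
  have "(rad n (\<lambda>s. \<bar>\<Sum>i<n. s i * x i\<bar>))\<^sup>2 \<le> rad n (\<lambda>s. (0 + (\<Sum>i<n. s i * x i))\<^sup>2)"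
    by (rule order_trans[OF rad_square]) simp
  then show "(rad n (\<lambda>s. \<bar>\<Sum>i<n. s i * x i\<bar>))\<^sup>2 \<le> (\<Sum>i<n. (x i)\<^sup>2)"
    unfolding rad_linear_square by simp
qed

lemma rad_enorm_le:
  "rad n (\<lambda>s. enorm p (\<lambda>j. \<Sum>i<n. s i * y i j)) \<le> sqrt (\<Sum>i<n. (enorm p (y i))\<^sup>2)"
proof (rule real_le_rsqrt)
  have "(rad n (\<lambda>s. enorm p (\<lambda>j. \<Sum>i<n. s i * y i j)))\<^sup>2
      \<le> rad n (\<lambda>s. (enorm p (\<lambda>j. \<Sum>i<n. s i * y i j))\<^sup>2)"
    by (rule rad_square)
  also have "\<dots> = rad n (\<lambda>s. \<Sum>j<p. (0 + (\<Sum>i<n. s i * y i j))\<^sup>2)"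
    by (simp add: enorm_def sum_nonneg)
  also have "\<dots> = (\<Sum>j<p. \<Sum>i<n. (y i j)\<^sup>2)"
    by (subst rad_sum) (simp_all only: finite_lessThan rad_linear_square, simp)
  also have "\<dots> = (\<Sum>i<n. (enorm p (y i))\<^sup>2)"
    by (subst sum.swap) (simp add: enorm_def sum_nonneg)
  finally show "(rad n (\<lambda>s. enorm p (\<lambda>j. \<Sum>i<n. s i * y i j)))\<^sup>2 \<le> (\<Sum>i<n. (enorm p (y i))\<^sup>2)" .
qed

lemma bdd_above_abs_bounded:
  fixes f :: "'a \<Rightarrow> real"
  shows "(\<And>t. t \<in> I \<Longrightarrow> \<bar>f t\<bar> \<le> K) \<Longrightarrow> bdd_above (f ` I)"
  by (rule bdd_aboveI2[where M = K]) fastforce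

text \<open>One coordinate of \<open>a\<close> is exchanged for that of \<open>c\<close> at a time,
  with \<open>g\<close> collecting the coordinate peeled off by the induction. Comparing increments
  of two indexed families, instead of composing with one Lipschitz map, lets the Lipschitz constant
  vary with the sample index. The bound \<open>K\<close> makes all suprema range over bounded
  sets.\<close>

lemma rad_contraction:
  fixes a c :: "'t \<Rightarrow> nat \<Rightarrow> real" and g :: "'t \<Rightarrow> real"
  assumes "I \<noteq> {}"
    and "\<And>t. t \<in> I \<Longrightarrow> \<bar>g t\<bar> \<le> K"
    and "\<And>t i. t \<in> I \<Longrightarrow> i < n \<Longrightarrow> \<bar>a t i\<bar> \<le> K"
    and "\<And>t i. t \<in> I \<Longrightarrow> i < n \<Longrightarrow> \<bar>c t i\<bar> \<le> K"
    and "\<And>t t' i. t \<in> I \<Longrightarrow> t' \<in> I \<Longrightarrow> i < n \<Longrightarrow> \<bar>a t i - a t' i\<bar> \<le> \<bar>c t i - c t' i\<bar>"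
  shows "rad n (\<lambda>s. SUP t\<in>I. g t + (\<Sum>i<n. s i * a t i))
       \<le> rad n (\<lambda>s. SUP t\<in>I. g t + (\<Sum>i<n. s i * c t i))"
  using assms(2-)
proof (induction n arbitrary: g K)
  case (Suc n)
  have K0: "0 \<le> K" using assms(1) Suc.prems(1) by fastforce
  define S where "S e s = (SUP t\<in>I. (g t + e t) + (\<Sum>i<n. s i * c t i))" for e :: "'t \<Rightarrow> real" and s :: "nat \<Rightarrow> real"
  have IH: "rad n (\<lambda>s. SUP t\<in>I. g t + (\<Sum>i<Suc n. (s(n := \<sigma>)) i * a t i)) \<le> rad n (S (\<lambda>t. \<sigma> * a t n))"
    if "\<sigma> = 1 \<or> \<sigma> = -1" for \<sigma>
  proof -
    have "rad n (\<lambda>s. SUP t\<in>I. g t + (\<Sum>i<Suc n. (s(n := \<sigma>)) i * a t i))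
       = rad n (\<lambda>s. SUP t\<in>I. (g t + \<sigma> * a t n) + (\<Sum>i<n. s i * a t i))"
      by (simp add: add_ac)
    also have "\<dots> \<le> rad n (\<lambda>s. SUP t\<in>I. (g t + \<sigma> * a t n) + (\<Sum>i<n. s i * c t i))"
    proof (rule Suc.IH[where K = "2 * K"])
      fix t assume t: "t \<in> I"
      show "\<bar>g t + \<sigma> * a t n\<bar> \<le> 2 * K"
        using Suc.prems(1)[OF t] Suc.prems(2)[OF t, of n] that by (auto simp: abs_if split: if_splits)
      show "\<bar>a t i\<bar> \<le> 2 * K" if "i < n" for i using Suc.prems(2)[OF t, of i] that K0 by simp
      show "\<bar>c t i\<bar> \<le> 2 * K" if "i < n" for i using Suc.prems(3)[OF t, of i] that K0 by simp
    qed (use Suc.prems(4) less_SucI in blast)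
    finally show ?thesis unfolding S_def .
  qed
  have bdd: "bdd_above ((\<lambda>t. (g t + e t) + (\<Sum>i<n. s i * c t i)) ` I)"
    if "s \<in> signs n" "\<And>t. t \<in> I \<Longrightarrow> \<bar>e t\<bar> \<le> K" for s e
  proof (rule bdd_above_abs_bounded)
    fix t assume t: "t \<in> I"
    have "\<bar>\<Sum>i<n. s i * c t i\<bar> \<le> (\<Sum>i<n. \<bar>s i * c t i\<bar>)" by (rule sum_abs)
    also have "\<dots> \<le> (\<Sum>i<n. K)"
      by (rule sum_mono) (use Suc.prems(3)[OF t] that(1) in \<open>auto simp: signs_def abs_mult\<close>)
    finally show "\<bar>g t + e t + (\<Sum>i<n. s i * c t i)\<bar> \<le> K + K + real n * K"
      using Suc.prems(1)[OF t] that(2)[OF t] by simp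
  qed
  have key: "S (\<lambda>t. 1 * a t n) s + S (\<lambda>t. -1 * a t n) s \<le> S (\<lambda>t. 1 * c t n) s + S (\<lambda>t. -1 * c t n) s"
    if s: "s \<in> signs n" for s
  proof -
    have bp: "(g t + 1 * c t n) + (\<Sum>i<n. s i * c t i) \<le> S (\<lambda>t. 1 * c t n) s" if "t \<in> I" for t
      unfolding S_def by (rule cSUP_upper[OF that bdd[OF s]]) (use Suc.prems(3) in auto)
    have bm: "(g t + -1 * c t n) + (\<Sum>i<n. s i * c t i) \<le> S (\<lambda>t. -1 * c t n) s" if "t \<in> I" for t
      unfolding S_def by (rule cSUP_upper[OF that bdd[OF s]]) (use Suc.prems(3) in auto)
    let ?R = "S (\<lambda>t. 1 * c t n) s + S (\<lambda>t. -1 * c t n) s"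
    \<comment> \<open>The two values of the last sign are tested at two indices t and t'. Whichever
      of \<open>c t n\<close> and \<open>c t' n\<close> is larger receives the plus sign; exchanging
      the roles of t and t' leaves the other terms unchanged.\<close>
    have pair: "((g t + 1 * a t n) + (\<Sum>i<n. s i * c t i)) + ((g t' + -1 * a t' n) + (\<Sum>i<n. s i * c t' i)) \<le> ?R"
      if "t \<in> I" "t' \<in> I" for t t'
      using bp[OF that(1)] bm[OF that(1)] bp[OF that(2)] bm[OF that(2)] Suc.prems(4)[OF that, of n]
      by (auto simp: abs_if split: if_splits)
    have "S (\<lambda>t. 1 * a t n) s \<le> ?R - ((g t' + -1 * a t' n) + (\<Sum>i<n. s i * c t' i))" if "t' \<in> I" for t'
      unfolding S_def[of "\<lambda>t. 1 * a t n"]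
      by (rule cSUP_least[OF assms(1)]) (use pair[OF _ that] in fastforce)
    then have "S (\<lambda>t. -1 * a t n) s \<le> ?R - S (\<lambda>t. 1 * a t n) s"
      unfolding S_def[of "\<lambda>t. -1 * a t n"]
      by (intro cSUP_least[OF assms(1)]) fastforce
    then show ?thesis by simp
  qed
  have "rad (Suc n) (\<lambda>s. SUP t\<in>I. g t + (\<Sum>i<Suc n. s i * a t i))
     \<le> (rad n (S (\<lambda>t. 1 * a t n)) + rad n (S (\<lambda>t. -1 * a t n))) / 2"
    unfolding rad.simps by (intro divide_right_mono add_mono IH) auto
  also have "\<dots> = rad n (\<lambda>s. S (\<lambda>t. 1 * a t n) s + S (\<lambda>t. -1 * a t n) s) / 2"
    by (simp add: rad_add)
  also have "\<dots> \<le> rad n (\<lambda>s. S (\<lambda>t. 1 * c t n) s + S (\<lambda>t. -1 * c t n) s) / 2"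
    by (intro divide_right_mono rad_mono key) auto
  also have "\<dots> = (rad n (S (\<lambda>t. 1 * c t n)) + rad n (S (\<lambda>t. -1 * c t n))) / 2"
    by (simp add: rad_add)
  also have "\<dots> = rad (Suc n) (\<lambda>s. SUP t\<in>I. g t + (\<Sum>i<Suc n. s i * c t i))"
  proof -
    have *: "S (\<lambda>t. \<sigma> * c t n) = (\<lambda>s. SUP t\<in>I. g t + (\<Sum>i<Suc n. (s(n := \<sigma>)) i * c t i))" for \<sigma>
      by (simp add: S_def add_ac fun_eq_iff)
    show ?thesis by (simp only: rad.simps *)
  qed
  finally show ?case .
qed simp

section \<open>Rademacher averages of the first layer\<close>

lemma enorm_L2: "enorm p x = L2_set x {..<p}"
  by (simp add: enorm_def L2_set_def)

lemma enorm_nonneg [simp]: "0 \<le> enorm p x"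
  by (simp add: enorm_def sum_nonneg)

lemma enorm_square: "(enorm p x)\<^sup>2 = (\<Sum>i<p. (x i)\<^sup>2)"
  by (simp add: enorm_def sum_nonneg)

lemma enorm_zero [simp]: "enorm p (\<lambda>_. 0) = 0"
  by (simp add: enorm_def)

lemma enorm_cmult: "enorm p (\<lambda>i. c * x i) = \<bar>c\<bar> * enorm p x"
  by (simp add: enorm_def power_mult_distrib sum_distrib_left[symmetric] real_sqrt_mult)

lemma inner_le_enorm: "\<bar>\<Sum>j<p. w j * x j\<bar> \<le> enorm p w * enorm p x"
proof -
  have "\<bar>\<Sum>j<p. w j * x j\<bar> \<le> (\<Sum>j<p. \<bar>w j\<bar> * \<bar>x j\<bar>)"
    by (rule order_trans[OF sum_abs]) (simp add: abs_mult)
  also have "\<dots> \<le> enorm p w * enorm p x"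
    unfolding enorm_L2 by (rule L2_set_mult_ineq)
  finally show ?thesis .
qed

section \<open>Slope of the sigmoid\<close>

lemma sigmoid_pos: "0 < sigmoid u" and sigmoid_less_1: "sigmoid u < 1"
  by (auto simp: sigmoid_def divide_simps add_pos_pos)

text \<open>The derivative is written as an even function with \<open>exp u + exp (- u)\<close> in
  the denominator, so that a quadratic lower bound for this sum becomes decay of the slope.\<close>

lemma sigmoid_deriv:
  "(sigmoid has_real_derivative 1 / (2 + exp u + exp (- u))) (at u)"
proof -
  have nz: "1 + exp (- u) \<noteq> 0" by (metis add_pos_pos exp_gt_zero less_irrefl zero_less_one)
  have eq: "exp u * exp (-u) = 1" by (simp add: exp_minus)
  have "(sigmoid has_real_derivative exp (- u) / (1 + exp (- u))\<^sup>2) (at u)"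
    unfolding sigmoid_def [abs_def]
    by (rule derivative_eq_intros refl nz | simp add: nz power2_eq_square)+
  also have "exp (- u) / (1 + exp (- u))\<^sup>2 = 1 / (2 + exp u + exp (- u))"
  proof -
    have "(1 + exp (- u))\<^sup>2 = exp (- u) * (2 + exp u + exp (- u))"
      using eq by (simp add: power2_eq_square algebra_simps)
    then show ?thesis by simp
  qed
  finally show ?thesis .
qed

lemma exp_plus_exp_minus_ge: "2 + v\<^sup>2 / 2 \<le> exp v + exp (- v)" for v :: real
proof -
  have *: "2 + v\<^sup>2 / 2 \<le> exp v + exp (- v)" if "0 \<le> v" for v :: real
    using exp_lower_Taylor_quadratic[OF that] exp_ge_add_one_self[of "- v"] by simp
  show ?thesis using *[of v] *[of "- v"] by (cases "0 \<le> v") (auto simp: add.commute)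
qed

lemma sigmoid_increment_le:
  assumes "\<And>v. min u u' \<le> v \<Longrightarrow> v \<le> max u u' \<Longrightarrow> 1 / (2 + exp v + exp (- v)) \<le> l"
  shows "\<bar>sigmoid u - sigmoid u'\<bar> \<le> l * \<bar>u - u'\<bar>"
proof -
  have *: "\<bar>sigmoid b - sigmoid a\<bar> \<le> l * \<bar>b - a\<bar>"
    if "a < b" "\<And>v. a \<le> v \<Longrightarrow> v \<le> b \<Longrightarrow> 1 / (2 + exp v + exp (- v)) \<le> l" for a b
  proof -
    have "\<exists>z>a. z < b \<and> sigmoid b - sigmoid a = (b - a) * (1 / (2 + exp z + exp (- z)))"
      by (rule MVT2[OF that(1)]) (rule sigmoid_deriv)
    then obtain z where z: "a < z" "z < b" "sigmoid b - sigmoid a = (b - a) * (1 / (2 + exp z + exp (- z)))" by blast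
    have "0 < 2 + exp z + exp (- z)" by (simp add: add_pos_pos)
    then have "\<bar>sigmoid b - sigmoid a\<bar> = (b - a) * (1 / (2 + exp z + exp (- z)))"
      using z that(1) by (simp add: abs_mult)
    also have "\<dots> \<le> (b - a) * l"
      by (rule mult_left_mono) (use z that in auto)
    finally show ?thesis using that(1) by (simp add: mult.commute)
  qed
  consider "u < u'" | "u = u'" | "u' < u" by linarith
  then show ?thesis
    by cases (use *[of u u'] *[of u' u] assms in \<open>auto simp: abs_minus_commute\<close>)
qed

lemma sigmoid_slope_le: "1 / (2 + exp v + exp (- v)) \<le> 1 / (4 + v\<^sup>2 / 2)" for v :: real
proof -
  have "0 < 4 + v\<^sup>2 / 2" by (intro add_pos_nonneg) auto
  moreover have "4 + v\<^sup>2 / 2 \<le> 2 + exp v + exp (- v)" using exp_plus_exp_minus_ge[of v] by simp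
  ultimately show ?thesis by (simp add: frac_le)
qed

lemma sigmoid_slope_le_quarter: "1 / (2 + exp v + exp (- v)) \<le> 1 / 4" for v :: real
proof (rule order_trans[OF sigmoid_slope_le])
  show "1 / (4 + v\<^sup>2 / 2) \<le> 1 / 4"
    by (rule divide_left_mono) (auto intro!: mult_pos_pos add_pos_nonneg)
qed

lemma sigmoid_lipschitz: "\<bar>sigmoid u - sigmoid u'\<bar> \<le> \<bar>u - u'\<bar> / 4"
  using sigmoid_increment_le[of u u' "1/4"] sigmoid_slope_le_quarter by simp

definition neuron :: "nat \<Rightarrow> (nat \<Rightarrow> real) \<times> real \<Rightarrow> (nat \<Rightarrow> real) \<Rightarrow> real" where
  "neuron p t y = (\<Sum>j<p. fst t j * y j) + snd t"

lemma abs_neuron_le: "\<bar>neuron p t y - snd t\<bar> \<le> enorm p (fst t) * enorm p y"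
  using inner_le_enorm[of "fst t" y p] by (simp add: neuron_def)

text \<open>Contraction replaces the sigmoid by its argument, scaled at the i-th sample point by the
  local slope bound \<open>l i\<close>. The argument is linear in weights and bias; Cauchy-Schwarz
  handles the weights and the bound \<open>\<beta>\<close> the bias. The constant
  \<open>\<theta>\<close> cancels in every increment, so centring is free here; it is what later
  makes block suprema nonnegative.\<close>

lemma rad_neuron_block:
  assumes T: "T \<noteq> {}" "\<And>t. t \<in> T \<Longrightarrow> enorm p (fst t) \<le> B \<and> \<bar>snd t\<bar> \<le> \<beta>"
    and l: "\<And>i. i < n \<Longrightarrow> 0 \<le> l i"
    and incr: "\<And>t t' i. t \<in> T \<Longrightarrow> t' \<in> T \<Longrightarrow> i < n \<Longrightarrow>
        \<bar>sigmoid (neuron p t (y i)) - sigmoid (neuron p t' (y i))\<bar>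
          \<le> l i * \<bar>neuron p t (y i) - neuron p t' (y i)\<bar>"
    and "0 \<le> \<theta>" "\<theta> \<le> 1"
  shows "rad n (\<lambda>s. SUP t\<in>T. \<Sum>i<n. s i * (sigmoid (neuron p t (y i)) - \<theta>))
       \<le> sqrt (\<Sum>i<n. (l i)\<^sup>2 * (B\<^sup>2 * (enorm p (y i))\<^sup>2)) + \<beta> * sqrt (\<Sum>i<n. (l i)\<^sup>2)"
proof -
  have B0: "0 \<le> B" and \<beta>0: "0 \<le> \<beta>"
    using T enorm_nonneg[of p] by (meson abs_ge_zero ex_in_conv order_trans)+
  have nb: "\<bar>neuron p t (y i)\<bar> \<le> B * enorm p (y i) + \<beta>" if "t \<in> T" for t i
  proof -
    have "enorm p (fst t) * enorm p (y i) \<le> B * enorm p (y i)"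
      using T(2)[OF that] by (intro mult_right_mono) auto
    then show ?thesis using abs_neuron_le[of p t "y i"] T(2)[OF that] by linarith
  qed
  define K where "K = 1 + (\<Sum>i<n. l i * (B * enorm p (y i) + \<beta>))"
  have lnb: "l i * (B * enorm p (y i) + \<beta>) \<le> K - 1" if "i < n" for i
    unfolding K_def using that B0 \<beta>0 l
    by (auto intro!: member_le_sum[of i "{..<n}" "\<lambda>i. l i * (B * enorm p (y i) + \<beta>)"] sum_nonneg)
  have K1: "1 \<le> K" unfolding K_def using l B0 \<beta>0 by (auto intro!: sum_nonneg)
  have "rad n (\<lambda>s. SUP t\<in>T. 0 + (\<Sum>i<n. s i * (sigmoid (neuron p t (y i)) - \<theta>)))
     \<le> rad n (\<lambda>s. SUP t\<in>T. 0 + (\<Sum>i<n. s i * (l i * neuron p t (y i))))"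
  proof (rule rad_contraction[where K = K])
    fix t i assume t: "t \<in> T" and i: "i < n"
    show "\<bar>sigmoid (neuron p t (y i)) - \<theta>\<bar> \<le> K"
      using sigmoid_pos[of "neuron p t (y i)"] sigmoid_less_1[of "neuron p t (y i)"] K1 assms(5,6)
      by linarith
    have "\<bar>l i * neuron p t (y i)\<bar> = l i * \<bar>neuron p t (y i)\<bar>" using l[OF i] by (simp add: abs_mult)
    also have "\<dots> \<le> l i * (B * enorm p (y i) + \<beta>)" by (rule mult_left_mono[OF nb[OF t] l[OF i]])
    finally show "\<bar>l i * neuron p t (y i)\<bar> \<le> K" using lnb[OF i] by simp
    fix t' assume t': "t' \<in> T"
    show "\<bar>sigmoid (neuron p t (y i)) - \<theta> - (sigmoid (neuron p t' (y i)) - \<theta>)\<bar>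
        \<le> \<bar>l i * neuron p t (y i) - l i * neuron p t' (y i)\<bar>"
      using incr[OF t t' i] l[OF i] by (simp add: right_diff_distrib[symmetric] abs_mult)
  qed (use T K1 in auto)
  also have "\<dots> \<le> rad n (\<lambda>s. B * enorm p (\<lambda>j. \<Sum>i<n. s i * (l i * y i j)) + \<beta> * \<bar>\<Sum>i<n. s i * l i\<bar>)"
  proof (rule rad_mono, rule cSUP_least[OF T(1)])
    fix s t assume t: "t \<in> T"
    let ?v = "\<lambda>j. \<Sum>i<n. s i * (l i * y i j)"
    have "(\<Sum>i<n. s i * (l i * neuron p t (y i)))
        = (\<Sum>i<n. \<Sum>j<p. fst t j * (s i * (l i * y i j))) + snd t * (\<Sum>i<n. s i * l i)"
      by (simp add: neuron_def sum_distrib_left sum.distrib[symmetric] algebra_simps)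
    also have "(\<Sum>i<n. \<Sum>j<p. fst t j * (s i * (l i * y i j))) = (\<Sum>j<p. fst t j * ?v j)"
      by (subst sum.swap) (simp add: sum_distrib_left)
    also have "(\<Sum>j<p. fst t j * ?v j) \<le> B * enorm p ?v"
      by (rule order_trans[OF order_trans[OF abs_ge_self inner_le_enorm]])
         (use T(2)[OF t] in \<open>auto intro: mult_right_mono\<close>)
    also have "snd t * (\<Sum>i<n. s i * l i) \<le> \<beta> * \<bar>\<Sum>i<n. s i * l i\<bar>"
      by (rule order_trans[OF abs_ge_self]) (use T(2)[OF t] in \<open>auto simp: abs_mult intro: mult_right_mono\<close>)
    finally show "0 + (\<Sum>i<n. s i * (l i * neuron p t (y i))) \<le> B * enorm p ?v + \<beta> * \<bar>\<Sum>i<n. s i * l i\<bar>"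
      by simp
  qed
  also have "\<dots> = B * rad n (\<lambda>s. enorm p (\<lambda>j. \<Sum>i<n. s i * (l i * y i j))) + \<beta> * rad n (\<lambda>s. \<bar>\<Sum>i<n. s i * l i\<bar>)"
    by (simp add: rad_add rad_cmult)
  also have "\<dots> \<le> B * sqrt (\<Sum>i<n. (enorm p (\<lambda>j. l i * y i j))\<^sup>2) + \<beta> * sqrt (\<Sum>i<n. (l i)\<^sup>2)"
    by (intro add_mono mult_left_mono rad_enorm_le rad_abs_linear_le B0 \<beta>0)
  also have "B * sqrt (\<Sum>i<n. (enorm p (\<lambda>j. l i * y i j))\<^sup>2)
      = sqrt (B\<^sup>2 * (\<Sum>i<n. (enorm p (\<lambda>j. l i * y i j))\<^sup>2))"
    using B0 by (simp add: real_sqrt_mult)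
  also have "B\<^sup>2 * (\<Sum>i<n. (enorm p (\<lambda>j. l i * y i j))\<^sup>2) = (\<Sum>i<n. (l i)\<^sup>2 * (B\<^sup>2 * (enorm p (y i))\<^sup>2))"
    by (simp add: enorm_cmult power_mult_distrib sum_distrib_left mult_ac)
  finally show ?thesis by simp
qed

text \<open>Bounds \<open>R\<^sup>2\<close> times the slope of \<open>sigmoid\<close> at any \<open>v\<close> with \<open>R \<le> \<bar>v\<bar> + B * enorm p y\<close>.\<close>

definition slope_weight :: "nat \<Rightarrow> real \<Rightarrow> (nat \<Rightarrow> real) \<Rightarrow> real" where
  "slope_weight p B y = 4 + B\<^sup>2 * (enorm p y)\<^sup>2 / 2"

lemma slope_weight_ge: "4 \<le> slope_weight p B y"
  by (simp add: slope_weight_def)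

text \<open>A small neuron value at bias of size R forces \<open>B * enorm p y\<close> to be of size
  R, so the slope is O(weight / R^2) throughout. The bias itself contributes only a factor 2 R, and
  the block costs O(1 / R).\<close>

lemma rad_far_block:
  fixes p :: nat
  assumes "0 < R" "0 \<le> B" "\<sigma> = 1 \<or> \<sigma> = -1"
  defines "T \<equiv> {t. enorm p (fst t) \<le> B \<and> R \<le> \<sigma> * snd t \<and> \<sigma> * snd t \<le> 2 * R}"
  shows "rad n (\<lambda>s. SUP t\<in>T. \<Sum>i<n. s i * (sigmoid (neuron p t (y i)) - sigmoid (\<sigma> * R)))
       \<le> 3 / R * sqrt (\<Sum>i<n. (slope_weight p B (y i))\<^sup>2)"
proof -
  \<comment> \<open>Both bounds are used together: when \<open>(l i)^2\<close> meets the squared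
    length of \<open>y i\<close>, one factor is bounded by 1/4 and the other by the decaying term.
    The result stays quadratic in \<open>slope_weight\<close> and thus within fourth
    moments.\<close>
  define l where "l i = min (1/4) (slope_weight p B (y i) / R\<^sup>2)" for i
  have m4: "4 \<le> slope_weight p B (y i)" for i by (rule slope_weight_ge)
  have l0: "0 \<le> l i" for i using m4[of i] by (simp add: l_def)
  have l_le: "l i \<le> 1/4" "l i \<le> slope_weight p B (y i) / R\<^sup>2" for i
    unfolding l_def by (rule min.cobounded1, rule min.cobounded2)
  have half_le: "u / 2 \<le> u" if "0 \<le> u" for u :: real using that by simp
  have slope: "1 / (2 + exp v + exp (- v)) \<le> l i" if "R \<le> \<bar>v\<bar> + B * enorm p (y i)" for v i
  proof -
    let ?e = "B * enorm p (y i)"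
    have "R\<^sup>2 \<le> (\<bar>v\<bar> + ?e)\<^sup>2" using that assms(1) by (intro power_mono) auto
    also have "\<dots> \<le> 2 * v\<^sup>2 + 2 * ?e\<^sup>2"
      using zero_le_power2[of "\<bar>v\<bar> - ?e"] by (simp add: power2_sum power2_diff)
    \<comment> \<open>With e = \<open>B * enorm p (y i)\<close> the product expands to 16 + 2 v^2 +
      2 e^2 + v^2 e^2 / 4.\<close>
    also have "\<dots> \<le> slope_weight p B (y i) * (4 + v\<^sup>2 / 2)"
    proof -
      have "2 * a + 2 * b \<le> (4 + b / 2) * (4 + a / 2)" if "0 \<le> a * b" for a b :: real
        using that by (simp add: algebra_simps)
      from this[of "v\<^sup>2" "?e\<^sup>2"] show ?thesis by (simp add: slope_weight_def power_mult_distrib)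
    qed
    finally have "R\<^sup>2 \<le> slope_weight p B (y i) * (4 + v\<^sup>2 / 2)" .
    then have "1 / (4 + v\<^sup>2 / 2) \<le> slope_weight p B (y i) / R\<^sup>2"
      using assms(1) by (simp add: divide_simps add_pos_nonneg)
    then show ?thesis
      using sigmoid_slope_le[of v] sigmoid_slope_le_quarter[of v] by (simp add: l_def)
  qed
  have far: "R \<le> \<sigma> * neuron p t (y i) + B * enorm p (y i)" if "t \<in> T" for t i
  proof -
    have "\<bar>neuron p t (y i) - snd t\<bar> \<le> B * enorm p (y i)"
      by (rule order_trans[OF abs_neuron_le]) (use that in \<open>auto simp: T_def intro: mult_right_mono\<close>)
    then show ?thesis using that assms(3) by (auto simp: T_def)
  qed
  have "rad n (\<lambda>s. SUP t\<in>T. \<Sum>i<n. s i * (sigmoid (neuron p t (y i)) - sigmoid (\<sigma> * R)))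
      \<le> sqrt (\<Sum>i<n. (l i)\<^sup>2 * (B\<^sup>2 * (enorm p (y i))\<^sup>2)) + 2 * R * sqrt (\<Sum>i<n. (l i)\<^sup>2)"
  proof (rule rad_neuron_block[OF _ _ l0])
    have "(\<lambda>_. 0, \<sigma> * R) \<in> T" using assms(1-3) by (auto simp: T_def)
    then show "T \<noteq> {}" by blast
    fix t t' i assume t: "t \<in> T" "t' \<in> T"
    show "\<bar>sigmoid (neuron p t (y i)) - sigmoid (neuron p t' (y i))\<bar>
        \<le> l i * \<bar>neuron p t (y i) - neuron p t' (y i)\<bar>"
    proof (rule sigmoid_increment_le, rule slope)
      \<comment> \<open>Both neuron values, multiplied by \<open>\<sigma>\<close>, are at least
        \<open>R - B * enorm p (y i)\<close>, hence so is everything between them.\<close>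
      fix v assume "min (neuron p t (y i)) (neuron p t' (y i)) \<le> v" "v \<le> max (neuron p t (y i)) (neuron p t' (y i))"
      then have "R \<le> \<sigma> * v + B * enorm p (y i)"
        using far[OF t(1), of i] far[OF t(2), of i] assms(3) by (auto simp: min_def max_def split: if_splits)
      then show "R \<le> \<bar>v\<bar> + B * enorm p (y i)" using assms(3) by auto
    qed
  qed (use assms(1,3) sigmoid_pos[of "\<sigma> * R"] sigmoid_less_1[of "\<sigma> * R"] in \<open>auto simp: T_def\<close>)
  also have "\<dots> \<le> sqrt (\<Sum>i<n. (slope_weight p B (y i))\<^sup>2) / R + 2 * R * (sqrt (\<Sum>i<n. (slope_weight p B (y i))\<^sup>2) / R\<^sup>2)"
  proof (intro add_mono mult_left_mono)
    have "(l i)\<^sup>2 * (B\<^sup>2 * (enorm p (y i))\<^sup>2) \<le> (slope_weight p B (y i))\<^sup>2 / R\<^sup>2" for i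
    proof -
      have "(l i)\<^sup>2 \<le> 1/4 * (slope_weight p B (y i) / R\<^sup>2)"
        unfolding power2_eq_square[of "l i"]
        by (rule mult_mono[OF l_le(1) l_le(2) _ l0]) simp
      then have "(l i)\<^sup>2 * (B\<^sup>2 * (enorm p (y i))\<^sup>2) \<le> (1/4 * (slope_weight p B (y i) / R\<^sup>2)) * (2 * slope_weight p B (y i))"
        by (rule mult_mono) (use m4[of i] in \<open>auto simp: slope_weight_def\<close>)
      also have "\<dots> = (slope_weight p B (y i))\<^sup>2 / R\<^sup>2 / 2" by (simp add: power2_eq_square)
      also have "\<dots> \<le> (slope_weight p B (y i))\<^sup>2 / R\<^sup>2"
        by (rule half_le) simp
      finally show ?thesis .
    qed
    then have "sqrt (\<Sum>i<n. (l i)\<^sup>2 * (B\<^sup>2 * (enorm p (y i))\<^sup>2)) \<le> sqrt (\<Sum>i<n. (slope_weight p B (y i))\<^sup>2 / R\<^sup>2)"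
      by (intro real_sqrt_le_mono sum_mono)
    then show "sqrt (\<Sum>i<n. (l i)\<^sup>2 * (B\<^sup>2 * (enorm p (y i))\<^sup>2)) \<le> sqrt (\<Sum>i<n. (slope_weight p B (y i))\<^sup>2) / R"
      using assms(1) by (simp add: sum_divide_distrib[symmetric] real_sqrt_divide)
    have "(l i)\<^sup>2 \<le> (slope_weight p B (y i))\<^sup>2 / (R\<^sup>2)\<^sup>2" for i
      unfolding power_divide[symmetric] by (rule power_mono) (use l0[of i] in \<open>auto simp: l_def\<close>)
    then have "sqrt (\<Sum>i<n. (l i)\<^sup>2) \<le> sqrt (\<Sum>i<n. (slope_weight p B (y i))\<^sup>2 / (R\<^sup>2)\<^sup>2)"
      by (intro real_sqrt_le_mono sum_mono)
    then show "sqrt (\<Sum>i<n. (l i)\<^sup>2) \<le> sqrt (\<Sum>i<n. (slope_weight p B (y i))\<^sup>2) / R\<^sup>2"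
      by (simp only: sum_divide_distrib[symmetric] real_sqrt_divide real_sqrt_abs abs_power2)
  qed (use assms(1) in auto)
  also have "\<dots> = 3 / R * sqrt (\<Sum>i<n. (slope_weight p B (y i))\<^sup>2)"
    using assms(1) by (simp add: power2_eq_square field_simps)
  finally show ?thesis .
qed

lemma rad_near_block:
  fixes p :: nat
  assumes "0 \<le> R" "0 \<le> B"
  defines "T \<equiv> {t. enorm p (fst t) \<le> B \<and> \<bar>snd t\<bar> \<le> R}"
  shows "rad n (\<lambda>s. SUP t\<in>T. \<Sum>i<n. s i * (sigmoid (neuron p t (y i)) - sigmoid 0))
       \<le> (sqrt (\<Sum>i<n. 2 * slope_weight p B (y i)) + R * sqrt (real n)) / 4"
proof -
  have "rad n (\<lambda>s. SUP t\<in>T. \<Sum>i<n. s i * (sigmoid (neuron p t (y i)) - sigmoid 0))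
       \<le> sqrt (\<Sum>i<n. (1/4)\<^sup>2 * (B\<^sup>2 * (enorm p (y i))\<^sup>2)) + R * sqrt (\<Sum>i<n. (1/4)\<^sup>2)"
  proof (rule rad_neuron_block)
    have "(\<lambda>_. 0, 0) \<in> T" using assms(1,2) by (auto simp: T_def)
    then show "T \<noteq> {}" by blast
  qed (use sigmoid_lipschitz in \<open>auto simp: T_def sigmoid_def\<close>)
  also have "sqrt (\<Sum>i<n. (1/4)\<^sup>2 * (B\<^sup>2 * (enorm p (y i))\<^sup>2)) = sqrt (\<Sum>i<n. B\<^sup>2 * (enorm p (y i))\<^sup>2) / 4"
    by (simp only: sum_distrib_left[symmetric] real_sqrt_mult) simp
  also have "sqrt (\<Sum>i<n. B\<^sup>2 * (enorm p (y i))\<^sup>2) \<le> sqrt (\<Sum>i<n. 2 * slope_weight p B (y i))"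
    by (intro real_sqrt_le_mono sum_mono) (simp add: slope_weight_def)
  also have "R * sqrt (\<Sum>i<n. (1/4)\<^sup>2) = R * sqrt (real n) / 4"
    by (simp add: real_sqrt_mult real_sqrt_divide power_divide)
  finally show ?thesis by (simp add: add_divide_distrib)
qed

declare layer.simps [simp del]

text \<open>Finitely many dyadic blocks control only bounded biases; the full first layer is the
  increasing union of its truncations.\<close>

lemma cSUP_mono_tendsto:
  fixes h :: "'t \<Rightarrow> real"
  assumes "\<And>N. S N \<noteq> {}" "incseq S" "bdd_above (h ` (\<Union>N. S N))"
  shows "(\<lambda>N. SUP t\<in>S N. h t) \<longlonglongrightarrow> (SUP t\<in>(\<Union>N. S N). h t)"
proof (rule LIMSEQ_I)
  fix \<epsilon> :: real assume "0 < \<epsilon>"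
  let ?M = "SUP t\<in>(\<Union>N. S N). h t"
  have "?M - \<epsilon> < ?M" using \<open>0 < \<epsilon>\<close> by simp
  then obtain t where t: "t \<in> (\<Union>N. S N)" "?M - \<epsilon> < h t"
    using less_cSUP_iff[of "\<Union>N. S N" h "?M - \<epsilon>"] assms(1,3) by auto
  from t(1) obtain N0 where N0: "t \<in> S N0" by blast
  have "norm ((SUP t\<in>S N. h t) - ?M) < \<epsilon>" if "N0 \<le> N" for N
  proof -
    have bd: "bdd_above (h ` S N)" by (rule bdd_above_mono[OF assms(3)]) auto
    have "t \<in> S N" using assms(2) N0 that by (auto simp: incseq_def)
    then have "h t \<le> (SUP t\<in>S N. h t)" by (rule cSUP_upper[OF _ bd])
    moreover have "(SUP t\<in>S N. h t) \<le> ?M"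
      by (rule cSUP_subset_mono[OF assms(1) assms(3)]) auto
    ultimately show ?thesis using t(2) by simp
  qed
  then show "\<exists>N0. \<forall>N\<ge>N0. norm ((SUP t\<in>S N. h t) - ?M) < \<epsilon>" by blast
qed

lemma abs_signed_sum_le:
  assumes "s \<in> signs n" "\<And>i. i < n \<Longrightarrow> \<bar>x i\<bar> \<le> K"
  shows "\<bar>\<Sum>i<n. s i * x i\<bar> \<le> real n * K"
proof -
  have "\<bar>\<Sum>i<n. s i * x i\<bar> \<le> (\<Sum>i<n. \<bar>s i * x i\<bar>)" by (rule sum_abs)
  also have "\<dots> \<le> (\<Sum>i<n. K)"
    by (rule sum_mono) (use assms in \<open>auto simp: signs_def abs_mult\<close>)
  finally show ?thesis by simp
qed

lemma dyadic_cover: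
  fixes R :: real
  assumes "R < x" "x \<le> 2 ^ N * R"
  shows "\<exists>k<N. 2 ^ k * R \<le> x \<and> x \<le> 2 * (2 ^ k * R)"
  using assms(2)
proof (induction N)
  case (Suc N)
  show ?case
  proof (cases "x \<le> 2 ^ N * R")
    case True then show ?thesis using Suc.IH less_SucI by blast
  next
    case False then show ?thesis using Suc.prems by (intro exI[of _ N]) auto
  qed
qed (use assms(1) in auto)

text \<open>The natural bound contains the square root of the sum of squared weights. It is
  linearised here, so that its expectation involves only the mean of the squared
  \<open>slope_weight\<close>. The constants absorb rounding and the factor 2 for absolute
  values.\<close>

definition first_layer_bound :: "nat \<Rightarrow> real \<Rightarrow> nat \<Rightarrow> (nat \<Rightarrow> nat \<Rightarrow> real) \<Rightarrow> real" where
  "first_layer_bound p B n y =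
     16 * sqrt (real n * real p)
     + 14 * (\<Sum>i<n. (slope_weight p B (y i))\<^sup>2) / (real p * sqrt (real n * real p))"

text \<open>The bound is free of N because the blocks at bias \<open>2 ^ k * sqrt p\<close>
  contribute a geometric series. In the innermost block the biases up to \<open>sqrt p\<close> cost
  sqrt (n p), the order that the weights cost anyway.\<close>

lemma rad_first_layer_truncated:
  assumes "1 \<le> p" "1 \<le> n" "0 \<le> B"
  shows "rad n (\<lambda>s. max 0 (SUP t\<in>{t. enorm p (fst t) \<le> B \<and> \<bar>snd t\<bar> \<le> 2 ^ N * sqrt p}.
            \<Sum>i<n. s i * sigmoid (neuron p t (y i))))
       \<le> first_layer_bound p B n y / 2"
proof -
  let ?R = "sqrt (real p)"
  define Q where "Q = (\<Sum>i<n. (slope_weight p B (y i))\<^sup>2)"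
  define T0 where "T0 = {t. enorm p (fst t) \<le> B \<and> \<bar>snd t\<bar> \<le> ?R}"
  define T where "T k \<sigma> = {t. enorm p (fst t) \<le> B \<and> 2 ^ k * ?R \<le> \<sigma> * snd t \<and> \<sigma> * snd t \<le> 2 * (2 ^ k * ?R)}"
    for k :: nat and \<sigma> :: real
  define S0 where "S0 s = (SUP t\<in>T0. \<Sum>i<n. s i * (sigmoid (neuron p t (y i)) - sigmoid 0))" for s
  define S where "S k \<sigma> s = (SUP t\<in>T k \<sigma>. \<Sum>i<n. s i * (sigmoid (neuron p t (y i)) - sigmoid (\<sigma> * (2 ^ k * ?R))))"
    for k \<sigma> s
  have p0: "0 < ?R" using assms(1) by simp
  have bdd: "bdd_above ((\<lambda>t. \<Sum>i<n. s i * (sigmoid (neuron p t (y i)) - sigmoid \<theta>)) ` A)"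
    if "s \<in> signs n" for s \<theta> A
  proof (rule bdd_above_abs_bounded, rule abs_signed_sum_le[OF that, of _ 1])
    fix t i
    show "\<bar>sigmoid (neuron p t (y i)) - sigmoid \<theta>\<bar> \<le> 1"
      using sigmoid_pos[of "neuron p t (y i)"] sigmoid_less_1[of "neuron p t (y i)"]
        sigmoid_pos[of \<theta>] sigmoid_less_1[of \<theta>] by linarith
  qed
  have le_S0: "(\<Sum>i<n. s i * (sigmoid (neuron p t (y i)) - sigmoid 0)) \<le> S0 s"
    if "s \<in> signs n" "t \<in> T0" for s t
    unfolding S0_def by (rule cSUP_upper[OF that(2) bdd[OF that(1)]])
  have le_S: "(\<Sum>i<n. s i * (sigmoid (neuron p t (y i)) - sigmoid (\<sigma> * (2 ^ k * ?R)))) \<le> S k \<sigma> s"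
    if "s \<in> signs n" "t \<in> T k \<sigma>" for s t k \<sigma>
    unfolding S_def by (rule cSUP_upper[OF that(2) bdd[OF that(1)]])
  \<comment> \<open>Each block contains a neuron with zero weights whose value is the centring
    constant, so its centred supremum is nonnegative. Hence the sum over all blocks dominates the
    supremum over their union.\<close>
  have S0_nonneg: "0 \<le> S0 s" if "s \<in> signs n" for s
    using le_S0[OF that, of "(\<lambda>_. 0, 0)"] assms(3) by (simp add: T0_def neuron_def)
  have S_nonneg: "0 \<le> S k \<sigma> s" if "s \<in> signs n" "\<sigma> = 1 \<or> \<sigma> = -1" for s k \<sigma>
    using le_S[OF that(1), of "(\<lambda>_. 0, \<sigma> * (2 ^ k * ?R))" k \<sigma>] assms(3) that(2) by (auto simp: T_def neuron_def)
  let ?U = "\<lambda>s. \<bar>\<Sum>i<n. s i * 1\<bar> + S0 s + (\<Sum>k<N. S k 1 s + S k (-1) s)"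
  \<comment> \<open>Undoing the centring costs \<open>sigmoid \<theta>\<close> times the sum of the
    signs. As this factor lies in (0, 1), the same single term serves all blocks.\<close>
  have off: "(\<Sum>i<n. s i * sigmoid (neuron p t (y i)))
     \<le> (\<Sum>i<n. s i * (sigmoid (neuron p t (y i)) - sigmoid \<theta>)) + \<bar>\<Sum>i<n. s i * 1\<bar>" for s t \<theta>
  proof -
    have "(\<Sum>i<n. s i * sigmoid (neuron p t (y i)))
       = (\<Sum>i<n. s i * (sigmoid (neuron p t (y i)) - sigmoid \<theta>)) + sigmoid \<theta> * (\<Sum>i<n. s i)"
      by (simp add: sum_distrib_left sum.distrib[symmetric] algebra_simps)
    also have "sigmoid \<theta> * (\<Sum>i<n. s i) \<le> 1 * \<bar>\<Sum>i<n. s i\<bar>"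
      by (rule order_trans[OF abs_ge_self])
         (use sigmoid_pos[of \<theta>] sigmoid_less_1[of \<theta>] in \<open>auto simp: abs_mult intro!: mult_left_le_one_le\<close>)
    finally show ?thesis by simp
  qed
  have "rad n (\<lambda>s. max 0 (SUP t\<in>{t. enorm p (fst t) \<le> B \<and> \<bar>snd t\<bar> \<le> 2 ^ N * sqrt p}.
            \<Sum>i<n. s i * sigmoid (neuron p t (y i)))) \<le> rad n ?U"
  proof (rule rad_mono, rule max.boundedI)
    show "0 \<le> ?U s" if "s \<in> signs n" for s
      using S0_nonneg[OF that] S_nonneg[OF that] by (auto intro!: add_nonneg_nonneg sum_nonneg)
  next
    fix s assume s: "s \<in> signs n"
    show "(SUP t\<in>{t. enorm p (fst t) \<le> B \<and> \<bar>snd t\<bar> \<le> 2 ^ N * sqrt p}.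
            \<Sum>i<n. s i * sigmoid (neuron p t (y i))) \<le> ?U s"
    proof (rule cSUP_least)
      have "(\<lambda>_. 0, 0) \<in> {t. enorm p (fst t) \<le> B \<and> \<bar>snd t\<bar> \<le> 2 ^ N * sqrt p}" using assms(3) by simp
      then show "{t. enorm p (fst t) \<le> B \<and> \<bar>snd t\<bar> \<le> 2 ^ N * sqrt p} \<noteq> {}" by blast
      fix t assume t: "t \<in> {t. enorm p (fst t) \<le> B \<and> \<bar>snd t\<bar> \<le> 2 ^ N * sqrt p}"
      have nn: "0 \<le> S k 1 s + S k (-1) s" for k using S_nonneg[OF s] by simp
      show "(\<Sum>i<n. s i * sigmoid (neuron p t (y i))) \<le> ?U s"
      proof (cases "\<bar>snd t\<bar> \<le> ?R")
        case True
        then have "t \<in> T0" using t by (simp add: T0_def)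
        moreover have "0 \<le> (\<Sum>k<N. S k 1 s + S k (-1) s)" by (intro sum_nonneg nn)
        ultimately show ?thesis using le_S0[OF s, of t] off[of s t 0] by simp
      next
        case False
        then obtain k where k: "k < N" "2 ^ k * ?R \<le> \<bar>snd t\<bar>" "\<bar>snd t\<bar> \<le> 2 * (2 ^ k * ?R)"
          using dyadic_cover[of ?R "\<bar>snd t\<bar>" N] t by auto
        define \<sigma> where "\<sigma> = (if 0 \<le> snd t then 1 else - 1 :: real)"
        have \<sigma>: "\<sigma> = 1 \<or> \<sigma> = -1" "\<sigma> * snd t = \<bar>snd t\<bar>" by (auto simp: \<sigma>_def)
        have "t \<in> T k \<sigma>" using t k \<sigma> by (simp add: T_def)
        from le_S[OF s this] have "(\<Sum>i<n. s i * sigmoid (neuron p t (y i))) \<le> S k \<sigma> s + \<bar>\<Sum>i<n. s i * 1\<bar>"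
          using off[of s t "\<sigma> * (2 ^ k * ?R)"] by simp
        also have "S k \<sigma> s \<le> S k 1 s + S k (-1) s" using \<sigma>(1) S_nonneg[OF s, of 1 k] S_nonneg[OF s, of "-1" k] by auto
        also have "\<dots> \<le> (\<Sum>k<N. S k 1 s + S k (-1) s)"
          by (rule member_le_sum[of k "{..<N}" "\<lambda>k. S k 1 s + S k (-1) s"]) (use k(1) nn in auto)
        finally show ?thesis using S0_nonneg[OF s] by simp
      qed
    qed
  qed
  also have "rad n ?U = rad n (\<lambda>s. \<bar>\<Sum>i<n. s i * 1\<bar>) + rad n S0 + (\<Sum>k<N. rad n (S k 1) + rad n (S k (-1)))"
    by (simp only: rad_add rad_sum finite_lessThan)
  also have "\<dots> \<le> sqrt n + (sqrt (\<Sum>i<n. 2 * slope_weight p B (y i)) + ?R * sqrt (real n)) / 4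
       + (\<Sum>k<N. 3 / (2 ^ k * ?R) * sqrt Q + 3 / (2 ^ k * ?R) * sqrt Q)"
  proof (intro add_mono sum_mono)
    show "rad n (\<lambda>s. \<bar>\<Sum>i<n. s i * 1\<bar>) \<le> sqrt n" using rad_abs_linear_le[of n "\<lambda>_. 1"] by simp
    show "rad n S0 \<le> (sqrt (\<Sum>i<n. 2 * slope_weight p B (y i)) + ?R * sqrt (real n)) / 4"
      unfolding S0_def T0_def by (rule rad_near_block) (use assms in auto)
    show "rad n (S k 1) \<le> 3 / (2 ^ k * ?R) * sqrt Q" "rad n (S k (-1)) \<le> 3 / (2 ^ k * ?R) * sqrt Q" for k
      unfolding S_def T_def Q_def by (rule rad_far_block; use p0 assms in simp)+
  qed
  also have "(\<Sum>k<N. 3 / (2 ^ k * ?R) * sqrt Q + 3 / (2 ^ k * ?R) * sqrt Q) \<le> 12 * sqrt Q / ?R"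
  proof -
    have "(\<Sum>k<N. 3 / (2 ^ k * ?R) * sqrt Q + 3 / (2 ^ k * ?R) * sqrt Q) = 6 * sqrt Q / ?R * (\<Sum>k<N. (1/2) ^ k)"
      by (auto simp: sum_distrib_left power_divide intro!: sum.cong)
    also have "\<dots> \<le> 6 * sqrt Q / ?R * 2"
      by (rule mult_left_mono) (simp_all add: sum_gp_strict Q_def sum_nonneg)
    finally show ?thesis by simp
  qed
  \<comment> \<open>AM-GM in the form 2 w \<le> p + w^2 / p turns the first powers from the
    innermost block into the squares that occur in the far blocks.\<close>
  also have "sqrt (\<Sum>i<n. 2 * slope_weight p B (y i)) \<le> sqrt (real n * real p) + sqrt (Q / p)"
  proof -
    have "(\<Sum>i<n. 2 * slope_weight p B (y i)) \<le> (\<Sum>i<n. real p + (slope_weight p B (y i))\<^sup>2 / p)"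
    proof (rule sum_mono)
      fix i
      have "2 * p * slope_weight p B (y i) \<le> p\<^sup>2 + (slope_weight p B (y i))\<^sup>2"
        using zero_le_power2[of "real p - slope_weight p B (y i)"] by (simp add: power2_diff)
      then show "2 * slope_weight p B (y i) \<le> real p + (slope_weight p B (y i))\<^sup>2 / p"
        using assms(1) by (simp add: field_simps power2_eq_square)
    qed
    also have "\<dots> = real n * real p + Q / p" by (simp add: sum.distrib Q_def sum_divide_distrib)
    finally have "sqrt (\<Sum>i<n. 2 * slope_weight p B (y i)) \<le> sqrt (real n * real p + Q / p)" by simp
    also have "\<dots> \<le> sqrt (real n * real p) + sqrt (Q / p)"
      by (rule sqrt_add_le_add_sqrt) (auto simp: Q_def sum_nonneg)
    finally show ?thesis .
  qed
  finally have "rad n (\<lambda>s. max 0 (SUP t\<in>{t. enorm p (fst t) \<le> B \<and> \<bar>snd t\<bar> \<le> 2 ^ N * sqrt p}.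
            \<Sum>i<n. s i * sigmoid (neuron p t (y i))))
     \<le> sqrt n + (sqrt (real n * real p) + sqrt (Q / p) + ?R * sqrt (real n)) / 4 + 12 * sqrt Q / ?R"
    by simp
  then have main: "rad n (\<lambda>s. max 0 (SUP t\<in>{t. enorm p (fst t) \<le> B \<and> \<bar>snd t\<bar> \<le> 2 ^ N * sqrt p}.
            \<Sum>i<n. s i * sigmoid (neuron p t (y i))))
     \<le> sqrt n + (sqrt (real n * real p) + sqrt (Q / p) + ?R * sqrt (real n)) / 4 + 12 * (sqrt Q / ?R)"
    by simp
  define a where "a = sqrt (real n * real p)"
  have a0: "0 < a" using assms by (simp add: a_def)
  have "sqrt n \<le> a" using assms(1) mult_left_mono[of 1 "real p" "real n"] by (simp add: a_def)
  moreover have "?R * sqrt (real n) = a" by (simp add: a_def real_sqrt_mult)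
  moreover have "sqrt Q / ?R = sqrt (Q / p)" by (simp add: real_sqrt_divide)
  moreover have "sqrt (Q / p) \<le> (Q / p / a + a) / 2"
  proof -
    have q: "(sqrt (Q / p))\<^sup>2 = Q / p" by (simp add: Q_def sum_nonneg)
    have "2 * a * sqrt (Q / p) \<le> Q / p + a\<^sup>2"
      using zero_le_power2[of "sqrt (Q / p) - a"] unfolding power2_diff q by (simp add: mult_ac)
    then have "sqrt (Q / p) \<le> (Q / p + a\<^sup>2) / (2 * a)"
      using a0 by (simp add: pos_le_divide_eq mult_ac)
    also have "\<dots> = (Q / p / a + a) / 2"
      using a0 by (simp add: add_divide_distrib power2_eq_square)
    finally show ?thesis .
  qed
  moreover have "0 \<le> Q / p / a" using a0 by (simp add: Q_def sum_nonneg)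
  moreover have "first_layer_bound p B n y = 16 * a + 14 * (Q / p / a)"
    by (simp add: first_layer_bound_def Q_def a_def)
  moreover have "x \<le> f / 2" if "sn \<le> a" "r = a" "w = u" "u \<le> (v + a) / 2" "0 \<le> v" "f = 16 * a + 14 * v"
      "x \<le> sn + (a + u + r) / 4 + 12 * w" for x f sn r w u v :: real
    using that a0 by argo
  ultimately show ?thesis using main[folded a_def] by blast
qed

section \<open>Two-sided Rademacher suprema and the passage through the layers\<close>

definition rsup :: "nat \<Rightarrow> (nat \<Rightarrow> 'a) \<Rightarrow> ('a \<Rightarrow> real) set \<Rightarrow> real" where
  "rsup n y G = rad n (\<lambda>s. SUP g\<in>G. \<bar>\<Sum>i<n. s i * g (y i)\<bar>)"

text \<open>The absolute value is at most \<open>H\<close> at the signs plus \<open>H\<close> at the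
  negated signs, both being nonnegative, and negating all signs preserves the average. Since
  \<open>rad_contraction\<close> is one-sided, this is where the factor 2 of each ReLU layer
  arises.\<close>

lemma rad_abs_SUP_le:
  fixes h :: "'t \<Rightarrow> nat \<Rightarrow> real"
  assumes "T \<noteq> {}" "\<And>t i. t \<in> T \<Longrightarrow> i < n \<Longrightarrow> \<bar>h t i\<bar> \<le> K"
    and nonneg: "\<And>s. s \<in> signs n \<Longrightarrow> 0 \<le> H s"
    and le: "\<And>s t. s \<in> signs n \<Longrightarrow> t \<in> T \<Longrightarrow> (\<Sum>i<n. s i * h t i) \<le> H s"
  shows "rad n (\<lambda>s. SUP t\<in>T. \<bar>\<Sum>i<n. s i * h t i\<bar>) \<le> 2 * rad n H"
proof -
  have "rad n (\<lambda>s. SUP t\<in>T. \<bar>\<Sum>i<n. s i * h t i\<bar>) \<le> rad n (\<lambda>s. H s + H (\<lambda>i. - s i))"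
  proof (rule rad_mono, rule cSUP_least[OF assms(1)])
    fix s t assume s: "s \<in> signs n" and t: "t \<in> T"
    then have s': "(\<lambda>i. - s i) \<in> signs n" by (auto simp: signs_def)
    show "\<bar>\<Sum>i<n. s i * h t i\<bar> \<le> H s + H (\<lambda>i. - s i)"
      using le[OF s t] le[OF s' t] nonneg[OF s] nonneg[OF s'] by (simp add: sum_negf)
  qed
  also have "\<dots> = 2 * rad n H" by (simp add: rad_add rad_neg)
  finally show ?thesis .
qed

lemma layer_1: "layer p B (Suc 0) = (\<lambda>t x. sigmoid (neuron p t x)) ` {t. enorm p (fst t) \<le> B}"
  by (auto simp: layer.simps neuron_def enorm_def image_def)

lemma rsup_first_layer:
  assumes "1 \<le> p" "1 \<le> n" "0 \<le> B"
  shows "rsup n y (layer p B (Suc 0)) \<le> first_layer_bound p B n y"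
proof -
  define T where "T N = {t. enorm p (fst t) \<le> B \<and> \<bar>snd t\<bar> \<le> 2 ^ N * sqrt p}" for N :: nat
  have sig1: "\<bar>sigmoid u\<bar> \<le> 1" for u
    using sigmoid_pos[of u] sigmoid_less_1[of u] by simp
  have bdd: "bdd_above ((\<lambda>t. \<Sum>i<n. s i * sigmoid (neuron p t (y i))) ` A)" if "s \<in> signs n" for s A
    by (rule bdd_above_abs_bounded, rule abs_signed_sum_le[OF that, of _ 1]) (rule sig1)
  have UT: "(\<Union>N. T N) = {t. enorm p (fst t) \<le> B}"
  proof -
    have "\<exists>N. x \<le> 2 ^ N * sqrt p" for x :: real
    proof -
      obtain N where "x < 2 ^ N" using real_arch_pow[of 2 x] by auto
      also have "2 ^ N \<le> 2 ^ N * sqrt p" using assms(1) by simp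
      finally show ?thesis by (blast intro: less_imp_le)
    qed
    then show ?thesis by (auto simp: T_def)
  qed
  have mem: "(\<lambda>_. 0, 0) \<in> T N" for N using assms(3) by (simp add: T_def)
  have inc: "incseq T"
  proof (rule incseq_SucI, rule subsetI)
    fix N t assume "t \<in> T N"
    moreover have "2 ^ N * sqrt p \<le> 2 ^ Suc N * sqrt p" by simp
    ultimately show "t \<in> T (Suc N)" unfolding T_def by (auto intro: order_trans)
  qed
  let ?H = "\<lambda>s. max 0 (SUP t\<in>(\<Union>N. T N). \<Sum>i<n. s i * sigmoid (neuron p t (y i)))"
  have "(\<lambda>N. rad n (\<lambda>s. max 0 (SUP t\<in>T N. \<Sum>i<n. s i * sigmoid (neuron p t (y i))))) \<longlonglongrightarrow> rad n ?H"
    by (intro rad_tendsto tendsto_max tendsto_const cSUP_mono_tendsto inc bdd) (use mem in blast)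
  then have H: "rad n ?H \<le> first_layer_bound p B n y / 2"
    by (rule LIMSEQ_le_const2) (use rad_first_layer_truncated[OF assms] in \<open>auto simp: T_def\<close>)
  have "rsup n y (layer p B (Suc 0))
      = rad n (\<lambda>s. SUP t\<in>(\<Union>N. T N). \<bar>\<Sum>i<n. s i * sigmoid (neuron p t (y i))\<bar>)"
    unfolding rsup_def layer_1 UT image_image ..
  also have "\<dots> \<le> 2 * rad n ?H"
  proof (rule rad_abs_SUP_le[where K = 1])
    show "(\<Union>N. T N) \<noteq> {}" using mem by blast
    show "(\<Sum>i<n. s i * sigmoid (neuron p t (y i))) \<le> ?H s"
      if "s \<in> signs n" "t \<in> (\<Union>N. T N)" for s t
      by (rule max.coboundedI2, rule cSUP_upper[OF that(2) bdd[OF that(1)]])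
  qed (auto simp: sig1)
  finally show ?thesis using H by simp
qed

text \<open>The absolutely convex hull. The input of a ReLU node and the output of a network both
  range over such a hull.\<close>

definition l1_hull :: "('a \<Rightarrow> real) set \<Rightarrow> ('a \<Rightarrow> real) set" where
  "l1_hull G = {(\<lambda>x. \<Sum>(a, g)\<leftarrow>ws. a * g x) | ws. set (map snd ws) \<subseteq> G \<and> (\<Sum>(a, g)\<leftarrow>ws. \<bar>a\<bar>) \<le> 1}"

lemma DNN_l1_hull: "DNN p B L = l1_hull (layer p B (L - 1))"
  by (simp add: DNN_def l1_hull_def)

lemma layer_Suc_Suc: "layer p B (Suc (Suc l)) = (\<lambda>h x. max (h x) 0) ` l1_hull (layer p B (Suc l))"
  by (auto simp: layer.simps l1_hull_def image_def)

lemma l1_hull_zero: "(\<lambda>_. 0) \<in> l1_hull G"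
  unfolding l1_hull_def by (rule CollectI, rule exI[of _ "[]"]) simp

lemma subset_l1_hull: "G \<subseteq> l1_hull G"
proof
  fix g assume "g \<in> G"
  then show "g \<in> l1_hull G"
    unfolding l1_hull_def by (intro CollectI exI[of _ "[(1, g)]"]) auto
qed

lemma l1_hull_uminus:
  assumes "h \<in> l1_hull G"
  shows "(\<lambda>x. - h x) \<in> l1_hull G"
proof -
  obtain ws where ws: "h = (\<lambda>x. \<Sum>(a, g)\<leftarrow>ws. a * g x)" "set (map snd ws) \<subseteq> G" "(\<Sum>(a, g)\<leftarrow>ws. \<bar>a\<bar>) \<le> 1"
    using assms by (auto simp: l1_hull_def)
  let ?vs = "map (\<lambda>(a, g). (- a, g)) ws"
  have "- (\<Sum>(a, g)\<leftarrow>ws. a * g x) = (\<Sum>(a, g)\<leftarrow>?vs. a * g x)" for x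
    by (induction ws) auto
  moreover have "set (map snd ?vs) = set (map snd ws)" by force
  moreover have "(\<Sum>(a, g)\<leftarrow>?vs. \<bar>a\<bar>) = (\<Sum>(a, g)\<leftarrow>ws. \<bar>a\<bar>)"
    by (simp add: case_prod_unfold comp_def)
  ultimately show ?thesis
    unfolding l1_hull_def using ws by (intro CollectI exI[of _ ?vs]) auto
qed

text \<open>A linear functional is bounded on the hull by its bound on the generators. The free
  index set covers signed sums, evaluation at a point, and differences of two values.\<close>

lemma l1_hull_functional_le:
  assumes "h \<in> l1_hull G" "0 \<le> M"
    and le: "\<And>g. g \<in> G \<Longrightarrow> \<bar>\<Sum>i\<in>I. c i * g (z i)\<bar> \<le> M"
  shows "\<bar>\<Sum>i\<in>I. c i * h (z i)\<bar> \<le> M"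
proof -
  obtain ws where ws: "h = (\<lambda>x. \<Sum>(a, g)\<leftarrow>ws. a * g x)" "set (map snd ws) \<subseteq> G" "(\<Sum>(a, g)\<leftarrow>ws. \<bar>a\<bar>) \<le> 1"
    using assms(1) by (auto simp: l1_hull_def)
  have "\<bar>\<Sum>i\<in>I. c i * (\<Sum>(a, g)\<leftarrow>ws. a * g (z i))\<bar> \<le> (\<Sum>(a, g)\<leftarrow>ws. \<bar>a\<bar>) * M"
    using ws(2)
  proof (induction ws)
    case (Cons w ws)
    obtain a g where w: "w = (a, g)" by fastforce
    have "(\<Sum>i\<in>I. c i * (\<Sum>(a, g)\<leftarrow>w # ws. a * g (z i)))
        = a * (\<Sum>i\<in>I. c i * g (z i)) + (\<Sum>i\<in>I. c i * (\<Sum>(a, g)\<leftarrow>ws. a * g (z i)))"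
      by (simp add: w sum_distrib_left sum.distrib[symmetric] algebra_simps)
    moreover have "\<bar>a * (\<Sum>i\<in>I. c i * g (z i))\<bar> \<le> \<bar>a\<bar> * M"
      unfolding abs_mult by (rule mult_left_mono[OF le]) (use Cons.prems w in auto)
    moreover have "\<bar>\<Sum>i\<in>I. c i * (\<Sum>(a, g)\<leftarrow>ws. a * g (z i))\<bar> \<le> (\<Sum>(a, g)\<leftarrow>ws. \<bar>a\<bar>) * M"
      by (rule Cons.IH) (use Cons.prems in auto)
    ultimately show ?case by (simp add: w algebra_simps)
  qed simp
  also have "\<dots> \<le> 1 * M" by (rule mult_right_mono) (use ws(3) assms(2) in auto)
  finally show ?thesis using ws(1) by simp
qed

lemma l1_hull_abs_le: "h \<in> l1_hull G \<Longrightarrow> (\<And>g. g \<in> G \<Longrightarrow> \<bar>g x\<bar> \<le> M) \<Longrightarrow> 0 \<le> M \<Longrightarrow> \<bar>h x\<bar> \<le> M"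
  using l1_hull_functional_le[where I = "{()}" and c = "\<lambda>_. 1" and z = "\<lambda>_. x"] by simp

lemma l1_hull_diff_le:
  assumes "h \<in> l1_hull G" "\<And>g. g \<in> G \<Longrightarrow> \<bar>g x - g y\<bar> \<le> M" "0 \<le> M"
  shows "\<bar>h x - h y\<bar> \<le> M"
  using l1_hull_functional_le[where I = UNIV and c = "\<lambda>b. if b then 1 else -1" and z = "\<lambda>b. if b then x else y"] assms
  by (simp add: UNIV_bool)

lemma rsup_hull_le:
  assumes "G \<noteq> {}" "\<And>g x. g \<in> G \<Longrightarrow> \<bar>g x\<bar> \<le> 1"
  shows "rsup n y (l1_hull G) \<le> rsup n y G"
  unfolding rsup_def
proof (rule rad_mono, rule cSUP_least)
  fix s h assume s: "s \<in> signs n" and h: "h \<in> l1_hull G"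
  have bdd: "bdd_above ((\<lambda>g. \<bar>\<Sum>i<n. s i * g (y i)\<bar>) ` G)"
    by (rule bdd_above_abs_bounded, simp only: abs_idempotent, rule abs_signed_sum_le[OF s]) (rule assms(2))
  have ub: "\<bar>\<Sum>i<n. s i * g (y i)\<bar> \<le> (SUP g\<in>G. \<bar>\<Sum>i<n. s i * g (y i)\<bar>)" if "g \<in> G" for g
    by (rule cSUP_upper[OF that bdd])
  show "\<bar>\<Sum>i<n. s i * h (y i)\<bar> \<le> (SUP g\<in>G. \<bar>\<Sum>i<n. s i * g (y i)\<bar>)"
    by (rule l1_hull_functional_le[OF h _ ub]) (use assms(1) ub in \<open>force intro: order_trans[OF abs_ge_zero]\<close>)
qed (use l1_hull_zero in blast)

text \<open>Range and Lipschitz constant do not deteriorate with depth, because the weights of a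
  node have l1 norm at most 1 and ReLU is 1-Lipschitz. Nonnegativity lets a node pass unchanged
  through later ReLUs.\<close>

lemma layer_props:
  assumes "0 \<le> B" "g \<in> layer p B (Suc l)"
  shows "0 \<le> g x" "g x \<le> 1" "\<bar>g x - g y\<bar> \<le> B * enorm p (\<lambda>i. x i - y i)"
proof -
  have "\<forall>g\<in>layer p B (Suc l). \<forall>x y. 0 \<le> g x \<and> g x \<le> 1 \<and> \<bar>g x - g y\<bar> \<le> B * enorm p (\<lambda>i. x i - y i)"
  proof (induction l)
    case 0
    show ?case
    proof (intro ballI allI)
      fix g x y assume "g \<in> layer p B (Suc 0)"
      then obtain t where g: "g = (\<lambda>x. sigmoid (neuron p t x))" and t: "enorm p (fst t) \<le> B"
        by (auto simp: layer_1)
      have "\<bar>g x - g y\<bar> \<le> \<bar>neuron p t x - neuron p t y\<bar>"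
        unfolding g by (rule order_trans[OF sigmoid_lipschitz]) simp
      also have "neuron p t x - neuron p t y = (\<Sum>j<p. fst t j * (x j - y j))"
        by (simp add: neuron_def sum_subtractf algebra_simps)
      also have "\<bar>\<dots>\<bar> \<le> enorm p (fst t) * enorm p (\<lambda>i. x i - y i)" by (rule inner_le_enorm)
      also have "\<dots> \<le> B * enorm p (\<lambda>i. x i - y i)" using t by (intro mult_right_mono) auto
      finally show "0 \<le> g x \<and> g x \<le> 1 \<and> \<bar>g x - g y\<bar> \<le> B * enorm p (\<lambda>i. x i - y i)"
        unfolding g using sigmoid_pos sigmoid_less_1 by (auto intro: less_imp_le)
    qed
  next
    case (Suc l)
    show ?case
    proof (intro ballI allI)
      fix g x y assume "g \<in> layer p B (Suc (Suc l))"
      then obtain h where g: "g = (\<lambda>x. max (h x) 0)" and h: "h \<in> l1_hull (layer p B (Suc l))"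
        unfolding layer_Suc_Suc by auto
      have "\<bar>h x\<bar> \<le> 1" by (rule l1_hull_abs_le[OF h]) (use Suc.IH in auto)
      moreover have "\<bar>h x - h y\<bar> \<le> B * enorm p (\<lambda>i. x i - y i)"
        by (rule l1_hull_diff_le[OF h]) (use Suc.IH assms(1) in auto)
      ultimately show "0 \<le> g x \<and> g x \<le> 1 \<and> \<bar>g x - g y\<bar> \<le> B * enorm p (\<lambda>i. x i - y i)"
        unfolding g by (auto simp: max_def)
    qed
  qed
  then show "0 \<le> g x" "g x \<le> 1" "\<bar>g x - g y\<bar> \<le> B * enorm p (\<lambda>i. x i - y i)"
    using assms(2) by blast+
qed

text \<open>A nonnegative node fed with weight 1 into a ReLU is reproduced. In this way single
  sigmoid neurons are available as discriminators at every depth.\<close>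

lemma layer_subset_Suc:
  assumes "0 \<le> B"
  shows "layer p B (Suc l) \<subseteq> layer p B (Suc (Suc l))"
proof
  fix g assume g: "g \<in> layer p B (Suc l)"
  have "g = (\<lambda>x. max (g x) 0)" using layer_props(1)[OF assms g] by (simp add: max_absorb1)
  then show "g \<in> layer p B (Suc (Suc l))"
    unfolding layer_Suc_Suc using subset_l1_hull[of "layer p B (Suc l)"] g by blast
qed

lemma first_layer_subset:
  assumes "0 \<le> B"
  shows "layer p B (Suc 0) \<subseteq> layer p B (Suc l)"
  by (induction l) (use layer_subset_Suc[OF assms] in blast)+

lemma layer_nonempty: "0 \<le> B \<Longrightarrow> layer p B (Suc l) \<noteq> {}"
proof -
  assume B: "0 \<le> B"
  then have "(\<lambda>_. 0, 0) \<in> {t :: (nat \<Rightarrow> real) \<times> real. enorm p (fst t) \<le> B}" by simp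
  then have "layer p B (Suc 0) \<noteq> {}" unfolding layer_1 by blast
  then show ?thesis using first_layer_subset[OF B] by blast
qed

text \<open>The hull of the previous layer contains 0, so the one-sided supremum is nonnegative, as
  \<open>rad_abs_SUP_le\<close> requires. Contraction then removes the ReLU, and passing from the
  hull to its generators costs nothing.\<close>

lemma rsup_layer_Suc:
  assumes "0 \<le> B"
  shows "rsup n y (layer p B (Suc (Suc l))) \<le> 2 * rsup n y (layer p B (Suc l))"
proof -
  let ?G = "l1_hull (layer p B (Suc l))"
  have G1: "\<bar>h x\<bar> \<le> 1" if "h \<in> ?G" for h x
    by (rule l1_hull_abs_le[OF that]) (use layer_props(1,2)[OF assms] in auto)
  have bdd: "bdd_above ((\<lambda>h. \<Sum>i<n. s i * f (h (y i))) ` ?G)"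
    if "s \<in> signs n" "\<And>u. \<bar>f u\<bar> \<le> \<bar>u\<bar>" for s and f :: "real \<Rightarrow> real"
    by (rule bdd_above_abs_bounded, rule abs_signed_sum_le[OF that(1)]) (use that(2) G1 order_trans in blast)
  let ?H = "\<lambda>s. SUP h\<in>?G. \<Sum>i<n. s i * max (h (y i)) 0"
  have H_upper: "(\<Sum>i<n. s i * max (h (y i)) 0) \<le> ?H s" if "s \<in> signs n" "h \<in> ?G" for s h
    by (rule cSUP_upper[OF that(2) bdd[OF that(1)]]) auto
  have "rsup n y (layer p B (Suc (Suc l))) = rad n (\<lambda>s. SUP h\<in>?G. \<bar>\<Sum>i<n. s i * max (h (y i)) 0\<bar>)"
    unfolding rsup_def layer_Suc_Suc image_image ..
  also have "\<dots> \<le> 2 * rad n ?H"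
  proof (rule rad_abs_SUP_le[where K = 1])
    show "?G \<noteq> {}" using l1_hull_zero by blast
    show "0 \<le> ?H s" if "s \<in> signs n" for s
      using H_upper[OF that l1_hull_zero] by simp
    show "\<bar>max (h (y i)) 0\<bar> \<le> 1" if "h \<in> ?G" for h i
      using G1[OF that, of "y i"] by auto
    show "(\<Sum>i<n. s i * max (h (y i)) 0) \<le> ?H s" if "s \<in> signs n" "h \<in> ?G" for s h
      by (rule H_upper[OF that])
  qed
  also have "rad n ?H \<le> rad n (\<lambda>s. SUP h\<in>?G. \<Sum>i<n. s i * h (y i))"
  proof -
    have "rad n (\<lambda>s. SUP h\<in>?G. 0 + (\<Sum>i<n. s i * max (h (y i)) 0))
        \<le> rad n (\<lambda>s. SUP h\<in>?G. 0 + (\<Sum>i<n. s i * h (y i)))"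
    proof (rule rad_contraction[where K = 1])
      show "?G \<noteq> {}" using l1_hull_zero by blast
      show "\<bar>max (h (y i)) 0\<bar> \<le> 1" "\<bar>h (y i)\<bar> \<le> 1" if "h \<in> ?G" for h i
        using G1[OF that, of "y i"] by auto
      show "\<bar>max (h (y i)) 0 - max (h' (y i)) 0\<bar> \<le> \<bar>h (y i) - h' (y i)\<bar>" for h h' :: "(nat \<Rightarrow> real) \<Rightarrow> real" and i
        by (auto simp: max_def)
    qed simp
    then show ?thesis by simp
  qed
  also have "\<dots> \<le> rsup n y ?G"
    unfolding rsup_def
  proof (rule rad_mono, rule cSUP_mono)
    fix s assume s: "s \<in> signs n"
    show "bdd_above ((\<lambda>h. \<bar>\<Sum>i<n. s i * h (y i)\<bar>) ` ?G)"
      by (rule bdd_above_abs_bounded, simp only: abs_idempotent, rule abs_signed_sum_le[OF s]) (rule G1)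
  qed (use l1_hull_zero abs_ge_self in blast)+
  also have "\<dots> \<le> rsup n y (layer p B (Suc l))"
    by (rule rsup_hull_le[OF layer_nonempty[OF assms]]) (use layer_props(1,2)[OF assms] in auto)
  finally show ?thesis by simp
qed

lemma rsup_layer:
  assumes "1 \<le> p" "1 \<le> n" "0 \<le> B"
  shows "rsup n y (layer p B (Suc l)) \<le> 2 ^ l * first_layer_bound p B n y"
proof (induction l)
  case 0 then show ?case using rsup_first_layer[OF assms] by simp
next
  case (Suc l)
  then show ?case using rsup_layer_Suc[OF assms(3), of n y p l] by simp
qed

lemma rsup_DNN:
  assumes "1 \<le> p" "1 \<le> n" "0 \<le> B" "2 \<le> L"
  shows "rsup n y (DNN p B L) \<le> 2 ^ (L - 2) * first_layer_bound p B n y"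
proof -
  \<comment> \<open>The last hidden layer has index L - 1 and layer 1 is the sigmoid layer, so L - 2
    ReLU layers contribute a factor 2 each.\<close>
  have L: "L - 1 = Suc (L - 2)" using assms(4) by simp
  have "rsup n y (DNN p B L) \<le> rsup n y (layer p B (Suc (L - 2)))"
    unfolding DNN_l1_hull L
    by (rule rsup_hull_le[OF layer_nonempty[OF assms(3)]]) (use layer_props(1,2)[OF assms(3)] in auto)
  then show ?thesis using rsup_layer[OF assms(1-3), of y "L - 2"] by linarith
qed

lemma DNN_props:
  assumes "0 \<le> B" "2 \<le> L" "f \<in> DNN p B L"
  shows "\<bar>f x\<bar> \<le> 1" "\<bar>f x - f y\<bar> \<le> B * enorm p (\<lambda>i. x i - y i)"
proof -
  have L: "L - 1 = Suc (L - 2)" using assms(2) by simp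
  note f = assms(3)[unfolded DNN_l1_hull L]
  show "\<bar>f x\<bar> \<le> 1" by (rule l1_hull_abs_le[OF f]) (use layer_props(1,2)[OF assms(1)] in auto)
  show "\<bar>f x - f y\<bar> \<le> B * enorm p (\<lambda>i. x i - y i)"
    by (rule l1_hull_diff_le[OF f]) (use layer_props(3)[OF assms(1)] assms(1) in auto)
qed

text \<open>Both signs are wanted because the discrepancy inequality for the estimator is one-sided
  in f.\<close>

lemma sigmoid_neuron_in_DNN:
  assumes "0 \<le> B" "2 \<le> L" "enorm p (fst t) \<le> B"
  shows "(\<lambda>x. sigmoid (neuron p t x)) \<in> DNN p B L" "(\<lambda>x. - sigmoid (neuron p t x)) \<in> DNN p B L"
proof -
  have L: "L - 1 = Suc (L - 2)" using assms(2) by simp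
  have "(\<lambda>x. sigmoid (neuron p t x)) \<in> layer p B (Suc 0)" unfolding layer_1 using assms(3) by blast
  then show "(\<lambda>x. sigmoid (neuron p t x)) \<in> DNN p B L"
    unfolding DNN_l1_hull L using first_layer_subset[OF assms(1)] subset_l1_hull by blast
  then show "(\<lambda>x. - sigmoid (neuron p t x)) \<in> DNN p B L"
    unfolding DNN_l1_hull by (rule l1_hull_uminus)
qed

section \<open>The bounded differences inequality\<close>

text \<open>The last coordinate is integrated first. Around its conditional mean, \<open>F\<close>
  is confined to an interval of length 2 c, so Hoeffding's lemma gives one factor
  \<open>exp (l^2 * c^2 / 2)\<close>; the conditional mean inherits all hypotheses in one coordinate
  less. The nonnegative integral spares integrability of the exponentials.\<close>

lemma mgf_bounded_differences:
  fixes M :: "'a measure"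
  assumes "prob_space M" "0 < l"
  assumes "F \<in> borel_measurable (PiM {..<n} (\<lambda>_. M))"
    and "\<And>X. X \<in> space (PiM {..<n} (\<lambda>_. M)) \<Longrightarrow> \<bar>F X\<bar> \<le> K"
    and "\<And>X i x. X \<in> space (PiM {..<n} (\<lambda>_. M)) \<Longrightarrow> i < n \<Longrightarrow> x \<in> space M \<Longrightarrow> \<bar>F X - F (X(i := x))\<bar> \<le> c"
  shows "(\<integral>\<^sup>+X. exp (l * (F X - (\<integral>Y. F Y \<partial>PiM {..<n} (\<lambda>_. M)))) \<partial>PiM {..<n} (\<lambda>_. M))
      \<le> ennreal (exp (real n * (l\<^sup>2 * c\<^sup>2 / 2)))"
  using assms(3-)
proof (induction n arbitrary: F)
  case 0
  interpret prob_space "PiM {} (\<lambda>_. M)" by (intro prob_space_PiM) simp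
  have "(\<integral>Y. F Y \<partial>PiM {} (\<lambda>_. M)) = F (\<lambda>_. undefined)"
    by (simp add: PiM_empty lebesgue_integral_count_space_finite)
  then show ?case
    by (simp add: PiM_empty nn_integral_count_space_finite)
next
  case (Suc n)
  interpret M: prob_space M by fact
  interpret P: product_sigma_finite "\<lambda>_::nat. M" by unfold_locales
  let ?P = "PiM {..<n} (\<lambda>_. M)" and ?P' = "PiM {..<Suc n} (\<lambda>_. M)"
  interpret P: prob_space ?P by (intro prob_space_PiM) (rule assms(1))
  interpret P': prob_space ?P' by (intro prob_space_PiM) (rule assms(1))
  have ins: "{..<Suc n} = insert n {..<n}" by auto
  note [measurable] = Suc.prems(1)
  have F_ins: "F \<in> borel_measurable (PiM (insert n {..<n}) (\<lambda>_. M))" using Suc.prems(1) by (simp add: ins)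
  have upd: "X(n := x) \<in> space ?P'" if "X \<in> space ?P" "x \<in> space M" for X x
    using that by (auto simp: ins space_PiM PiE_iff extensional_def)
  have meas: "(\<lambda>x. F (X(n := x))) \<in> borel_measurable M" if "X \<in> space ?P" for X
    using measurable_comp[OF measurable_component_update[OF that, of n] F_ins] by (simp add: comp_def)
  have int: "integrable M (\<lambda>x. F (X(n := x)))" if "X \<in> space ?P" for X
    by (rule M.integrable_const_bound[OF _ meas[OF that], of K])
       (use Suc.prems(2) upd[OF that] in \<open>auto intro!: AE_I2\<close>)
  define F' where "F' X = (\<integral>x. F (X(n := x)) \<partial>M)" for X
  have intF: "integrable ?P' F"
    by (rule P'.integrable_const_bound[of _ K]) (use Suc.prems in \<open>auto intro!: AE_I2\<close>)
  have EF: "(\<integral>Y. F Y \<partial>?P') = (\<integral>Y. F' Y \<partial>?P)"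
    unfolding F'_def ins by (rule P.product_integral_insert) (use intF ins in auto)
  have F'_meas: "F' \<in> borel_measurable ?P"
  proof -
    have "(\<lambda>(X, x). F (X(n := x))) \<in> borel_measurable (?P \<Otimes>\<^sub>M M)"
      using measurable_comp[OF measurable_add_dim F_ins] by (simp add: comp_def case_prod_unfold)
    then show ?thesis unfolding F'_def by (rule M.borel_measurable_lebesgue_integral)
  qed
  have F'_bd: "\<bar>F' X\<bar> \<le> K" if "X \<in> space ?P" for X
  proof -
    have "\<bar>F' X\<bar> \<le> (\<integral>x. \<bar>F (X(n := x))\<bar> \<partial>M)" unfolding F'_def by (rule integral_abs_bound)
    also have "\<dots> \<le> (\<integral>x. K \<partial>M)"
      by (rule integral_mono) (use int[OF that] Suc.prems(2) upd[OF that] in auto)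
    finally show ?thesis by (simp add: M.prob_space)
  qed
  have diff_bd: "\<bar>\<integral>x. G x \<partial>M\<bar> \<le> c" if "integrable M G" "\<And>x. x \<in> space M \<Longrightarrow> \<bar>G x\<bar> \<le> c" for G :: "'a \<Rightarrow> real"
  proof -
    have "\<bar>\<integral>x. G x \<partial>M\<bar> \<le> (\<integral>x. \<bar>G x\<bar> \<partial>M)" by (rule integral_abs_bound)
    also have "\<dots> \<le> (\<integral>x. c \<partial>M)" by (rule integral_mono) (use that in auto)
    finally show ?thesis by (simp add: M.prob_space)
  qed
  have F'_diff: "\<bar>F' X - F' (X(i := x))\<bar> \<le> c" if X: "X \<in> space ?P" and "i < n" "x \<in> space M" for X i x
  proof -
    have X': "X(i := x) \<in> space ?P" using that by (auto simp: space_PiM PiE_iff extensional_def)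
    have "F' X - F' (X(i := x)) = (\<integral>z. F (X(n := z)) - F (X(i := x, n := z)) \<partial>M)"
      unfolding F'_def by (rule Bochner_Integration.integral_diff[symmetric]) (use int X X' in auto)
    also have "\<bar>\<dots>\<bar> \<le> c"
    proof (rule diff_bd)
      fix z assume z: "z \<in> space M"
      have "X(i := x, n := z) = X(n := z, i := x)" using that(2) by (intro fun_upd_twist) auto
      moreover have "\<bar>F (X(n := z)) - F (X(n := z, i := x))\<bar> \<le> c"
        by (rule Suc.prems(3)[OF upd[OF X z] less_SucI[OF that(2)] that(3)])
      ultimately show "\<bar>F (X(n := z)) - F (X(i := x, n := z))\<bar> \<le> c" by (simp only:)
    qed (use int X X' in auto)
    finally show ?thesis .
  qed
  have inner: "(\<integral>\<^sup>+x. exp (l * (F (X(n := x)) - F' X)) \<partial>M) \<le> ennreal (exp (l\<^sup>2 * c\<^sup>2 / 2))"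
    if X: "X \<in> space ?P" for X
  proof -
    have *: "\<bar>F (X(n := x)) - F' X\<bar> \<le> c" if x: "x \<in> space M" for x
    proof -
      have "F (X(n := x)) - F' X = (\<integral>z. F (X(n := x)) - F (X(n := z)) \<partial>M)"
        unfolding F'_def using int[OF X] by (simp add: M.prob_space)
      also have "\<bar>\<dots>\<bar> \<le> c"
      proof (rule diff_bd)
        fix z assume z: "z \<in> space M"
        have "\<bar>F (X(n := x)) - F (X(n := x, n := z))\<bar> \<le> c"
          by (rule Suc.prems(3)[OF upd[OF X x] lessI z])
        then show "\<bar>F (X(n := x)) - F (X(n := z))\<bar> \<le> c" by (simp only: fun_upd_upd)
      qed (use int[OF X] in simp)
      finally show ?thesis .
    qed
    interpret H: interval_bounded_random_variable M "\<lambda>x. F (X(n := x)) - F' X" "- c" c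
    proof unfold_locales
      show "AE x in M. F (X(n := x)) - F' X \<in> {- c..c}"
      proof (rule AE_I2)
        fix x assume "x \<in> space M"
        from abs_le_D1[OF *[OF this]] abs_le_D2[OF *[OF this]]
        show "F (X(n := x)) - F' X \<in> {- c..c}" by simp
      qed
    qed (use meas[OF X] in simp)
    have "(\<integral>\<^sup>+x. exp (l * (F (X(n := x)) - F' X)) \<partial>M) \<le> ennreal (exp (l\<^sup>2 * (c - - c)\<^sup>2 / 8))"
      by (rule H.Hoeffdings_lemma_nn_integral_0[OF assms(2)])
         (use int[OF X] in \<open>simp add: M.prob_space F'_def\<close>)
    also have "l\<^sup>2 * (c - - c)\<^sup>2 / 8 = l\<^sup>2 * c\<^sup>2 / 2" by (simp add: power2_eq_square)
    finally show ?thesis .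
  qed
  let ?e = "\<integral>Y. F' Y \<partial>?P"
  have "(\<integral>\<^sup>+X. exp (l * (F X - ?e)) \<partial>?P')
      = (\<integral>\<^sup>+X. (\<integral>\<^sup>+x. exp (l * (F (X(n := x)) - ?e)) \<partial>M) \<partial>?P)"
    unfolding ins by (rule P.product_nn_integral_insert) (use F_ins in auto)
  also have "\<dots> = (\<integral>\<^sup>+X. (\<integral>\<^sup>+x. ennreal (exp (l * (F' X - ?e))) * ennreal (exp (l * (F (X(n := x)) - F' X))) \<partial>M) \<partial>?P)"
    by (simp add: ennreal_mult[symmetric] exp_add[symmetric] algebra_simps)
  also have "\<dots> \<le> (\<integral>\<^sup>+X. ennreal (exp (l * (F' X - ?e))) * ennreal (exp (l\<^sup>2 * c\<^sup>2 / 2)) \<partial>?P)"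
  proof (rule nn_integral_mono)
    fix X assume X: "X \<in> space ?P"
    have "(\<integral>\<^sup>+x. ennreal (exp (l * (F' X - ?e))) * ennreal (exp (l * (F (X(n := x)) - F' X))) \<partial>M)
        = ennreal (exp (l * (F' X - ?e))) * (\<integral>\<^sup>+x. exp (l * (F (X(n := x)) - F' X)) \<partial>M)"
      by (rule nn_integral_cmult) (use meas[OF X] in measurable)
    also have "\<dots> \<le> ennreal (exp (l * (F' X - ?e))) * ennreal (exp (l\<^sup>2 * c\<^sup>2 / 2))"
      by (rule mult_left_mono[OF inner[OF X]]) simp
    finally show "(\<integral>\<^sup>+x. ennreal (exp (l * (F' X - ?e))) * ennreal (exp (l * (F (X(n := x)) - F' X))) \<partial>M)
        \<le> ennreal (exp (l * (F' X - ?e))) * ennreal (exp (l\<^sup>2 * c\<^sup>2 / 2))" .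
  qed
  also have "\<dots> = (\<integral>\<^sup>+X. ennreal (exp (l * (F' X - ?e))) \<partial>?P) * ennreal (exp (l\<^sup>2 * c\<^sup>2 / 2))"
    by (rule nn_integral_multc) (use F'_meas in measurable)
  also have "\<dots> \<le> ennreal (exp (real n * (l\<^sup>2 * c\<^sup>2 / 2))) * ennreal (exp (l\<^sup>2 * c\<^sup>2 / 2))"
    by (rule mult_right_mono[OF Suc.IH[OF F'_meas F'_bd F'_diff]]) auto
  also have "\<dots> = ennreal (exp (real (Suc n) * (l\<^sup>2 * c\<^sup>2 / 2)))"
    by (simp add: ennreal_mult[symmetric] exp_add[symmetric] algebra_simps)
  finally show ?case unfolding EF .
qed

lemma bounded_differences_tail:
  fixes M :: "'a measure"
  defines "P n \<equiv> PiM {..<n} (\<lambda>_. M)"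
  assumes "prob_space M" "0 < n" "0 < t" "0 < c"
  assumes F[measurable]: "F \<in> borel_measurable (P n)"
    and "\<And>X. X \<in> space (P n) \<Longrightarrow> \<bar>F X\<bar> \<le> K"
    and "\<And>X i x. X \<in> space (P n) \<Longrightarrow> i < n \<Longrightarrow> x \<in> space M \<Longrightarrow> \<bar>F X - F (X(i := x))\<bar> \<le> c"
  shows "measure (P n) {X \<in> space (P n). F X \<le> (\<integral>Y. F Y \<partial>P n) + t} \<ge> 1 - exp (- t\<^sup>2 / (2 * real n * c\<^sup>2))"
proof -
  interpret P: prob_space "P n" unfolding P_def by (intro prob_space_PiM) (rule assms(2))
  let ?e = "\<integral>Y. F Y \<partial>P n"
  \<comment> \<open>The minimiser of the Chernoff exponent
    \<open>- l * t + n * l^2 * c^2 / 2\<close>.\<close>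
  define l where "l = t / (real n * c\<^sup>2)"
  have l: "0 < l" using assms(3-5) by (simp add: l_def)
  have "emeasure (P n) {X \<in> space (P n). ?e + t < F X}
      \<le> emeasure (P n) ({X \<in> space (P n). 1 \<le> ennreal (exp (- (l * t))) * ennreal (exp (l * (F X - ?e)))} \<inter> space (P n))"
  proof (rule emeasure_mono)
    show "{X \<in> space (P n). ?e + t < F X} \<subseteq> {X \<in> space (P n). 1 \<le> ennreal (exp (- (l * t))) * ennreal (exp (l * (F X - ?e)))} \<inter> space (P n)"
    proof safe
      fix X assume "?e + t < F X"
      then have "0 \<le> l * (F X - ?e - t)" using l by simp
      then have "1 \<le> exp (- (l * t)) * exp (l * (F X - ?e))"
        by (simp add: exp_add[symmetric] algebra_simps)
      then show "1 \<le> ennreal (exp (- (l * t))) * ennreal (exp (l * (F X - ?e)))"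
        by (simp add: ennreal_mult[symmetric])
    qed
  qed measurable
  also have "\<dots> \<le> ennreal (exp (- (l * t))) * (\<integral>\<^sup>+X. ennreal (exp (l * (F X - ?e))) * indicator (space (P n)) X \<partial>P n)"
    using nn_integral_Markov_inequality[of "\<lambda>X. ennreal (exp (l * (F X - ?e)))" "space (P n)" "P n" "ennreal (exp (- (l * t)))"]
    by (simp add: Int_def conj_commute)
  also have "(\<integral>\<^sup>+X. ennreal (exp (l * (F X - ?e))) * indicator (space (P n)) X \<partial>P n) = (\<integral>\<^sup>+X. exp (l * (F X - ?e)) \<partial>P n)"
    by (intro nn_integral_cong) simp
  also have "\<dots> \<le> ennreal (exp (real n * (l\<^sup>2 * c\<^sup>2 / 2)))"
    unfolding P_def by (rule mgf_bounded_differences[OF assms(2) l]) (use assms in \<open>auto simp: P_def\<close>)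
  also have "ennreal (exp (- (l * t))) * ennreal (exp (real n * (l\<^sup>2 * c\<^sup>2 / 2))) = ennreal (exp (- t\<^sup>2 / (2 * real n * c\<^sup>2)))"
  proof -
    have "- (l * t) + real n * (l\<^sup>2 * c\<^sup>2 / 2) = - t\<^sup>2 / (2 * real n * c\<^sup>2)"
      using assms(3,5) by (simp add: l_def power2_eq_square field_simps)
    then show ?thesis by (simp add: ennreal_mult[symmetric] exp_add[symmetric])
  qed
  finally have "measure (P n) {X \<in> space (P n). ?e + t < F X} \<le> exp (- t\<^sup>2 / (2 * real n * c\<^sup>2))"
    by (simp add: P.emeasure_eq_measure mult_left_mono)
  moreover have "measure (P n) {X \<in> space (P n). F X \<le> ?e + t} = 1 - measure (P n) {X \<in> space (P n). ?e + t < F X}"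
  proof -
    have "{X \<in> space (P n). F X \<le> ?e + t} = space (P n) - {X \<in> space (P n). ?e + t < F X}" by auto
    then show ?thesis by (simp add: P.prob_compl)
  qed
  ultimately show ?thesis by simp
qed

section \<open>Suprema over classes of Lipschitz functions\<close>

lemma enorm_cong: "(\<And>i. i < p \<Longrightarrow> x i = y i) \<Longrightarrow> enorm p x = enorm p y"
  by (simp add: enorm_def)

lemma enorm_measurable [measurable]: "enorm p \<in> borel_measurable (Rp p)"
  unfolding enorm_def [abs_def] Rp_def by measurable

text \<open>Meant for suprema over uncountable classes: Lipschitz dependence on finitely many real
  entries gives continuity, and continuity gives measurability.\<close>

lemma lipschitz_borel_measurable:
  fixes G :: "(nat \<Rightarrow> nat \<Rightarrow> real) \<Rightarrow> real"
  assumes lip: "\<And>X Y. \<bar>G X - G Y\<bar> \<le> K * (\<Sum>i<m. enorm p (\<lambda>j. X i j - Y i j))"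
  shows "G \<in> borel_measurable (PiM {..<m} (\<lambda>_. Rp p))"
proof -
  \<comment> \<open>Continuity refers to the product topology on total functions, while points of
    the product space carry default values outside the index ranges. \<open>T\<close> sets those
    entries to 0, which makes every entry measurable; by the Lipschitz bound \<open>G\<close> does
    not see the change.\<close>
  define T where "T X = (\<lambda>i j. if i < m \<and> j < p then X i j else 0)" for X :: "nat \<Rightarrow> nat \<Rightarrow> real"
  have "T \<in> borel_measurable (PiM {..<m} (\<lambda>_. Rp p))"
  proof (rule measurable_coordinatewise_then_product)+
    fix i j
    show "(\<lambda>X. T X i j) \<in> borel_measurable (PiM {..<m} (\<lambda>_. Rp p))"
    proof (cases "i < m \<and> j < p")
      case True
      then have "(\<lambda>X. X i) \<in> measurable (PiM {..<m} (\<lambda>_. Rp p)) (Rp p)"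
        by (intro measurable_component_singleton) auto
      moreover have "(\<lambda>x. x j) \<in> measurable (Rp p) borel"
        using True unfolding Rp_def by (intro measurable_component_singleton) auto
      ultimately have "(\<lambda>X. X i j) \<in> borel_measurable (PiM {..<m} (\<lambda>_. Rp p))"
        by (rule measurable_compose)
      then show ?thesis using True by (simp add: T_def)
    next
      case False
      then have "(\<lambda>X. T X i j) = (\<lambda>X. 0)" by (auto simp: T_def fun_eq_iff)
      then show ?thesis by simp
    qed
  qed
  moreover have "continuous_on UNIV G"
  proof (rule continuous_at_imp_continuous_on, rule ballI)
    fix X :: "nat \<Rightarrow> nat \<Rightarrow> real"
    have cont: "continuous_on UNIV (\<lambda>Y. K * (\<Sum>i<m. enorm p (\<lambda>j. Y i j - X i j)))"
    proof -
      have "continuous_on UNIV (\<lambda>Y :: nat \<Rightarrow> nat \<Rightarrow> real. Y i j)" for i j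
        using continuous_on_product_then_coordinatewise[OF continuous_on_product_coordinates] .
      then show ?thesis unfolding enorm_def by (intro continuous_intros)
    qed
    then have "((\<lambda>Y. K * (\<Sum>i<m. enorm p (\<lambda>j. Y i j - X i j))) \<longlongrightarrow> K * (\<Sum>i<m. enorm p (\<lambda>j. X i j - X i j))) (at X)"
      unfolding continuous_on_eq_continuous_at[OF open_UNIV] isCont_def by blast
    then have "((\<lambda>Y. K * (\<Sum>i<m. enorm p (\<lambda>j. Y i j - X i j))) \<longlongrightarrow> 0) (at X)" by simp
    then have "((\<lambda>Y. G Y - G X) \<longlongrightarrow> 0) (at X)"
      by (rule Lim_null_comparison[rotated]) (use lip in \<open>auto intro!: always_eventually\<close>)
    then show "isCont G X" by (simp add: isCont_def LIM_zero_iff)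
  qed
  then have "G \<in> borel_measurable borel" by (rule borel_measurable_continuous_onI)
  ultimately have "(\<lambda>X. G (T X)) \<in> borel_measurable (PiM {..<m} (\<lambda>_. Rp p))"
    by (rule measurable_compose)
  moreover have "G (T X) = G X" for X
  proof -
    have "enorm p (\<lambda>j. T X i j - X i j) = 0" if "i < m" for i
      using that enorm_cong[of p "\<lambda>j. T X i j - X i j" "\<lambda>_. 0"] by (simp add: T_def)
    then show ?thesis using lip[of "T X" X] by simp
  qed
  ultimately show ?thesis by simp
qed

lemma lipschitz_borel_measurable_Rp:
  assumes lip: "\<And>x y. \<bar>f x - f y\<bar> \<le> K * enorm p (\<lambda>j. x j - y j)"
  shows "f \<in> borel_measurable (Rp p)"
proof -
  have "(\<lambda>X. f (X 0)) \<in> borel_measurable (PiM {..<1::nat} (\<lambda>_. Rp p))"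
    by (rule lipschitz_borel_measurable[of _ K]) (use lip in simp)
  moreover have "(\<lambda>x. \<lambda>i\<in>{..<1::nat}. x) \<in> measurable (Rp p) (PiM {..<1} (\<lambda>_. Rp p))"
    by (intro measurable_restrict) simp
  ultimately have "(\<lambda>x. f ((\<lambda>i\<in>{..<1::nat}. x) 0)) \<in> borel_measurable (Rp p)"
    by (rule measurable_compose[rotated])
  then show ?thesis by simp
qed

lemma abs_SUP_diff_le:
  fixes a b :: "'t \<Rightarrow> real"
  assumes "T \<noteq> {}" "bdd_above (a ` T)" "bdd_above (b ` T)" "\<And>t. t \<in> T \<Longrightarrow> \<bar>a t - b t\<bar> \<le> d"
  shows "\<bar>(SUP t\<in>T. a t) - (SUP t\<in>T. b t)\<bar> \<le> d"
proof -
  have "(SUP t\<in>T. a t) \<le> (SUP t\<in>T. b t) + d"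
  proof (rule cSUP_least[OF assms(1)])
    fix t assume "t \<in> T"
    then show "a t \<le> (SUP t\<in>T. b t) + d" using cSUP_upper[OF _ assms(3), of t] assms(4)[of t] by simp
  qed
  moreover have "(SUP t\<in>T. b t) \<le> (SUP t\<in>T. a t) + d"
  proof (rule cSUP_least[OF assms(1)])
    fix t assume "t \<in> T"
    then show "b t \<le> (SUP t\<in>T. a t) + d" using cSUP_upper[OF _ assms(2), of t] assms(4)[of t] by simp
  qed
  ultimately show ?thesis by simp
qed

text \<open>What symmetrization, coupling and concentration use of the networks: values in [-1, 1]
  and one Lipschitz constant for the whole class.\<close>

locale lipschitz_class =
  fixes p :: nat and F :: "((nat \<Rightarrow> real) \<Rightarrow> real) set" and K :: real
  assumes F_nonempty: "F \<noteq> {}"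
    and F_abs_le: "f \<in> F \<Longrightarrow> \<bar>f x\<bar> \<le> 1"
    and F_lipschitz: "f \<in> F \<Longrightarrow> \<bar>f x - f y\<bar> \<le> K * enorm p (\<lambda>i. x i - y i)"
    and K_nonneg: "0 \<le> K"
begin

text \<open>Free coefficients and centring let one treatment serve three suprema: the empirical
  deviation (c = 1, centred at n times the mean), the difference of two samples (c = 1 and -1 on the
  halves), and signed sums (c a sign vector).\<close>

definition Phi :: "nat \<Rightarrow> (nat \<Rightarrow> real) \<Rightarrow> (((nat \<Rightarrow> real) \<Rightarrow> real) \<Rightarrow> real) \<Rightarrow> (nat \<Rightarrow> nat \<Rightarrow> real) \<Rightarrow> real" where
  "Phi m c \<gamma> X = (SUP f\<in>F. \<bar>(\<Sum>i<m. c i * f (X i)) - \<gamma> f\<bar>)"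

definition bounded_on_F :: "(((nat \<Rightarrow> real) \<Rightarrow> real) \<Rightarrow> real) \<Rightarrow> bool" where
  "bounded_on_F \<gamma> \<longleftrightarrow> (\<exists>G. \<forall>f\<in>F. \<bar>\<gamma> f\<bar> \<le> G)"

lemma bounded_on_F_zero [simp]: "bounded_on_F (\<lambda>_. 0)"
  by (auto simp: bounded_on_F_def)

lemma weighted_sum_le: "f \<in> F \<Longrightarrow> \<bar>\<Sum>i<m. c i * f (X i)\<bar> \<le> (\<Sum>i<m. \<bar>c i\<bar>)"
  by (rule order_trans[OF sum_abs], rule sum_mono)
     (use F_abs_le in \<open>auto simp: abs_mult intro: mult_left_le\<close>)

lemma Phi_bdd:
  assumes "bounded_on_F \<gamma>"
  shows "bdd_above ((\<lambda>f. \<bar>(\<Sum>i<m. c i * f (X i)) - \<gamma> f\<bar>) ` F)"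
proof -
  obtain G where G: "\<And>f. f \<in> F \<Longrightarrow> \<bar>\<gamma> f\<bar> \<le> G" using assms by (auto simp: bounded_on_F_def)
  have "\<bar>\<bar>(\<Sum>i<m. c i * f (X i)) - \<gamma> f\<bar>\<bar> \<le> (\<Sum>i<m. \<bar>c i\<bar>) + G" if "f \<in> F" for f
    using weighted_sum_le[OF that, where m = m and c = c and X = X] G[OF that] by linarith
  then show ?thesis by (rule bdd_above_abs_bounded)
qed

lemma Phi_upper:
  "bounded_on_F \<gamma> \<Longrightarrow> f \<in> F \<Longrightarrow> \<bar>(\<Sum>i<m. c i * f (X i)) - \<gamma> f\<bar> \<le> Phi m c \<gamma> X"
  unfolding Phi_def by (rule cSUP_upper[OF _ Phi_bdd])

lemma Phi_least:
  "(\<And>f. f \<in> F \<Longrightarrow> \<bar>(\<Sum>i<m. c i * f (X i)) - \<gamma> f\<bar> \<le> u) \<Longrightarrow> Phi m c \<gamma> X \<le> u"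
  unfolding Phi_def by (rule cSUP_least[OF F_nonempty])

lemma Phi_nonneg: "bounded_on_F \<gamma> \<Longrightarrow> 0 \<le> Phi m c \<gamma> X"
  using F_nonempty Phi_upper by (meson abs_ge_zero ex_in_conv order_trans)

lemma Phi_le:
  assumes "\<And>f. f \<in> F \<Longrightarrow> \<bar>\<gamma> f\<bar> \<le> G"
  shows "Phi m c \<gamma> X \<le> (\<Sum>i<m. \<bar>c i\<bar>) + G"
proof (rule Phi_least)
  fix f assume "f \<in> F"
  from weighted_sum_le[OF this, where m = m and c = c and X = X] assms[OF this]
  show "\<bar>(\<Sum>i<m. c i * f (X i)) - \<gamma> f\<bar> \<le> (\<Sum>i<m. \<bar>c i\<bar>) + G" by linarith
qed

lemma Phi_diff:
  assumes "bounded_on_F \<gamma>" "\<And>f. f \<in> F \<Longrightarrow> \<bar>\<Sum>i<m. c i * (f (X i) - f (Y i))\<bar> \<le> d"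
  shows "\<bar>Phi m c \<gamma> X - Phi m c \<gamma> Y\<bar> \<le> d"
  unfolding Phi_def
proof (rule abs_SUP_diff_le[OF F_nonempty Phi_bdd[OF assms(1)] Phi_bdd[OF assms(1)]])
  fix f assume "f \<in> F"
  from assms(2)[OF this] have "\<bar>(\<Sum>i<m. c i * f (X i)) - (\<Sum>i<m. c i * f (Y i))\<bar> \<le> d"
    by (simp add: right_diff_distrib sum_subtractf)
  then show "\<bar>\<bar>(\<Sum>i<m. c i * f (X i)) - \<gamma> f\<bar> - \<bar>(\<Sum>i<m. c i * f (Y i)) - \<gamma> f\<bar>\<bar> \<le> d"
    by linarith
qed

lemma Phi_lipschitz:
  assumes "bounded_on_F \<gamma>"
  shows "\<bar>Phi m c \<gamma> X - Phi m c \<gamma> Y\<bar> \<le> K * (\<Sum>i<m. \<bar>c i\<bar> * enorm p (\<lambda>j. X i j - Y i j))"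
proof (rule Phi_diff[OF assms])
  fix f assume f: "f \<in> F"
  have "\<bar>\<Sum>i<m. c i * (f (X i) - f (Y i))\<bar> \<le> (\<Sum>i<m. \<bar>c i\<bar> * \<bar>f (X i) - f (Y i)\<bar>)"
    by (rule order_trans[OF sum_abs]) (simp add: abs_mult)
  also have "\<dots> \<le> (\<Sum>i<m. \<bar>c i\<bar> * (K * enorm p (\<lambda>j. X i j - Y i j)))"
    by (intro sum_mono mult_left_mono F_lipschitz f) auto
  also have "\<dots> = K * (\<Sum>i<m. \<bar>c i\<bar> * enorm p (\<lambda>j. X i j - Y i j))"
    by (simp add: sum_distrib_left mult_ac)
  finally show "\<bar>\<Sum>i<m. c i * (f (X i) - f (Y i))\<bar> \<le> K * (\<Sum>i<m. \<bar>c i\<bar> * enorm p (\<lambda>j. X i j - Y i j))" .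
qed

lemma Phi_measurable:
  assumes "bounded_on_F \<gamma>" "sets Q = sets (Rp p)"
  shows "Phi m c \<gamma> \<in> borel_measurable (PiM {..<m} (\<lambda>_. Q))"
proof -
  have "Phi m c \<gamma> \<in> borel_measurable (PiM {..<m} (\<lambda>_. Rp p))"
  proof (rule lipschitz_borel_measurable)
    fix X Y
    have "K * (\<Sum>i<m. \<bar>c i\<bar> * enorm p (\<lambda>j. X i j - Y i j))
        \<le> K * (\<Sum>i<m. (\<Sum>i<m. \<bar>c i\<bar>) * enorm p (\<lambda>j. X i j - Y i j))"
      by (intro mult_left_mono sum_mono mult_right_mono K_nonneg)
         (auto intro: member_le_sum[where f = "\<lambda>i. \<bar>c i\<bar>"])
    then show "\<bar>Phi m c \<gamma> X - Phi m c \<gamma> Y\<bar> \<le> (K * (\<Sum>i<m. \<bar>c i\<bar>)) * (\<Sum>i<m. enorm p (\<lambda>j. X i j - Y i j))"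
      using Phi_lipschitz[OF assms(1), of m c X Y] unfolding sum_distrib_left[symmetric] mult.assoc by linarith
  qed
  then show ?thesis
    by (subst measurable_cong_sets[OF sets_PiM_cong[OF refl] refl]) (use assms(2) in auto)
qed

lemma Phi_integrable:
  assumes "bounded_on_F \<gamma>" "sets Q = sets (Rp p)" "prob_space Q"
  shows "integrable (PiM {..<m} (\<lambda>_. Q)) (Phi m c \<gamma>)"
proof -
  interpret prob_space "PiM {..<m} (\<lambda>_. Q)" by (intro prob_space_PiM assms(3))
  obtain G where G: "\<And>f. f \<in> F \<Longrightarrow> \<bar>\<gamma> f\<bar> \<le> G" using assms(1) by (auto simp: bounded_on_F_def)
  show ?thesis
    by (rule integrable_const_bound[OF _ Phi_measurable[OF assms(1,2)], where B = "(\<Sum>i<m. \<bar>c i\<bar>) + G"])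
       (use Phi_le[OF G] Phi_nonneg[OF assms(1)] in auto)
qed

lemma F_measurable: "f \<in> F \<Longrightarrow> sets Q = sets (Rp p) \<Longrightarrow> f \<in> borel_measurable Q"
  using lipschitz_borel_measurable_Rp[of f K p] F_lipschitz measurable_cong_sets by blast

lemma F_integrable:
  assumes "f \<in> F" "sets Q = sets (Rp p)" "prob_space Q"
  shows "integrable Q f"
proof -
  interpret prob_space Q by fact
  show ?thesis
    by (rule integrable_const_bound[of _ 1]) (use F_abs_le F_measurable assms in auto)
qed

lemma F_integral_abs_le:
  assumes "f \<in> F" "sets Q = sets (Rp p)" "prob_space Q"
  shows "\<bar>\<integral>x. f x \<partial>Q\<bar> \<le> 1"
proof -
  interpret prob_space Q by fact
  have "\<bar>\<integral>x. f x \<partial>Q\<bar> \<le> (\<integral>x. \<bar>f x\<bar> \<partial>Q)" by (rule integral_abs_bound)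
  also have "\<dots> \<le> (\<integral>x. 1 \<partial>Q)"
    by (rule integral_mono) (use F_integrable assms F_abs_le in auto)
  finally show ?thesis by (simp add: prob_space)
qed

end

section \<open>Projections, reindexing and sign averages under product measures\<close>

lemma integral_PiM_component:
  fixes f :: "'a \<Rightarrow> real"
  assumes "prob_space Q" "i \<in> I" "f \<in> borel_measurable Q"
  shows "(\<integral>X. f (X i) \<partial>PiM I (\<lambda>_. Q)) = (\<integral>x. f x \<partial>Q)"
proof -
  have "(\<integral>x. f x \<partial>distr (PiM I (\<lambda>_. Q)) Q (\<lambda>X. X i)) = (\<integral>X. f (X i) \<partial>PiM I (\<lambda>_. Q))"
    by (rule integral_distr) (use assms in auto)
  then show ?thesis using distr_PiM_component[of I "\<lambda>_. Q" i] assms by simp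
qed

lemma integrable_PiM_component:
  fixes f :: "'a \<Rightarrow> real"
  assumes "prob_space Q" "i \<in> I" "integrable Q f"
  shows "integrable (PiM I (\<lambda>_. Q)) (\<lambda>X. f (X i))"
proof -
  have "integrable (distr (PiM I (\<lambda>_. Q)) Q (\<lambda>X. X i)) f"
    using distr_PiM_component[of I "\<lambda>_. Q" i] assms by simp
  then show ?thesis by (rule integrable_distr[rotated]) (use assms(2) in simp)
qed

lemma integral_PiM_reindex:
  fixes f :: "('i \<Rightarrow> 'a) \<Rightarrow> real"
  assumes "prob_space Q" "inj_on \<tau> I" "\<tau> \<in> I \<rightarrow> J" "f \<in> borel_measurable (PiM I (\<lambda>_. Q))"
  shows "(\<integral>X. f (\<lambda>i\<in>I. X (\<tau> i)) \<partial>PiM J (\<lambda>_. Q)) = (\<integral>X. f X \<partial>PiM I (\<lambda>_. Q))"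
proof -
  have "distr (PiM J (\<lambda>_. Q)) (PiM I (\<lambda>_. Q)) (\<lambda>X. \<lambda>i\<in>I. X (\<tau> i)) = PiM I (\<lambda>_. Q)"
    using distr_PiM_reindex[of J "\<lambda>_. Q" \<tau> I] assms(1-3) by simp
  moreover have "(\<lambda>X. \<lambda>i\<in>I. X (\<tau> i)) \<in> measurable (PiM J (\<lambda>_. Q)) (PiM I (\<lambda>_. Q))"
    by (intro measurable_restrict measurable_component_singleton) (use assms(3) in auto)
  ultimately show ?thesis using integral_distr[OF _ assms(4)] by metis
qed

lemma integrable_rad:
  "(\<And>s. integrable M (h s)) \<Longrightarrow> integrable M (\<lambda>x. rad n (\<lambda>s. h s x))"
proof (induction n arbitrary: h)
  case (Suc n)
  show ?case unfolding rad.simps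
    by (rule integrable_divide_zero)
       (rule Bochner_Integration.integrable_add[OF Suc.IH[OF Suc.prems] Suc.IH[OF Suc.prems]])
qed simp

lemma integral_rad:
  "(\<And>s. integrable M (h s)) \<Longrightarrow> (\<integral>x. rad n (\<lambda>s. h s x) \<partial>M) = rad n (\<lambda>s. \<integral>x. h s x \<partial>M)"
proof (induction n arbitrary: h)
  case (Suc n)
  have "(\<integral>x. rad (Suc n) (\<lambda>s. h s x) \<partial>M)
      = ((\<integral>x. rad n (\<lambda>s. h (s(n := 1)) x) \<partial>M) + (\<integral>x. rad n (\<lambda>s. h (s(n := -1)) x) \<partial>M)) / 2"
    unfolding rad.simps integral_divide_zero
    by (subst Bochner_Integration.integral_add[OF integrable_rad[OF Suc.prems] integrable_rad[OF Suc.prems]]) (rule refl)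
  then show ?case
    unfolding rad.simps Suc.IH[of "\<lambda>s. h (s(n := 1))", OF Suc.prems] Suc.IH[of "\<lambda>s. h (s(n := -1))", OF Suc.prems] .
qed simp

section \<open>Symmetrization and coupling\<close>

lemma sum_lessThan_add: "(\<Sum>i<n + m. g i) = (\<Sum>i<n. g i) + (\<Sum>i<m. g (n + i))" for g :: "nat \<Rightarrow> real"
  by (induction m) auto

context lipschitz_class
begin

text \<open>Each expectation is a mean over an independent second sample, and the supremum of a mean
  is at most the mean of the supremum. The second sample occupies the indices from n to 2 n - 1, so
  both live in one product measure.\<close>

lemma Phi_ghost_sample:
  assumes Q: "prob_space Q" "sets Q = sets (Rp p)"
  shows "(\<integral>X. Phi n (\<lambda>_. 1) (\<lambda>f. real n * (\<integral>x. f x \<partial>Q)) X \<partial>PiM {..<n} (\<lambda>_. Q))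
      \<le> (\<integral>X. Phi (n + n) (\<lambda>i. if i < n then 1 else -1) (\<lambda>_. 0) X \<partial>PiM {..<n + n} (\<lambda>_. Q))"
proof -
  interpret Q: prob_space Q by fact
  interpret P: product_sigma_finite "\<lambda>_::nat. Q" by unfold_locales
  let ?I = "{..<n}" and ?J = "{n..<n + n}"
  let ?PI = "PiM ?I (\<lambda>_. Q)" and ?PJ = "PiM ?J (\<lambda>_. Q)"
  define c :: "nat \<Rightarrow> real" where "c i = (if i < n then 1 else -1)" for i
  let ?G = "Phi (n + n) c (\<lambda>_. 0)"
  interpret PI: prob_space ?PI by (intro prob_space_PiM Q)
  interpret PJ: prob_space ?PJ by (intro prob_space_PiM Q)
  have IJ: "?I \<union> ?J = {..<n + n}" "?I \<inter> ?J = {}" by auto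
  have bd: "bounded_on_F (\<lambda>f. real n * (\<integral>x. f x \<partial>Q))"
    unfolding bounded_on_F_def
    by (rule exI[of _ "real n"]) (use F_integral_abs_le Q in \<open>auto simp: abs_mult intro: mult_left_le\<close>)
  have G_meas: "?G \<in> borel_measurable (PiM (?I \<union> ?J) (\<lambda>_. Q))"
    unfolding IJ by (rule Phi_measurable) (use Q in auto)
  have merge_meas: "(\<lambda>z. ?G (merge ?I ?J z)) \<in> borel_measurable (?PI \<Otimes>\<^sub>M ?PJ)"
    using measurable_comp[OF measurable_merge G_meas] by (simp add: comp_def)
  have G_le: "\<bar>?G X\<bar> \<le> (\<Sum>i<n + n. \<bar>c i\<bar>)" for X
    using Phi_le[of "\<lambda>_. 0" 0 "n + n" c X] Phi_nonneg[of "\<lambda>_. 0" "n + n" c X] by simp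
  have G_int: "integrable ?PJ (\<lambda>Y. ?G (merge ?I ?J (X, Y)))" if X: "X \<in> space ?PI" for X
    by (rule PJ.integrable_const_bound[where B = "\<Sum>i<n + n. \<bar>c i\<bar>"])
       (use G_le measurable_Pair2[OF merge_meas X] in auto)
  have "(\<integral>X. Phi n (\<lambda>_. 1) (\<lambda>f. real n * (\<integral>x. f x \<partial>Q)) X \<partial>?PI)
      \<le> (\<integral>X. (\<integral>Y. ?G (merge ?I ?J (X, Y)) \<partial>?PJ) \<partial>?PI)"
  proof (rule integral_mono)
    show "integrable ?PI (Phi n (\<lambda>_. 1) (\<lambda>f. real n * (\<integral>x. f x \<partial>Q)))"
      by (rule Phi_integrable[OF bd Q(2,1)])
    show "integrable ?PI (\<lambda>X. \<integral>Y. ?G (merge ?I ?J (X, Y)) \<partial>?PJ)"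
    proof (rule PI.integrable_const_bound[where B = "\<Sum>i<n + n. \<bar>c i\<bar>"], rule AE_I2)
      fix X assume X: "X \<in> space ?PI"
      have "\<bar>\<integral>Y. ?G (merge ?I ?J (X, Y)) \<partial>?PJ\<bar> \<le> (\<integral>Y. \<bar>?G (merge ?I ?J (X, Y))\<bar> \<partial>?PJ)"
        by (rule integral_abs_bound)
      also have "\<dots> \<le> (\<integral>Y. (\<Sum>i<n + n. \<bar>c i\<bar>) \<partial>?PJ)"
        by (rule integral_mono) (use G_int[OF X] G_le in auto)
      finally show "norm (\<integral>Y. ?G (merge ?I ?J (X, Y)) \<partial>?PJ) \<le> (\<Sum>i<n + n. \<bar>c i\<bar>)"
        by (simp add: PJ.prob_space)
    next
      show "(\<lambda>X. \<integral>Y. ?G (merge ?I ?J (X, Y)) \<partial>?PJ) \<in> borel_measurable ?PI"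
        by (rule PJ.borel_measurable_lebesgue_integral) (use merge_meas in \<open>simp add: case_prod_unfold\<close>)
    qed
    fix X assume X: "X \<in> space ?PI"
    show "Phi n (\<lambda>_. 1) (\<lambda>f. real n * (\<integral>x. f x \<partial>Q)) X \<le> (\<integral>Y. ?G (merge ?I ?J (X, Y)) \<partial>?PJ)"
    proof (rule Phi_least)
      fix f assume f: "f \<in> F"
      note f_int = F_integrable[OF f Q(2,1)]
      have comp_int: "integrable ?PJ (\<lambda>Y. f (Y (n + i)))" if "i < n" for i
        by (rule integrable_PiM_component[OF Q(1) _ f_int]) (use that in auto)
      have "(\<integral>Y. (\<Sum>i<n. f (X i)) - (\<Sum>i<n. f (Y (n + i))) \<partial>?PJ)
          = (\<Sum>i<n. f (X i)) - (\<Sum>i<n. (\<integral>Y. f (Y (n + i)) \<partial>?PJ))"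
      proof -
        have "integrable ?PJ (\<lambda>Y. \<Sum>i<n. f (Y (n + i)))"
          by (intro Bochner_Integration.integrable_sum comp_int) simp
        moreover have "(\<integral>Y. (\<Sum>i<n. f (Y (n + i))) \<partial>?PJ) = (\<Sum>i<n. (\<integral>Y. f (Y (n + i)) \<partial>?PJ))"
          by (intro Bochner_Integration.integral_sum comp_int) simp
        ultimately show ?thesis by (simp add: PJ.prob_space)
      qed
      also have "(\<Sum>i<n. (\<integral>Y. f (Y (n + i)) \<partial>?PJ)) = (\<Sum>i<n. (\<integral>x. f x \<partial>Q))"
        by (rule sum.cong) (use f_int in \<open>auto intro!: integral_PiM_component Q\<close>)
      finally have eq: "(\<Sum>i<n. 1 * f (X i)) - real n * (\<integral>x. f x \<partial>Q)
          = (\<integral>Y. (\<Sum>i<n. f (X i)) - (\<Sum>i<n. f (Y (n + i))) \<partial>?PJ)" by simp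
      have "\<bar>(\<Sum>i<n. 1 * f (X i)) - real n * (\<integral>x. f x \<partial>Q)\<bar>
          \<le> (\<integral>Y. \<bar>(\<Sum>i<n. f (X i)) - (\<Sum>i<n. f (Y (n + i)))\<bar> \<partial>?PJ)"
        unfolding eq by (rule integral_abs_bound)
      also have "\<dots> \<le> (\<integral>Y. ?G (merge ?I ?J (X, Y)) \<partial>?PJ)"
      proof (rule integral_mono[OF _ G_int[OF X]])
        show "integrable ?PJ (\<lambda>Y. \<bar>(\<Sum>i<n. f (X i)) - (\<Sum>i<n. f (Y (n + i)))\<bar>)"
          by (intro integrable_abs Bochner_Integration.integrable_diff Bochner_Integration.integrable_sum comp_int) auto
        fix Y
        show "\<bar>(\<Sum>i<n. f (X i)) - (\<Sum>i<n. f (Y (n + i)))\<bar> \<le> ?G (merge ?I ?J (X, Y))"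
          using Phi_upper[OF bounded_on_F_zero f, where m = "n + n" and c = c and X = "merge ?I ?J (X, Y)"]
          by (simp add: sum_lessThan_add merge_def c_def sum_negf)
      qed
      finally show "\<bar>(\<Sum>i<n. 1 * f (X i)) - real n * (\<integral>x. f x \<partial>Q)\<bar> \<le> (\<integral>Y. ?G (merge ?I ?J (X, Y)) \<partial>?PJ)" .
    qed
  qed
  also have "\<dots> = (\<integral>X. ?G X \<partial>PiM (?I \<union> ?J) (\<lambda>_. Q))"
    by (rule P.product_integral_fold[symmetric])
       (use IJ Phi_integrable[of "\<lambda>_. 0" Q "n + n" c] Q in auto)
  finally show ?thesis unfolding IJ c_def .
qed

text \<open>For a fixed sign vector, exchanging observations i and n + i wherever
  \<open>s i = -1\<close> preserves the product law and turns the difference of the samples into a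
  signed one. The triangle inequality then separates the halves, hence the factor 2.\<close>

lemma Phi_swap:
  assumes Q: "prob_space Q" "sets Q = sets (Rp p)" and s: "s \<in> signs n"
  shows "(\<integral>X. Phi (n + n) (\<lambda>i. if i < n then 1 else -1) (\<lambda>_. 0) X \<partial>PiM {..<n + n} (\<lambda>_. Q))
      \<le> 2 * (\<integral>X. Phi n s (\<lambda>_. 0) X \<partial>PiM {..<n} (\<lambda>_. Q))"
proof -
  define c :: "nat \<Rightarrow> real" where "c i = (if i < n then 1 else -1)" for i
  let ?G = "Phi (n + n) c (\<lambda>_. 0)" and ?H = "Phi n s (\<lambda>_. 0)"
  let ?P = "PiM {..<n + n} (\<lambda>_. Q)"
  \<comment> \<open>An involution swapping the pairs with sign -1; an index i in the second half
    consults the sign of \<open>i - n\<close>.\<close>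
  define \<tau> where "\<tau> i = (if i < n then if s i = 1 then i else n + i else if s (i - n) = 1 then i else i - n)" for i
  have s_cases: "s i = 1 \<or> s i = -1" if "i < n" for i using s that by (auto simp: signs_def)
  have \<tau>\<tau>: "\<tau> (\<tau> i) = i" if "i < n + n" for i
    using that by (auto simp: \<tau>_def)
  have \<tau>: "inj_on \<tau> {..<n + n}" "\<tau> \<in> {..<n + n} \<rightarrow> {..<n + n}"
    by (rule inj_on_inverseI[of _ \<tau>], simp add: \<tau>\<tau>) (auto simp: \<tau>_def)
  have meas: "?G \<in> borel_measurable ?P" "?H \<in> borel_measurable (PiM {..<n} (\<lambda>_. Q))"
    by (rule Phi_measurable; use Q in simp)+
  have half: "(\<integral>X. ?H (\<lambda>i\<in>{..<n}. X (k + i)) \<partial>?P) = (\<integral>X. ?H X \<partial>PiM {..<n} (\<lambda>_. Q))" if "k \<le> n" for k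
    using integral_PiM_reindex[of Q "\<lambda>i. k + i" "{..<n}" "{..<n + n}" ?H] Q meas that by auto
  interpret P: prob_space ?P by (intro prob_space_PiM Q)
  have sub_meas: "(\<lambda>X. \<lambda>i\<in>J. X (\<rho> i)) \<in> measurable ?P (PiM J (\<lambda>_. Q))" if "\<rho> \<in> J \<rightarrow> {..<n + n}" for \<rho> and J :: "nat set"
    by (intro measurable_restrict measurable_component_singleton) (use that in auto)
  have "(\<integral>X. ?G X \<partial>?P) = (\<integral>X. ?G (\<lambda>i\<in>{..<n + n}. X (\<tau> i)) \<partial>?P)"
    by (rule integral_PiM_reindex[symmetric]) (use Q \<tau> meas in auto)
  also have "\<dots> \<le> (\<integral>X. ?H (\<lambda>i\<in>{..<n}. X (0 + i)) + ?H (\<lambda>i\<in>{..<n}. X (n + i)) \<partial>?P)"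
  proof (rule integral_mono)
    have int: "integrable ?P (\<lambda>X. Phi m d (\<lambda>_. 0) (\<lambda>i\<in>{..<m}. X (\<rho> i)))" if "\<rho> \<in> {..<m} \<rightarrow> {..<n + n}" for m d \<rho>
    proof (rule P.integrable_const_bound[where B = "\<Sum>i<m. \<bar>d i\<bar>"])
      show "AE X in ?P. norm (Phi m d (\<lambda>_. 0) (\<lambda>i\<in>{..<m}. X (\<rho> i))) \<le> (\<Sum>i<m. \<bar>d i\<bar>)"
        by (rule AE_I2) (use Phi_le[of "\<lambda>_. 0" 0 m d] Phi_nonneg[of "\<lambda>_. 0" m d] in simp)
      show "(\<lambda>X. Phi m d (\<lambda>_. 0) (\<lambda>i\<in>{..<m}. X (\<rho> i))) \<in> borel_measurable ?P"
        by (rule measurable_compose[OF sub_meas[OF that]]) (rule Phi_measurable, use Q in auto)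
    qed
    show "integrable ?P (\<lambda>X. ?G (\<lambda>i\<in>{..<n + n}. X (\<tau> i)))" by (rule int[OF \<tau>(2)])
    show "integrable ?P (\<lambda>X. ?H (\<lambda>i\<in>{..<n}. X (0 + i)) + ?H (\<lambda>i\<in>{..<n}. X (n + i)))"
      by (intro Bochner_Integration.integrable_add int) auto
    fix X
    show "?G (\<lambda>i\<in>{..<n + n}. X (\<tau> i)) \<le> ?H (\<lambda>i\<in>{..<n}. X (0 + i)) + ?H (\<lambda>i\<in>{..<n}. X (n + i))"
    proof (rule Phi_least)
      fix f assume f: "f \<in> F"
      have "(\<Sum>i<n + n. c i * f ((\<lambda>i\<in>{..<n + n}. X (\<tau> i)) i)) = (\<Sum>i<n. f (X (\<tau> i)) - f (X (\<tau> (n + i))))"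
        by (simp add: sum_lessThan_add c_def sum_subtractf sum_negf)
      also have "\<dots> = (\<Sum>i<n. s i * f (X i) - s i * f (X (n + i)))"
        by (rule sum.cong) (use s_cases in \<open>fastforce simp: \<tau>_def\<close>)+
      also have "\<dots> = (\<Sum>i<n. s i * f ((\<lambda>i\<in>{..<n}. X (0 + i)) i)) - (\<Sum>i<n. s i * f ((\<lambda>i\<in>{..<n}. X (n + i)) i))"
        by (simp add: sum_subtractf)
      finally show "\<bar>(\<Sum>i<n + n. c i * f ((\<lambda>i\<in>{..<n + n}. X (\<tau> i)) i)) - 0\<bar>
          \<le> ?H (\<lambda>i\<in>{..<n}. X (0 + i)) + ?H (\<lambda>i\<in>{..<n}. X (n + i))"
        using Phi_upper[OF bounded_on_F_zero f, where m = n and c = s and X = "\<lambda>i\<in>{..<n}. X (0 + i)"]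
          Phi_upper[OF bounded_on_F_zero f, where m = n and c = s and X = "\<lambda>i\<in>{..<n}. X (n + i)"] by linarith
    qed
  qed
  also have "\<dots> = (\<integral>X. ?H (\<lambda>i\<in>{..<n}. X (0 + i)) \<partial>?P) + (\<integral>X. ?H (\<lambda>i\<in>{..<n}. X (n + i)) \<partial>?P)"
  proof (rule Bochner_Integration.integral_add)
    have int: "integrable ?P (\<lambda>X. ?H (\<lambda>i\<in>{..<n}. X (k + i)))" if "k \<le> n" for k
    proof (rule P.integrable_const_bound[where B = "\<Sum>i<n. \<bar>s i\<bar>"])
      show "AE X in ?P. norm (?H (\<lambda>i\<in>{..<n}. X (k + i))) \<le> (\<Sum>i<n. \<bar>s i\<bar>)"
        by (rule AE_I2) (use Phi_le[of "\<lambda>_. 0" 0 n s] Phi_nonneg[of "\<lambda>_. 0" n s] in simp)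
      show "(\<lambda>X. ?H (\<lambda>i\<in>{..<n}. X (k + i))) \<in> borel_measurable ?P"
        by (rule measurable_compose[OF sub_meas meas(2)]) (use that in auto)
    qed
    show "integrable ?P (\<lambda>X. ?H (\<lambda>i\<in>{..<n}. X (0 + i)))" "integrable ?P (\<lambda>X. ?H (\<lambda>i\<in>{..<n}. X (n + i)))"
      by (rule int, simp)+
  qed
  also have "\<dots> = 2 * (\<integral>X. ?H X \<partial>PiM {..<n} (\<lambda>_. Q))"
    using half[of 0] half[of n] by simp
  finally show ?thesis unfolding c_def .
qed

text \<open>The left side of \<open>Phi_swap\<close> does not depend on the sign vector, so
  averaging over all sign vectors leaves it unchanged and produces the Rademacher average on the
  right.\<close>

lemma symmetrization:
  assumes Q: "prob_space Q" "sets Q = sets (Rp p)"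
    and V: "\<And>y. rsup n y F \<le> V y" "integrable (PiM {..<n} (\<lambda>_. Q)) V"
  shows "(\<integral>X. Phi n (\<lambda>_. 1) (\<lambda>f. real n * (\<integral>x. f x \<partial>Q)) X \<partial>PiM {..<n} (\<lambda>_. Q))
      \<le> 2 * (\<integral>y. V y \<partial>PiM {..<n} (\<lambda>_. Q))"
proof -
  let ?P = "PiM {..<n} (\<lambda>_. Q)" and ?G = "Phi (n + n) (\<lambda>i. if i < n then 1 else -1) (\<lambda>_. 0)"
  note int = Phi_integrable[OF bounded_on_F_zero Q(2,1)]
  have "(\<integral>X. ?G X \<partial>PiM {..<n + n} (\<lambda>_. Q)) = rad n (\<lambda>s. \<integral>X. ?G X \<partial>PiM {..<n + n} (\<lambda>_. Q))" by simp
  also have "\<dots> \<le> rad n (\<lambda>s. 2 * (\<integral>X. Phi n s (\<lambda>_. 0) X \<partial>?P))"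
    by (rule rad_mono) (rule Phi_swap[OF Q])
  also have "\<dots> = 2 * (\<integral>X. rad n (\<lambda>s. Phi n s (\<lambda>_. 0) X) \<partial>?P)"
    by (simp add: rad_cmult integral_rad[OF int])
  also have "(\<integral>X. rad n (\<lambda>s. Phi n s (\<lambda>_. 0) X) \<partial>?P) \<le> (\<integral>y. V y \<partial>?P)"
  proof (rule integral_mono)
    show "integrable ?P (\<lambda>X. rad n (\<lambda>s. Phi n s (\<lambda>_. 0) X))" by (rule integrable_rad[OF int])
    show "rad n (\<lambda>s. Phi n s (\<lambda>_. 0) y) \<le> V y" for y
      using V(1)[of y] by (simp add: rsup_def Phi_def)
  qed (rule V(2))
  finally show ?thesis using Phi_ghost_sample[OF Q, of n] by simp
qed

text \<open>Independent copies of one coupling couple the two samples of size n. Along it the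
  Lipschitz bound compares the suprema, at mean cost at most \<open>K * e\<close> per
  observation.\<close>

lemma Phi_coupling:
  assumes \<pi>: "\<pi> \<in> couplings p P Q"
    and P: "prob_space P" "sets P = sets (Rp p)" and Q: "prob_space Q" "sets Q = sets (Rp p)"
    and "(\<integral>\<^sup>+ z. ennreal (enorm p (\<lambda>i. fst z i - snd z i)) \<partial>\<pi>) \<le> ennreal e" "0 \<le> e"
    and bd: "bounded_on_F \<gamma>"
  shows "(\<integral>X. Phi n (\<lambda>_. 1) \<gamma> X \<partial>PiM {..<n} (\<lambda>_. P))
      \<le> (\<integral>X. Phi n (\<lambda>_. 1) \<gamma> X \<partial>PiM {..<n} (\<lambda>_. Q)) + K * (real n * e)"
proof -
  let ?H = "Phi n (\<lambda>_. 1) \<gamma>" and ?I = "{..<n}"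
  let ?d = "\<lambda>z. enorm p (\<lambda>i. fst z i - snd z i)"
  have sets_\<pi>: "sets \<pi> = sets (Rp p \<Otimes>\<^sub>M Rp p)" and prob_\<pi>: "prob_space \<pi>"
    and fst_\<pi>: "distr \<pi> (Rp p) fst = P" and snd_\<pi>: "distr \<pi> (Rp p) snd = Q"
    using \<pi> by (auto simp: couplings_def)
  interpret \<pi>: prob_space \<pi> by fact
  interpret \<pi>n: prob_space "PiM ?I (\<lambda>_. \<pi>)" by (intro prob_space_PiM prob_\<pi>)
  have d_meas: "?d \<in> borel_measurable \<pi>"
  proof -
    have "(\<lambda>z. fst z i) \<in> borel_measurable (Rp p \<Otimes>\<^sub>M Rp p)" "(\<lambda>z. snd z i) \<in> borel_measurable (Rp p \<Otimes>\<^sub>M Rp p)" if "i < p" for i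
      unfolding Rp_def using that
      by (auto intro!: measurable_compose[OF measurable_fst measurable_component_singleton]
        measurable_compose[OF measurable_snd measurable_component_singleton])
    then have "(\<lambda>z. \<Sum>i<p. (fst z i - snd z i)\<^sup>2) \<in> borel_measurable (Rp p \<Otimes>\<^sub>M Rp p)"
      by (intro borel_measurable_sum borel_measurable_power borel_measurable_diff) auto
    then have "?d \<in> borel_measurable (Rp p \<Otimes>\<^sub>M Rp p)"
      unfolding enorm_def by (rule measurable_compose) measurable
    then show ?thesis using sets_\<pi> measurable_cong_sets by blast
  qed
  have d_int: "integrable \<pi> ?d" and d_le: "(\<integral>z. ?d z \<partial>\<pi>) \<le> e"
  proof -
    show int: "integrable \<pi> ?d"
      using assms(6) by (intro integrableI_nonneg d_meas) (auto intro: order_le_less_trans)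
    have "ennreal (\<integral>z. ?d z \<partial>\<pi>) \<le> ennreal e"
      using assms(6) by (subst (asm) nn_integral_eq_integral[OF int]) auto
    then show "(\<integral>z. ?d z \<partial>\<pi>) \<le> e" using assms(7) by simp
  qed
  \<comment> \<open>A coordinatewise map sends the product measure to the product of the image
    measures; this is applied to both projections of the coupling.\<close>
  have marg: "h \<in> measurable \<pi> R \<and> PiM ?I (\<lambda>_. R) = distr (PiM ?I (\<lambda>_. \<pi>)) (PiM ?I (\<lambda>_. R)) (compose ?I h)
       \<and> compose ?I h \<in> measurable (PiM ?I (\<lambda>_. \<pi>)) (PiM ?I (\<lambda>_. R))"
    if "distr \<pi> (Rp p) h = R" "h \<in> measurable (Rp p \<Otimes>\<^sub>M Rp p) (Rp p)" "prob_space R" "sets R = sets (Rp p)" for h R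
  proof -
    have h: "h \<in> measurable \<pi> R"
      using that(2) measurable_cong_sets[OF sets_\<pi> that(4)] by blast
    have "distr \<pi> R h = distr \<pi> (Rp p) h" by (rule distr_cong) (use that(4) in auto)
    then have dR: "distr \<pi> R h = R" using that(1) by simp
    have "distr (PiM ?I (\<lambda>_. \<pi>)) (PiM ?I (\<lambda>_. R)) (compose ?I h) = PiM ?I (\<lambda>_. distr \<pi> R h)"
      by (rule distr_PiM_finite_prob_space') (use h prob_\<pi> that(3) in auto)
    moreover have "compose ?I h \<in> measurable (PiM ?I (\<lambda>_. \<pi>)) (PiM ?I (\<lambda>_. R))"
      unfolding compose_def [abs_def]
      by (rule measurable_restrict, rule measurable_compose[OF _ h], rule measurable_component_singleton)
    ultimately show ?thesis using h dR by simp
  qed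
  have "fst \<in> measurable (Rp p \<Otimes>\<^sub>M Rp p) (Rp p)" "snd \<in> measurable (Rp p \<Otimes>\<^sub>M Rp p) (Rp p)" by auto
  note mP = marg[OF fst_\<pi> this(1) P] and mQ = marg[OF snd_\<pi> this(2) Q]
  note intP = Phi_integrable[OF bd P(2,1), of n "\<lambda>_. 1"] and intQ = Phi_integrable[OF bd Q(2,1), of n "\<lambda>_. 1"]
  have int1: "integrable (PiM ?I (\<lambda>_. \<pi>)) (\<lambda>Z. ?H (compose ?I fst Z))"
    using mP intP by (metis integrable_distr)
  have int2: "integrable (PiM ?I (\<lambda>_. \<pi>)) (\<lambda>Z. ?H (compose ?I snd Z))"
    using mQ intQ by (metis integrable_distr)
  have intd: "integrable (PiM ?I (\<lambda>_. \<pi>)) (\<lambda>Z. ?d (Z i))" if "i < n" for i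
    by (rule integrable_PiM_component[OF prob_\<pi> _ d_int]) (use that in simp)
  have "(\<integral>X. ?H X \<partial>PiM ?I (\<lambda>_. P)) = (\<integral>Z. ?H (compose ?I fst Z) \<partial>PiM ?I (\<lambda>_. \<pi>))"
    using mP integral_distr[of "compose ?I fst" "PiM ?I (\<lambda>_. \<pi>)" "PiM ?I (\<lambda>_. P)" ?H] intP by auto
  also have "\<dots> \<le> (\<integral>Z. ?H (compose ?I snd Z) + K * (\<Sum>i<n. ?d (Z i)) \<partial>PiM ?I (\<lambda>_. \<pi>))"
  proof (rule integral_mono[OF int1])
    show "integrable (PiM ?I (\<lambda>_. \<pi>)) (\<lambda>Z. ?H (compose ?I snd Z) + K * (\<Sum>i<n. ?d (Z i)))"
      by (intro Bochner_Integration.integrable_add int2 integrable_mult_right Bochner_Integration.integrable_sum intd) simp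
    show "?H (compose ?I fst Z) \<le> ?H (compose ?I snd Z) + K * (\<Sum>i<n. ?d (Z i))" for Z
      using Phi_lipschitz[OF bd, of n "\<lambda>_. 1" "compose ?I fst Z" "compose ?I snd Z"] by (simp add: compose_def)
  qed
  also have "\<dots> = (\<integral>Z. ?H (compose ?I snd Z) \<partial>PiM ?I (\<lambda>_. \<pi>)) + K * (\<Sum>i<n. (\<integral>Z. ?d (Z i) \<partial>PiM ?I (\<lambda>_. \<pi>)))"
  proof -
    have "integrable (PiM ?I (\<lambda>_. \<pi>)) (\<lambda>Z. \<Sum>i<n. ?d (Z i))"
      by (intro Bochner_Integration.integrable_sum intd) simp
    moreover have "(\<integral>Z. (\<Sum>i<n. ?d (Z i)) \<partial>PiM ?I (\<lambda>_. \<pi>)) = (\<Sum>i<n. (\<integral>Z. ?d (Z i) \<partial>PiM ?I (\<lambda>_. \<pi>)))"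
      by (intro Bochner_Integration.integral_sum intd) simp
    ultimately show ?thesis using int2 by simp
  qed
  also have "(\<integral>Z. ?H (compose ?I snd Z) \<partial>PiM ?I (\<lambda>_. \<pi>)) = (\<integral>X. ?H X \<partial>PiM ?I (\<lambda>_. Q))"
    using mQ integral_distr[of "compose ?I snd" "PiM ?I (\<lambda>_. \<pi>)" "PiM ?I (\<lambda>_. Q)" ?H] intQ by auto
  also have "(\<Sum>i<n. (\<integral>Z. ?d (Z i) \<partial>PiM ?I (\<lambda>_. \<pi>))) \<le> (\<Sum>i<n. e)"
  proof (rule sum_mono)
    fix i assume "i \<in> {..<n}"
    then have "(\<integral>Z. ?d (Z i) \<partial>PiM ?I (\<lambda>_. \<pi>)) = (\<integral>z. ?d z \<partial>\<pi>)"
      by (intro integral_PiM_component prob_\<pi> d_meas)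
    then show "(\<integral>Z. ?d (Z i) \<partial>PiM ?I (\<lambda>_. \<pi>)) \<le> e" using d_le by simp
  qed
  finally show ?thesis using K_nonneg by (simp add: mult_left_mono)
qed

end

section \<open>Quadratic forms and the spectral norm\<close>

definition bil :: "nat \<Rightarrow> (nat \<Rightarrow> nat \<Rightarrow> real) \<Rightarrow> (nat \<Rightarrow> real) \<Rightarrow> (nat \<Rightarrow> real) \<Rightarrow> real" where
  "bil p S x y = (\<Sum>i<p. \<Sum>j<p. x i * S i j * y j)"

lemma bil_alt: "bil p S x y = (\<Sum>i<p. x i * (\<Sum>j<p. S i j * y j))"
  by (simp add: bil_def sum_distrib_left mult.assoc)

lemma bil_sym: "symmetric_mat p S \<Longrightarrow> bil p S x y = bil p S y x"
  unfolding bil_def by (subst sum.swap) (auto simp: symmetric_mat_def mult_ac intro!: sum.cong)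

lemma bil_add_cmult:
  assumes "symmetric_mat p S"
  shows "bil p S (\<lambda>i. x i + t * y i) (\<lambda>i. x i + t * y i)
    = bil p S x x + 2 * t * bil p S y x + t\<^sup>2 * bil p S y y"
proof -
  have "bil p S (\<lambda>i. x i + t * y i) (\<lambda>i. x i + t * y i)
      = bil p S x x + t * bil p S x y + t * bil p S y x + t\<^sup>2 * bil p S y y"
    by (simp add: bil_def algebra_simps sum.distrib sum_distrib_left power2_eq_square)
  then show ?thesis using bil_sym[OF assms, of x y] by simp
qed

lemma bil_cmult: "bil p S (\<lambda>i. t * y i) (\<lambda>i. t * y i) = t\<^sup>2 * bil p S y y"
  by (simp add: bil_def algebra_simps sum_distrib_left power2_eq_square)

lemma bil_cong: "(\<And>i. i < p \<Longrightarrow> x i = x' i) \<Longrightarrow> (\<And>i. i < p \<Longrightarrow> y i = y' i) \<Longrightarrow> bil p S x y = bil p S x' y'"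
  by (simp add: bil_def)

lemma bil_unit: "i < p \<Longrightarrow> bil p S (\<lambda>k. if k = i then 1 else 0) x = (\<Sum>j<p. S i j * x j)"
  by (simp add: bil_alt if_distrib[of "\<lambda>u. u * _"] cong: if_cong)

text \<open>First-order condition at a minimum. The test value is - a / d with d larger than the
  absolute value of b, where the quadratic term cannot compensate the linear one.\<close>

lemma nonneg_quadratic_linear_zero:
  fixes a b :: real
  assumes "\<And>t. 0 \<le> 2 * t * a + t\<^sup>2 * b"
  shows "a = 0"
proof (rule ccontr)
  assume "a \<noteq> 0"
  define d where "d = \<bar>b\<bar> + 1"
  have d: "0 < d" "b \<le> d" by (auto simp: d_def)
  have "2 * (- a / d) * a + (- a / d)\<^sup>2 * b = a\<^sup>2 / d\<^sup>2 * (b - 2 * d)"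
    using d by (simp add: field_simps power2_eq_square)
  moreover have "a\<^sup>2 / d\<^sup>2 * (b - 2 * d) < 0"
    using d \<open>a \<noteq> 0\<close> by (intro mult_pos_neg) auto
  ultimately show False using assms[of "- a / d"] by linarith
qed

text \<open>\<open>Theta\<close> constrains eigenvalues, while the estimates need quadratic forms.
  The form attains its minimum on the unit sphere, and stationarity there is the eigenvalue
  equation.\<close>

lemma rayleigh_minimum:
  assumes sym: "symmetric_mat p S" and "1 \<le> p"
  shows "\<exists>m. is_eigenvalue p S m \<and> (\<forall>x. m * (\<Sum>i<p. (x i)\<^sup>2) \<le> bil p S x x)"
proof -
  \<comment> \<open>With the entries from p on fixed to 0, this copy of the sphere is a closed
    subset of a power of [-1, 1], which is compact by Tychonoff.\<close>
  define U :: "(nat \<Rightarrow> real) set" where "U = {x. (\<forall>i. p \<le> i \<longrightarrow> x i = 0) \<and> (\<Sum>i<p. (x i)\<^sup>2) = 1}"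
  have coord: "continuous_on A (\<lambda>x :: nat \<Rightarrow> real. x i)" for A i
    by (rule continuous_on_subset[OF continuous_on_product_coordinates]) simp
  have "closed {x :: nat \<Rightarrow> real. p \<le> i \<longrightarrow> x i = 0}" for i
    by (cases "p \<le> i") (auto intro!: closed_Collect_eq coord)
  then have closed: "closed U"
    unfolding U_def by (intro closed_Collect_conj closed_Collect_all closed_Collect_eq continuous_intros coord)
  have box: "compact (Pi\<^sub>E UNIV (\<lambda>_::nat. {-1..1::real}))"
  proof -
    have "compactin (product_topology (\<lambda>_. euclidean) UNIV) (Pi\<^sub>E UNIV (\<lambda>_::nat. {-1..1::real}))"
      by (subst compactin_PiE) simp
    then show ?thesis by (simp add: euclidean_product_topology)
  qed
  have "U \<subseteq> Pi\<^sub>E UNIV (\<lambda>_. {-1..1})"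
  proof
    fix x assume x: "x \<in> U"
    have "\<bar>x i\<bar> \<le> 1" for i
    proof (cases "i < p")
      case True
      then have "(x i)\<^sup>2 \<le> (\<Sum>i<p. (x i)\<^sup>2)" by (intro member_le_sum) auto
      then show ?thesis using x by (simp add: U_def abs_square_le_1)
    qed (use x in \<open>simp add: U_def\<close>)
    then show "x \<in> Pi\<^sub>E UNIV (\<lambda>_. {-1..1})" by (auto simp: abs_le_iff)
  qed
  then have "compact U" using compact_Int_closed[OF box closed] by (simp add: Int_absorb1)
  moreover have "(\<lambda>i. if i = 0 then 1 else 0) \<in> U"
    using assms(2) by (auto simp: U_def if_distrib[of "\<lambda>u. u\<^sup>2"] cong: if_cong)
  moreover have "continuous_on U (\<lambda>x. bil p S x x)"
    unfolding bil_def by (intro continuous_intros coord)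
  ultimately obtain x0 where x0: "x0 \<in> U" and min: "\<And>y. y \<in> U \<Longrightarrow> bil p S x0 x0 \<le> bil p S y y"
    using continuous_attains_inf[of U "\<lambda>x. bil p S x x"] by blast
  define m where "m = bil p S x0 x0"
  have lower: "m * (\<Sum>i<p. (y i)\<^sup>2) \<le> bil p S y y" for y
  proof (cases "(\<Sum>i<p. (y i)\<^sup>2) = 0")
    case True
    then have "\<And>i. i < p \<Longrightarrow> y i = 0" by (simp add: sum_nonneg_eq_0_iff)
    then have "bil p S y y = 0" by (simp add: bil_def)
    then show ?thesis using True by simp
  next
    case False
    define q where "q = (\<Sum>i<p. (y i)\<^sup>2)"
    have q: "0 < q" using False sum_nonneg[of "{..<p}" "\<lambda>i. (y i)\<^sup>2"] by (simp add: q_def)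
    let ?z = "\<lambda>i. if i < p then (1 / sqrt q) * y i else 0"
    have "(\<Sum>i<p. (?z i)\<^sup>2) = (\<Sum>i<p. (1 / sqrt q)\<^sup>2 * (y i)\<^sup>2)"
      by (rule sum.cong) (auto simp: power_divide)
    also have "\<dots> = (1 / sqrt q)\<^sup>2 * q" by (simp only: q_def sum_distrib_left)
    finally have "(\<Sum>i<p. (?z i)\<^sup>2) = (1 / sqrt q)\<^sup>2 * q" .
    then have "?z \<in> U" using q by (simp add: U_def power_divide)
    from min[OF this] have "m \<le> bil p S (\<lambda>i. (1 / sqrt q) * y i) (\<lambda>i. (1 / sqrt q) * y i)"
      using bil_cong[of p ?z "\<lambda>i. (1 / sqrt q) * y i" ?z "\<lambda>i. (1 / sqrt q) * y i" S] by (simp add: m_def)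
    also have "\<dots> = bil p S y y / q" unfolding bil_cmult using q by (simp add: power_divide)
    finally show ?thesis using q by (simp add: q_def[symmetric] pos_le_divide_eq)
  qed
  have "(\<Sum>j<p. S i j * x0 j) = m * x0 i" if i: "i < p" for i
  proof -
    let ?e = "\<lambda>k. if k = i then 1 else 0 :: real"
    \<comment> \<open>The inequality \<open>lower\<close> is an equality at \<open>x0\<close>, so
      perturbing \<open>x0\<close> along the i-th basis vector leaves a nonnegative quadratic in t
      without constant term.\<close>
    have "0 \<le> 2 * t * (bil p S ?e x0 - m * x0 i) + t\<^sup>2 * (bil p S ?e ?e - m)" for t
    proof -
      have "(\<Sum>k<p. (x0 k + t * ?e k)\<^sup>2) = (\<Sum>k<p. (x0 k)\<^sup>2) + (\<Sum>k<p. if k = i then 2 * t * x0 k + t\<^sup>2 else 0)"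
        unfolding sum.distrib[symmetric] by (rule sum.cong) (auto simp: power2_sum)
      also have "\<dots> = 1 + 2 * t * x0 i + t\<^sup>2" using x0 i by (simp add: U_def)
      finally show ?thesis
        using lower[of "\<lambda>k. x0 k + t * ?e k"] unfolding bil_add_cmult[OF sym]
        by (simp add: m_def[symmetric] algebra_simps)
    qed
    from nonneg_quadratic_linear_zero[OF this] show ?thesis using bil_unit[OF i, of S x0] by simp
  qed
  moreover have "\<exists>i<p. x0 i \<noteq> 0"
  proof (rule ccontr)
    assume "\<not> ?thesis"
    then have "(\<Sum>i<p. (x0 i)\<^sup>2) = 0" by simp
    then show False using x0 by (simp add: U_def)
  qed
  ultimately show ?thesis using lower unfolding is_eigenvalue_def by blast
qed

text \<open>The upper bound is the lower one for the negated matrix, whose eigenvalues are the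
  negatives of those of \<open>S\<close>.\<close>

lemma Theta_bounds:
  assumes "S \<in> Theta p M1 M2" "1 \<le> p"
  shows "symmetric_mat p S" "M1 * (\<Sum>i<p. (x i)\<^sup>2) \<le> bil p S x x" "bil p S x x \<le> M2 * (\<Sum>i<p. (x i)\<^sup>2)"
proof -
  show sym: "symmetric_mat p S" using assms(1) by (simp add: Theta_def psd_def)
  have ev: "is_eigenvalue p S lam \<Longrightarrow> M1 \<le> lam \<and> lam \<le> M2" for lam
    using assms(1) by (simp add: Theta_def)
  have nn: "0 \<le> (\<Sum>i<p. (x i)\<^sup>2)" by (rule sum_nonneg) simp
  obtain m where m: "is_eigenvalue p S m" "\<And>x. m * (\<Sum>i<p. (x i)\<^sup>2) \<le> bil p S x x"
    using rayleigh_minimum[OF sym assms(2)] by blast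
  have "M1 * (\<Sum>i<p. (x i)\<^sup>2) \<le> m * (\<Sum>i<p. (x i)\<^sup>2)"
    by (rule mult_right_mono[OF _ nn]) (use ev[OF m(1)] in simp)
  then show "M1 * (\<Sum>i<p. (x i)\<^sup>2) \<le> bil p S x x" using m(2)[of x] by linarith
  let ?N = "\<lambda>i j. - S i j"
  have "symmetric_mat p ?N" using sym by (simp add: symmetric_mat_def)
  then obtain m' where m': "is_eigenvalue p ?N m'" "\<And>x. m' * (\<Sum>i<p. (x i)\<^sup>2) \<le> bil p ?N x x"
    using rayleigh_minimum[OF _ assms(2)] by blast
  have "is_eigenvalue p S (- m')"
  proof -
    obtain v where "\<exists>i<p. v i \<noteq> 0" "\<And>i. i < p \<Longrightarrow> (\<Sum>j<p. ?N i j * v j) = m' * v i"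
      using m'(1) unfolding is_eigenvalue_def by blast
    then show ?thesis unfolding is_eigenvalue_def
      by (intro exI[of _ v]) (auto simp: sum_negf minus_equation_iff)
  qed
  from ev[OF this] have "- M2 \<le> m'" by simp
  then have "- M2 * (\<Sum>i<p. (x i)\<^sup>2) \<le> m' * (\<Sum>i<p. (x i)\<^sup>2)" by (rule mult_right_mono[OF _ nn])
  moreover have "bil p ?N x x = - bil p S x x" by (simp add: bil_def sum_negf)
  ultimately show "bil p S x x \<le> M2 * (\<Sum>i<p. (x i)\<^sup>2)" using m'(2)[of x] by simp
qed

text \<open>Cholesky factorisation, splitting off the last row and column. \<open>mat_sqrt\<close>
  is a choice operator, so the existence of a factor is what gives it meaning.\<close>

lemma positive_definite_factor:
  assumes "symmetric_mat p S" "\<And>x. \<exists>i<p. x i \<noteq> 0 \<Longrightarrow> 0 < bil p S x x"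
  shows "\<exists>A. \<forall>i<p. \<forall>j<p. (\<Sum>k<p. A i k * A j k) = S i j"
  using assms
proof (induction p arbitrary: S)
  case (Suc p)
  have sym: "S i j = S j i" if "i < Suc p" "j < Suc p" for i j
    using Suc.prems(1) that by (simp add: symmetric_mat_def)
  define s where "s = S p p"
  have s: "0 < s"
    using Suc.prems(2)[of "\<lambda>k. if k = p then 1 else 0"] bil_unit[of p "Suc p" S "\<lambda>k. if k = p then 1 else 0"]
    by (auto simp: s_def if_distrib[of "\<lambda>u. _ * u"] cong: if_cong)
  \<comment> \<open>The Schur complement of the last diagonal entry.\<close>
  define T where "T i j = S i j - S i p * S p j / s" for i j
  have "0 < bil p T x x" if x: "\<exists>i<p. x i \<noteq> 0" for x
  proof -
    define c where "c = (\<Sum>j<p. S p j * x j)"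
    have c': "(\<Sum>i<p. x i * S i p) = c" unfolding c_def by (rule sum.cong) (auto simp: sym)
    \<comment> \<open>The last coordinate minimises the form of \<open>S\<close> over all extensions
      of x; the minimum is the form of \<open>T\<close> at x.\<close>
    define z where "z i = (if i < p then x i else - c / s)" for i
    have z: "z i = x i" if "i < p" for i using that by (simp add: z_def)
    have zp: "z p = - c / s" by (simp add: z_def)
    have "0 < bil (Suc p) S z z" by (rule Suc.prems(2)) (use x z less_SucI in metis)
    also have "bil (Suc p) S z z = bil p S x x + (\<Sum>i<p. x i * S i p * (- c / s)) + (- c / s) * c + (- c / s) * s * (- c / s)"
    proof -
      have "(\<Sum>j<p. (- c / s) * S p j * x j) = (- c / s) * c" by (simp only: c_def sum_distrib_left mult.assoc)
      then show ?thesis by (simp add: bil_def z zp sum.distrib sum_subtractf sum_negf s_def[symmetric])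
    qed
    also have "(\<Sum>i<p. x i * S i p * (- c / s)) = c * (- c / s)" by (simp only: c'[symmetric] sum_distrib_right)
    also have "bil p S x x + c * (- c / s) + (- c / s) * c + (- c / s) * s * (- c / s) = bil p S x x - c * c / s"
      using s by (simp add: field_simps)
    also have "\<dots> = bil p T x x"
    proof -
      have "bil p T x x = bil p S x x - (\<Sum>i<p. \<Sum>j<p. (x i * S i p) * (S p j * x j) / s)"
        by (simp add: bil_def T_def sum_subtractf algebra_simps)
      also have "(\<Sum>i<p. \<Sum>j<p. (x i * S i p) * (S p j * x j) / s) = c * c / s"
        by (simp add: sum_divide_distrib[symmetric] sum_product[symmetric] c' c_def[symmetric])
      finally show ?thesis by simp
    qed
    finally show ?thesis .
  qed
  moreover have "symmetric_mat p T" by (auto simp: symmetric_mat_def T_def sym mult.commute)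
  ultimately obtain A where A: "\<forall>i<p. \<forall>j<p. (\<Sum>k<p. A i k * A j k) = T i j" using Suc.IH by blast
  define A' where "A' i k = (if k = p then S i p / sqrt s else if i = p then 0 else A i k)" for i k
  have "(\<Sum>k<Suc p. A' i k * A' j k) = S i j" if "i < Suc p" "j < Suc p" for i j
  proof -
    have "A' i p * A' j p = S i p * S p j / s"
      using s sym[of j p] that by (simp add: A'_def)
    moreover have "(\<Sum>k<p. A' i k * A' j k) = S i j - S i p * S p j / s"
    proof (cases "i = p \<or> j = p")
      case True
      then have "(\<Sum>k<p. A' i k * A' j k) = 0" by (auto simp: A'_def intro!: sum.neutral)
      then show ?thesis using True s by (auto simp: s_def[symmetric])
    next
      case False
      then have "(\<Sum>k<p. A' i k * A' j k) = T i j" using A that by (simp add: A'_def)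
      then show ?thesis by (simp add: T_def)
    qed
    ultimately show ?thesis by simp
  qed
  then show ?case by blast
qed simp

lemma Theta_mat_sqrt:
  assumes "S \<in> Theta p M1 M2" "1 \<le> p" "0 < M1" "i < p" "j < p"
  shows "(\<Sum>k<p. mat_sqrt p S i k * mat_sqrt p S j k) = S i j"
proof -
  have "0 < bil p S x x" if x: "\<exists>i<p. x i \<noteq> 0" for x
  proof -
    obtain i where i: "i < p" "x i \<noteq> 0" using x by blast
    have "0 < (\<Sum>i<p. (x i)\<^sup>2)" by (rule sum_pos2[of _ i]) (use i in auto)
    then have "0 < M1 * (\<Sum>i<p. (x i)\<^sup>2)" using assms(3) by simp
    also note Theta_bounds(2)[OF assms(1,2)]
    finally show ?thesis .
  qed
  from positive_definite_factor[OF Theta_bounds(1)[OF assms(1,2)] this]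
  have "\<forall>i<p. \<forall>j<p. (\<Sum>k<p. mat_sqrt p S i k * mat_sqrt p S j k) = S i j"
    unfolding mat_sqrt_def by (rule someI_ex)
  then show ?thesis using assms(4,5) by blast
qed

text \<open>Polarisation: with w the normalised image of x, the norm of that image is the bilinear
  form at w and x, a quarter of the difference of the quadratic form at x + w and x - w. By the
  parallelogram law the squared norms of x + w and x - w sum to at most 4.\<close>

lemma spec_norm_le:
  assumes sym: "symmetric_mat p D" and quad: "\<And>u. \<bar>bil p D u u\<bar> \<le> K * (\<Sum>i<p. (u i)\<^sup>2)" and "0 \<le> K"
  shows "spec_norm p D \<le> K"
  unfolding spec_norm_def
proof (rule cSup_least)
  have "enorm p (mat_vec p D (\<lambda>_. 0)) \<in> {enorm p (mat_vec p D x) |x. enorm p x \<le> 1}"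
    by (intro CollectI exI[of _ "\<lambda>_. 0"]) simp
  then show "{enorm p (mat_vec p D x) |x. enorm p x \<le> 1} \<noteq> {}" by blast
  fix r assume "r \<in> {enorm p (mat_vec p D x) |x. enorm p x \<le> 1}"
  then obtain x where r: "r = enorm p (mat_vec p D x)" and x: "enorm p x \<le> 1" by blast
  define v where "v i = (\<Sum>j<p. D i j * x j)" for i
  have rv: "r = enorm p v" by (simp add: r v_def mat_vec_def enorm_def)
  show "r \<le> K"
  proof (cases "r = 0")
    case False
    then have r0: "0 < r" using enorm_nonneg[of p v] unfolding rv by linarith
    have v2: "(\<Sum>i<p. (v i)\<^sup>2) = r\<^sup>2" by (simp only: rv enorm_square)
    let ?w = "\<lambda>i. v i / r"
    have w: "(\<Sum>i<p. (?w i)\<^sup>2) = 1"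
      unfolding power_divide sum_divide_distrib[symmetric] v2 using r0 by simp
    have "bil p D ?w x = (\<Sum>i<p. (v i)\<^sup>2) / r"
      by (simp add: bil_alt v_def[symmetric] power2_eq_square sum_divide_distrib)
    also have "\<dots> = r" unfolding v2 using r0 by (simp add: power2_eq_square)
    finally have bw: "bil p D ?w x = r" .
    have "4 * r = bil p D (\<lambda>i. x i + 1 * ?w i) (\<lambda>i. x i + 1 * ?w i) - bil p D (\<lambda>i. x i + (-1) * ?w i) (\<lambda>i. x i + (-1) * ?w i)"
      unfolding bil_add_cmult[OF sym] bw by simp
    also have "\<dots> \<le> K * (\<Sum>i<p. (x i + 1 * ?w i)\<^sup>2) + K * (\<Sum>i<p. (x i + (-1) * ?w i)\<^sup>2)"
      using quad[of "\<lambda>i. x i + 1 * ?w i"] quad[of "\<lambda>i. x i + (-1) * ?w i"] by linarith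
    also have "\<dots> = K * (2 * (\<Sum>i<p. (x i)\<^sup>2) + 2 * (\<Sum>i<p. (?w i)\<^sup>2))"
      by (simp only: distrib_left[symmetric] sum_distrib_left sum.distrib[symmetric])
         (simp add: power2_eq_square algebra_simps)
    also have "\<dots> \<le> K * 4"
      using x enorm_square[of p x] w power_mono[OF x enorm_nonneg, of 2] assms(3) by (intro mult_left_mono) auto
    finally show ?thesis by simp
  qed (use assms(3) in simp)
qed

section \<open>Gaussian marginals\<close>

definition std_normal :: "real measure" where
  "std_normal = density lborel std_normal_density"

lemma prob_space_std_normal: "prob_space std_normal"
  unfolding std_normal_def by (rule prob_space_normal_density) simp

lemma sets_std_normal [simp, measurable_cong]: "sets std_normal = sets borel"
  by (simp add: std_normal_def)

lemma std_gauss_alt: "std_gauss p = PiM {..<p} (\<lambda>_. std_normal)"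
  by (simp add: std_gauss_def std_normal_def)

lemma prob_space_std_gauss: "prob_space (std_gauss p)"
  unfolding std_gauss_alt by (intro prob_space_PiM prob_space_std_normal)

lemma sets_std_gauss: "sets (std_gauss p) = sets (Rp p)"
  unfolding std_gauss_alt Rp_def by (intro sets_PiM_cong) auto

lemma Rp_component_measurable: "j < p \<Longrightarrow> (\<lambda>x. x j) \<in> borel_measurable (Rp p)"
  unfolding Rp_def by (intro measurable_component_singleton) simp

lemma mat_vec_measurable: "mat_vec p A \<in> measurable (std_gauss p) (Rp p)"
proof -
  have "mat_vec p A \<in> measurable (Rp p) (Rp p)"
    unfolding mat_vec_def [abs_def]
    by (subst (2) Rp_def, rule measurable_restrict)
       (intro borel_measurable_sum borel_measurable_times borel_measurable_const Rp_component_measurable, simp)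
  then show ?thesis using measurable_cong_sets[OF sets_std_gauss] by blast
qed

lemma sets_gaussian: "sets (gaussian p S) = sets (Rp p)"
  by (simp add: gaussian_def)

lemma prob_space_gaussian: "prob_space (gaussian p S)"
  unfolding gaussian_def by (rule prob_space.prob_space_distr[OF prob_space_std_gauss mat_vec_measurable])

lemma distributed_std_normal_scaled:
  assumes "c \<noteq> 0"
  shows "distributed std_normal lborel (\<lambda>z. c * z) (normal_density 0 \<bar>c\<bar>)"
proof -
  interpret prob_space std_normal by (rule prob_space_std_normal)
  have "distributed std_normal lborel (\<lambda>z. z) std_normal_density"
    unfolding distributed_def std_normal_def by (auto simp: distr_id2)
  from normal_density_affine[OF this _ assms, of 0] show ?thesis by simp
qed

lemma distributed_std_gauss_linear:
  assumes v: "0 < (\<Sum>k<p. (a k)\<^sup>2)"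
  shows "distributed (std_gauss p) lborel (\<lambda>z. \<Sum>k<p. a k * z k) (normal_density 0 (sqrt (\<Sum>k<p. (a k)\<^sup>2)))"
proof -
  interpret G: prob_space "std_gauss p" by (rule prob_space_std_gauss)
  \<comment> \<open>The sum rule for independent normals is applied to positive standard deviations,
    so terms with coefficient 0 are dropped first.\<close>
  define I where "I = {k. k < p \<and> a k \<noteq> 0}"
  have I: "finite I" "I \<subseteq> {..<p}" by (auto simp: I_def)
  have sub: "(\<Sum>k<p. a k * g k) = (\<Sum>k\<in>I. a k * g k)" "(\<Sum>k<p. (a k)\<^sup>2) = (\<Sum>k\<in>I. (a k)\<^sup>2)" for g :: "nat \<Rightarrow> real"
    by (rule sum.mono_neutral_right; use I in \<open>auto simp: I_def\<close>)+
  have "I \<noteq> {}" using v unfolding sub(2) by auto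
  then have p: "{..<p} \<noteq> {}" using I by auto
  have comp: "distr (std_gauss p) borel (\<lambda>z. z k) = std_normal" if "k < p" for k
  proof -
    have "distr (std_gauss p) borel (\<lambda>z. z k) = distr (std_gauss p) std_normal (\<lambda>z. z k)"
      by (rule distr_cong) auto
    also have "\<dots> = std_normal"
      unfolding std_gauss_alt by (rule distr_PiM_component) (use that prob_space_std_normal in auto)
    finally show ?thesis .
  qed
  have meas: "(\<lambda>z. z k) \<in> borel_measurable (std_gauss p)" if "k < p" for k
    using Rp_component_measurable[OF that] measurable_cong_sets[OF sets_std_gauss] by blast
  have "G.indep_vars (\<lambda>_. borel) (\<lambda>k z. z k) {..<p}"
  proof (subst G.indep_vars_iff_distr_eq_PiM'[OF p])
    have "distr (std_gauss p) (PiM {..<p} (\<lambda>_. borel)) (\<lambda>z. \<lambda>k\<in>{..<p}. z k) = distr (std_gauss p) (std_gauss p) (\<lambda>z. z)"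
    proof (rule distr_cong)
      fix z assume "z \<in> space (std_gauss p)"
      then have "z \<in> extensional {..<p}" by (auto simp: std_gauss_alt space_PiM PiE_def)
      then show "(\<lambda>k\<in>{..<p}. z k) = z" by (rule extensional_restrict)
    qed (auto simp: sets_std_gauss Rp_def)
    also have "\<dots> = std_gauss p" by (rule distr_id)
    also have "\<dots> = PiM {..<p} (\<lambda>k. distr (std_gauss p) borel (\<lambda>z. z k))"
      unfolding std_gauss_alt by (rule PiM_cong) (auto simp: comp[unfolded std_gauss_alt])
    finally show "distr (std_gauss p) (PiM {..<p} (\<lambda>_. borel)) (\<lambda>z. \<lambda>k\<in>{..<p}. z k)
        = PiM {..<p} (\<lambda>k. distr (std_gauss p) borel (\<lambda>z. z k))" .
  qed (use meas in auto)
  then have "G.indep_vars (\<lambda>_. borel) (\<lambda>k z. a k * z k) {..<p}"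
    by (rule G.indep_vars_compose2) auto
  then have indep: "G.indep_vars (\<lambda>_. borel) (\<lambda>k z. a k * z k) I"
    by (rule G.indep_vars_subset) (rule I(2))
  have "distributed (std_gauss p) lborel (\<lambda>z. \<Sum>k\<in>I. a k * z k) (normal_density (\<Sum>k\<in>I. 0) (sqrt (\<Sum>k\<in>I. \<bar>a k\<bar>\<^sup>2)))"
  proof (rule G.sum_indep_normal[OF I(1) \<open>I \<noteq> {}\<close> indep])
    fix k assume k: "k \<in> I"
    then show "0 < \<bar>a k\<bar>" by (simp add: I_def)
    have "distributed (std_gauss p) lborel (\<lambda>z. z k) std_normal_density"
      using comp[of k] meas[of k] k unfolding distributed_def std_normal_def I_def
      by (auto intro: distr_cong[THEN trans, rotated -1])
    from G.normal_density_affine[OF this _, of "a k" 0] k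
    show "distributed (std_gauss p) lborel (\<lambda>z. a k * z k) (normal_density 0 \<bar>a k\<bar>)" by (simp add: I_def)
  qed
  then show ?thesis unfolding sub by simp
qed

text \<open>The marginal depends on the factor A of S only through the product of A with its
  transpose, so the choice made by \<open>mat_sqrt\<close> is immaterial. Writing it as a rescaled
  standard normal lets two covariances be compared under one integral.\<close>

lemma gaussian_marginal:
  assumes S: "S \<in> Theta p M1 M2" "1 \<le> p" "0 < M1" and w: "0 < (\<Sum>i<p. (w i)\<^sup>2)"
  shows "distr (gaussian p S) borel (\<lambda>x. \<Sum>j<p. w j * x j)
       = distr std_normal borel (\<lambda>z. sqrt (bil p S w w) * z)"
proof -
  define A where "A = mat_sqrt p S"
  define a where "a k = (\<Sum>j<p. w j * A j k)" for k
  have "(\<Sum>k<p. (a k)\<^sup>2) = (\<Sum>k<p. \<Sum>i<p. \<Sum>j<p. w i * (A i k * A j k) * w j)"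
    by (simp add: a_def power2_eq_square sum_product mult_ac)
  also have "\<dots> = (\<Sum>i<p. \<Sum>k<p. \<Sum>j<p. w i * (A i k * A j k) * w j)" by (rule sum.swap)
  also have "\<dots> = (\<Sum>i<p. \<Sum>j<p. \<Sum>k<p. w i * (A i k * A j k) * w j)"
    by (rule sum.cong[OF refl]) (rule sum.swap)
  also have "\<dots> = (\<Sum>i<p. \<Sum>j<p. w i * (\<Sum>k<p. A i k * A j k) * w j)"
    by (simp only: sum_distrib_left sum_distrib_right)
  also have "\<dots> = bil p S w w"
    unfolding bil_def A_def by (intro sum.cong refl) (simp add: Theta_mat_sqrt[OF S])
  finally have sum_a: "(\<Sum>k<p. (a k)\<^sup>2) = bil p S w w" .
  have pos: "0 < bil p S w w"
    using Theta_bounds(2)[OF S(1,2), of w] mult_pos_pos[OF S(3) w] by linarith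
  have lin: "(\<Sum>j<p. w j * mat_vec p A z j) = (\<Sum>k<p. a k * z k)" for z
  proof -
    have "(\<Sum>j<p. w j * mat_vec p A z j) = (\<Sum>j<p. \<Sum>k<p. w j * A j k * z k)"
      by (simp add: mat_vec_def sum_distrib_left mult.assoc)
    also have "\<dots> = (\<Sum>k<p. a k * z k)" by (subst sum.swap) (simp add: a_def sum_distrib_right)
    finally show ?thesis .
  qed
  have w_meas: "(\<lambda>x. \<Sum>j<p. w j * x j) \<in> borel_measurable (Rp p)"
    by (intro borel_measurable_sum borel_measurable_times borel_measurable_const Rp_component_measurable) simp
  have "distr (gaussian p S) borel (\<lambda>x. \<Sum>j<p. w j * x j) = distr (std_gauss p) borel (\<lambda>z. \<Sum>k<p. a k * z k)"
    unfolding gaussian_def A_def[symmetric] by (subst distr_distr[OF w_meas mat_vec_measurable]) (simp add: comp_def lin)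
  also have "\<dots> = distr (std_gauss p) lborel (\<lambda>z. \<Sum>k<p. a k * z k)" by (rule distr_cong) auto
  also have "\<dots> = density lborel (normal_density 0 (sqrt (bil p S w w)))"
    using distributed_std_gauss_linear[where p = p and a = a] pos unfolding sum_a by (simp add: distributed_def)
  also have "\<dots> = distr std_normal lborel (\<lambda>z. sqrt (bil p S w w) * z)"
    using distributed_std_normal_scaled[of "sqrt (bil p S w w)"] pos by (simp add: distributed_def)
  also have "\<dots> = distr std_normal borel (\<lambda>z. sqrt (bil p S w w) * z)" by (rule distr_cong) auto
  finally show ?thesis .
qed

lemma integral_gaussian_marginal:
  fixes h :: "real \<Rightarrow> real"
  assumes "S \<in> Theta p M1 M2" "1 \<le> p" "0 < M1" "0 < (\<Sum>i<p. (w i)\<^sup>2)"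
    and h: "h \<in> borel_measurable borel"
  shows "(\<integral>x. h (\<Sum>j<p. w j * x j) \<partial>gaussian p S) = (\<integral>z. h (sqrt (bil p S w w) * z) \<partial>std_normal)"
    and "integrable (gaussian p S) (\<lambda>x. h (\<Sum>j<p. w j * x j)) \<longleftrightarrow> integrable std_normal (\<lambda>z. h (sqrt (bil p S w w) * z))"
proof -
  have w_meas: "(\<lambda>x. \<Sum>j<p. w j * x j) \<in> borel_measurable (gaussian p S)"
    unfolding measurable_cong_sets[OF sets_gaussian refl]
    by (intro borel_measurable_sum borel_measurable_times borel_measurable_const Rp_component_measurable) simp
  have z_meas: "(\<lambda>z. sqrt (bil p S w w) * z) \<in> borel_measurable std_normal" by measurable
  note eq = gaussian_marginal[OF assms(1-4)]
  show "(\<integral>x. h (\<Sum>j<p. w j * x j) \<partial>gaussian p S) = (\<integral>z. h (sqrt (bil p S w w) * z) \<partial>std_normal)"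
    using integral_distr[OF w_meas h] integral_distr[OF z_meas h] eq by simp
  show "integrable (gaussian p S) (\<lambda>x. h (\<Sum>j<p. w j * x j)) \<longleftrightarrow> integrable std_normal (\<lambda>z. h (sqrt (bil p S w w) * z))"
    using integrable_distr_eq[OF w_meas h] integrable_distr_eq[OF z_meas h] eq by simp
qed

lemma std_normal_moment_4: "has_bochner_integral std_normal (\<lambda>z. z ^ 4) 3"
proof -
  have "has_bochner_integral lborel (\<lambda>x. std_normal_density x * x ^ (2 * 2)) (fact (2 * 2) / (2 ^ 2 * fact 2))"
    by (rule std_normal_moment_even)
  moreover have "fact (2 * 2) / (2 ^ 2 * fact 2) = (3::real)" by (simp add: fact_numeral)
  ultimately have *: "has_bochner_integral lborel (\<lambda>x. std_normal_density x * x ^ 4) 3" by simp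
  have int: "integrable std_normal (\<lambda>z. z ^ 4)"
    unfolding std_normal_def by (subst integrable_density) (use * in \<open>auto simp: has_bochner_integral_iff\<close>)
  have "(\<integral>z. z ^ 4 \<partial>std_normal) = 3"
    unfolding std_normal_def by (subst integral_density) (use * in \<open>auto simp: has_bochner_integral_iff\<close>)
  then show ?thesis using int by (simp add: has_bochner_integral_iff)
qed

text \<open>By Cauchy-Schwarz the fourth power of the norm is at most p times the sum of the fourth
  powers of the coordinates, so one-dimensional marginals suffice.\<close>

lemma gaussian_enorm_4:
  assumes S: "S \<in> Theta p M1 M2" "1 \<le> p" "0 < M1" "M1 \<le> M2"
  shows "integrable (gaussian p S) (\<lambda>x. (enorm p x) ^ 4)"
    and "(\<integral>x. (enorm p x) ^ 4 \<partial>gaussian p S) \<le> 3 * (real p)\<^sup>2 * M2\<^sup>2"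
proof -
  have coord: "integrable (gaussian p S) (\<lambda>x. x i ^ 4) \<and> (\<integral>x. x i ^ 4 \<partial>gaussian p S) \<le> 3 * M2\<^sup>2" if i: "i < p" for i
  proof -
    let ?e = "\<lambda>k. if k = i then 1 else 0 :: real"
    have e1: "(\<Sum>k<p. (?e k)\<^sup>2) = 1" using i by (simp add: if_distrib[of "\<lambda>u. u\<^sup>2"] cong: if_cong)
    have ex: "(\<Sum>k<p. ?e k * x k) = x i" for x using i by (simp add: if_distrib[of "\<lambda>u. u * _"] cong: if_cong)
    let ?v = "bil p S ?e ?e"
    have v: "0 \<le> ?v" "?v \<le> M2"
      using Theta_bounds(2,3)[OF S(1,2), of ?e] S(3) unfolding e1 by auto
    note marg = integral_gaussian_marginal[OF S(1-3), of ?e "\<lambda>u. u ^ 4", unfolded e1 ex]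
    have "has_bochner_integral std_normal (\<lambda>z. (sqrt ?v) ^ 4 * z ^ 4) ((sqrt ?v) ^ 4 * 3)"
      by (intro has_bochner_integral_mult_right std_normal_moment_4)
    moreover have "(sqrt ?v) ^ 4 = ?v\<^sup>2" using v(1) by (simp add: power4_eq_xxxx power2_eq_square)
    ultimately have "has_bochner_integral std_normal (\<lambda>z. (sqrt ?v * z) ^ 4) (?v\<^sup>2 * 3)"
      by (simp add: power_mult_distrib)
    moreover have "?v\<^sup>2 \<le> M2\<^sup>2" using v by (intro power_mono) auto
    ultimately show ?thesis using marg by (simp add: has_bochner_integral_iff)
  qed
  have sq_le: "(enorm p x) ^ 4 \<le> real p * (\<Sum>i<p. x i ^ 4)" for x
  proof -
    have "(enorm p x) ^ 4 = (\<Sum>i<p. 1 * (x i)\<^sup>2)\<^sup>2"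
      using enorm_square[of p x] by (simp add: power4_eq_xxxx power2_eq_square)
    also have "\<dots> \<le> (\<Sum>i<p. 1\<^sup>2) * (\<Sum>i<p. ((x i)\<^sup>2)\<^sup>2)" by (rule Cauchy_Schwarz_ineq_sum)
    finally show ?thesis by simp
  qed
  have meas: "(\<lambda>x. (enorm p x) ^ 4) \<in> borel_measurable (gaussian p S)"
  proof -
    have "(\<lambda>x. \<Sum>i<p. (x i)\<^sup>2) \<in> borel_measurable (Rp p)"
      by (intro borel_measurable_sum borel_measurable_power Rp_component_measurable) simp
    then have "(\<lambda>x. (sqrt (\<Sum>i<p. (x i)\<^sup>2)) ^ 4) \<in> borel_measurable (Rp p)"
      by (rule measurable_compose) measurable
    then show ?thesis unfolding enorm_def measurable_cong_sets[OF sets_gaussian refl] .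
  qed
  have sum_int: "integrable (gaussian p S) (\<lambda>x. real p * (\<Sum>i<p. x i ^ 4))"
    by (intro integrable_mult_right Bochner_Integration.integrable_sum) (use coord in auto)
  show int: "integrable (gaussian p S) (\<lambda>x. (enorm p x) ^ 4)"
    by (rule Bochner_Integration.integrable_bound[OF sum_int meas])
       (use sq_le in \<open>auto intro!: AE_I2 order_trans[OF _ abs_ge_self]\<close>)
  have "(\<integral>x. (enorm p x) ^ 4 \<partial>gaussian p S) \<le> (\<integral>x. real p * (\<Sum>i<p. x i ^ 4) \<partial>gaussian p S)"
    by (rule integral_mono[OF int sum_int]) (rule sq_le)
  also have "\<dots> = real p * (\<Sum>i<p. (\<integral>x. x i ^ 4 \<partial>gaussian p S))"
    by (subst integral_mult_right_zero, subst Bochner_Integration.integral_sum) (use coord in auto)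
  also have "\<dots> \<le> real p * (\<Sum>i<p. 3 * M2\<^sup>2)"
    by (intro mult_left_mono sum_mono) (use coord in auto)
  finally show "(\<integral>x. (enorm p x) ^ 4 \<partial>gaussian p S) \<le> 3 * (real p)\<^sup>2 * M2\<^sup>2"
    by (simp add: power2_eq_square mult_ac)
qed

section \<open>Detecting the variance with a sigmoid\<close>

lemma sigmoid_measurable [measurable]: "sigmoid \<in> borel_measurable borel"
  unfolding sigmoid_def [abs_def] by measurable

lemma std_normal_reflect:
  fixes h :: "real \<Rightarrow> real"
  assumes h[measurable]: "h \<in> borel_measurable borel"
  shows "(\<integral>z. h (- z) \<partial>std_normal) = (\<integral>z. h z \<partial>std_normal)"
proof -
  have "distr std_normal lborel (\<lambda>z. -1 * z) = distr std_normal lborel (\<lambda>z. 1 * z)"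
    using distributed_std_normal_scaled[of "-1"] distributed_std_normal_scaled[of 1] by (simp add: distributed_def)
  then have "(\<integral>x. h x \<partial>distr std_normal lborel (\<lambda>z. -1 * z)) = (\<integral>x. h x \<partial>distr std_normal lborel (\<lambda>z. 1 * z))"
    by simp
  then show ?thesis by (subst (asm) (1 2) integral_distr) auto
qed

text \<open>This window is where the variance gap is collected: for z in [1, 2], z^2 is at least 1
  while t z is at most 2 t.\<close>

lemma std_normal_12_pos: "0 < measure std_normal {1..2}"
proof (rule ccontr)
  interpret prob_space std_normal by (rule prob_space_std_normal)
  assume "\<not> ?thesis"
  then have "emeasure std_normal {1..2} = 0" by (simp add: emeasure_eq_measure not_less measure_le_0_iff)
  then have "(\<integral>\<^sup>+x. ennreal (std_normal_density x) * indicator {1..2} x \<partial>lborel) = 0"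
    unfolding std_normal_def by (subst (asm) emeasure_density) auto
  then have "AE x in lborel. ennreal (std_normal_density x) * indicator {1..2} x = 0"
    by (subst (asm) nn_integral_0_iff_AE) auto
  then have "AE x in lborel. x \<notin> {1..2::real}"
  proof (rule eventually_mono)
    fix x :: real assume "ennreal (std_normal_density x) * indicator {1..2} x = 0"
    moreover have "0 < std_normal_density x" by (rule normal_density_pos) simp
    ultimately show "x \<notin> {1..2}" by (auto simp: indicator_def split: if_splits)
  qed
  then have "emeasure lborel {1..2::real} = 0" by (subst (asm) AE_iff_measurable[of "{1..2}"]) auto
  then show False by simp
qed

text \<open>The even part of \<open>x \<mapsto> sigmoid (x - 1)\<close>, up to the factor 2, is a strictly increasing function of
  \<open>cosh x\<close>.  This is why a sigmoid with non-zero bias detects the variance of a centred Gaussian.\<close>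

lemma sigmoid_even_part:
  "sigmoid (x - 1) + sigmoid (- x - 1)
    = 1 - (exp 1 * exp 1 - 1) / (1 + exp 1 * exp 1 + exp 1 * (exp x + exp (- x)))"
proof -
  define e a b :: real where "e = exp 1" and "a = exp x" and "b = exp (- x)"
  have ab: "a * b = 1" "0 < a" "0 < b" "0 < e" by (simp_all add: a_def b_def e_def exp_minus)
  have "sigmoid (x - 1) = 1 / (1 + e * b)" "sigmoid (- x - 1) = 1 / (1 + e * a)"
    by (simp_all add: sigmoid_def a_def b_def e_def exp_add[symmetric])
  moreover have "1 / (1 + e * b) + 1 / (1 + e * a) = 1 - (e * e - 1) / (1 + e * e + e * (a + b))"
  proof -
    have prod: "(1 + e * b) * (1 + e * a) = 1 + e * e + e * (a + b)"
      using ab(1) by (simp add: algebra_simps)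
    have nz: "1 + e * b \<noteq> 0" "1 + e * a \<noteq> 0" "1 + e * e + e * (a + b) \<noteq> 0"
    proof -
      have "0 < 1 + e * b" "0 < 1 + e * a" using ab by (auto intro!: add_pos_pos)
      then show "1 + e * b \<noteq> 0" "1 + e * a \<noteq> 0" "1 + e * e + e * (a + b) \<noteq> 0"
        unfolding prod[symmetric] by auto
    qed
    have "1 / (1 + e * b) + 1 / (1 + e * a) = ((1 + e * a) + (1 + e * b)) / ((1 + e * b) * (1 + e * a))"
      using nz by (simp add: add_frac_eq)
    also have "\<dots> = ((1 + e * e + e * (a + b)) - (e * e - 1)) / (1 + e * e + e * (a + b))"
      unfolding prod by (simp add: algebra_simps)
    also have "\<dots> = 1 - (e * e - 1) / (1 + e * e + e * (a + b))"
      unfolding diff_divide_distrib using nz by simp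
    finally show ?thesis .
  qed
  ultimately show ?thesis by (simp add: e_def a_def b_def)
qed

text \<open>The difference factors as \<open>(exp x - exp y) * (1 - exp (- (x + y)))\<close>; the
  factors are at least x - y and \<open>(x + y) * exp (- 2 * X)\<close>.\<close>

lemma exp_plus_exp_minus_diff:
  fixes x y X :: real
  assumes "0 \<le> y" "y \<le> x" "x \<le> X"
  shows "(x\<^sup>2 - y\<^sup>2) * exp (- 2 * X) \<le> (exp x + exp (- x)) - (exp y + exp (- y))"
proof -
  let ?r = "x + y"
  have "?r * exp (- ?r) \<le> 1 - exp (- ?r)"
  proof -
    have "(1 + ?r) * exp (- ?r) \<le> exp ?r * exp (- ?r)" by (intro mult_right_mono exp_ge_add_one_self) simp
    also have "exp ?r * exp (- ?r) = 1" unfolding exp_add[symmetric] by simp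
    finally show ?thesis by (simp only: distrib_right mult_1_left le_diff_eq add.commute)
  qed
  moreover have "?r * exp (- 2 * X) \<le> ?r * exp (- ?r)" using assms by (intro mult_left_mono) auto
  ultimately have r: "?r * exp (- 2 * X) \<le> 1 - exp (- ?r)" by linarith
  have "x - y \<le> exp y * (exp (x - y) - 1)"
  proof -
    have "x - y \<le> exp (x - y) - 1" using exp_ge_add_one_self[of "x - y"] by linarith
    then have "1 * (x - y) \<le> exp y * (exp (x - y) - 1)"
      by (intro mult_mono) (use assms in auto)
    then show ?thesis by simp
  qed
  also have "\<dots> = exp x - exp y" by (simp add: algebra_simps exp_diff)
  finally have d: "x - y \<le> exp x - exp y" .
  have "(x\<^sup>2 - y\<^sup>2) * exp (- 2 * X) = (x - y) * (?r * exp (- 2 * X))"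
    by (simp add: power2_eq_square algebra_simps)
  also have "\<dots> \<le> (exp x - exp y) * (1 - exp (- ?r))"
    by (rule mult_mono[OF d r]) (use assms in auto)
  also have "\<dots> = (exp x + exp (- x)) - (exp y + exp (- y))"
  proof -
    have "exp x * exp (- ?r) = exp (- y)" "exp y * exp (- ?r) = exp (- x)" by (simp_all add: exp_add[symmetric])
    then show ?thesis by (simp add: algebra_simps)
  qed
  finally show ?thesis .
qed

text \<open>A lower bound, on [0, X], for the growth of the sum in \<open>sigmoid_even_part\<close>
  as a function of x^2. The squared term bounds the two denominators that arise when the values at x
  and y are subtracted.\<close>

definition gap_const :: "real \<Rightarrow> real" where
  "gap_const X = (exp 1 * exp 1 - 1) * exp 1 * exp (- 2 * X) / (1 + exp 1 * exp 1 + 2 * exp 1 * exp X)\<^sup>2"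

lemma gap_const_pos: "0 < gap_const X"
proof -
  have "1 < exp 1 * exp (1::real)" by (simp add: exp_add[symmetric])
  moreover have "0 < 1 + exp 1 * exp 1 + 2 * exp 1 * exp X" by (intro add_pos_pos) auto
  ultimately show ?thesis unfolding gap_const_def by (intro divide_pos_pos mult_pos_pos) auto
qed

text \<open>Monotonicity fixes the sign of the difference for all arguments; the quantitative gap is
  available for arguments up to X.\<close>

lemma sigmoid_even_part_diff:
  assumes "0 \<le> y" "y \<le> x"
  shows "sigmoid (y - 1) + sigmoid (- y - 1) \<le> sigmoid (x - 1) + sigmoid (- x - 1)"
    and "x \<le> X \<Longrightarrow> gap_const X * (x\<^sup>2 - y\<^sup>2) \<le> (sigmoid (x - 1) + sigmoid (- x - 1)) - (sigmoid (y - 1) + sigmoid (- y - 1))"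
proof -
  define e :: real where "e = exp 1"
  define u where "u x = exp x + exp (- x)" for x :: real
  define D where "D x = 1 + e * e + e * u x" for x
  have e: "0 < e" "0 < e * e - 1"
  proof -
    have "exp 0 < exp (1 + 1 :: real)" by (subst exp_less_cancel_iff) simp
    then show "0 < e * e - 1" unfolding exp_add e_def by simp
  qed (simp add: e_def)
  have u0: "0 < u x" for x by (simp add: u_def add_pos_pos)
  have D0: "0 < D x" for x unfolding D_def using e u0[of x] by (intro add_pos_pos mult_pos_pos) auto
  have diff: "(sigmoid (x - 1) + sigmoid (- x - 1)) - (sigmoid (y - 1) + sigmoid (- y - 1))
      = (e * e - 1) * e * (u x - u y) / (D x * D y)"
  proof -
    have "(sigmoid (x - 1) + sigmoid (- x - 1)) - (sigmoid (y - 1) + sigmoid (- y - 1))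
       = (e * e - 1) / D y - (e * e - 1) / D x"
      unfolding sigmoid_even_part by (simp add: D_def u_def e_def)
    also have "\<dots> = (e * e - 1) * (D x - D y) / (D x * D y)"
      using D0[of x] D0[of y] by (simp add: field_simps)
    also have "D x - D y = e * (u x - u y)" by (simp add: D_def algebra_simps)
    finally show ?thesis by (simp add: mult.assoc)
  qed
  have u_diff: "(x\<^sup>2 - y\<^sup>2) * exp (- 2 * X) \<le> u x - u y" if "x \<le> X" for X
    unfolding u_def by (rule exp_plus_exp_minus_diff[OF assms that])
  have sq: "0 \<le> x\<^sup>2 - y\<^sup>2" using assms by (simp add: power_mono)
  then have "0 \<le> (x\<^sup>2 - y\<^sup>2) * exp (- 2 * x)" by simp
  then have "0 \<le> u x - u y" using u_diff[of x] by linarith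
  then have "0 \<le> (e * e - 1) * e * (u x - u y) / (D x * D y)"
    using e D0[of x] D0[of y] by simp
  then show "sigmoid (y - 1) + sigmoid (- y - 1) \<le> sigmoid (x - 1) + sigmoid (- x - 1)"
    using diff by linarith
  show "gap_const X * (x\<^sup>2 - y\<^sup>2) \<le> (sigmoid (x - 1) + sigmoid (- x - 1)) - (sigmoid (y - 1) + sigmoid (- y - 1))"
    if X: "x \<le> X"
  proof -
    define DX where "DX = 1 + e * e + 2 * e * exp X"
    have D_le: "D z \<le> DX" if "0 \<le> z" "z \<le> X" for z
    proof -
      have "exp z \<le> exp X" "exp (- z) \<le> exp X" using that by auto
      then have "u z \<le> 2 * exp X" unfolding u_def by linarith
      then have "e * u z \<le> e * (2 * exp X)" using e by (intro mult_left_mono) auto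
      then show ?thesis by (simp add: D_def DX_def)
    qed
    have "D x * D y \<le> DX\<^sup>2"
      unfolding power2_eq_square by (rule mult_mono) (use D_le assms X D0 less_imp_le order_trans in \<open>meson\<close>)+
    have "gap_const X * (x\<^sup>2 - y\<^sup>2) = (e * e - 1) * e * ((x\<^sup>2 - y\<^sup>2) * exp (- 2 * X)) / DX\<^sup>2"
      by (simp add: gap_const_def DX_def e_def)
    also have "\<dots> \<le> (e * e - 1) * e * (u x - u y) / (D x * D y)"
    proof (rule frac_le)
      show "(e * e - 1) * e * ((x\<^sup>2 - y\<^sup>2) * exp (- 2 * X)) \<le> (e * e - 1) * e * (u x - u y)"
        by (rule mult_left_mono[OF u_diff[OF X]]) (use e in auto)
      show "0 \<le> (e * e - 1) * e * (u x - u y)" using e \<open>0 \<le> u x - u y\<close> by simp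
    qed (use D0 \<open>D x * D y \<le> DX\<^sup>2\<close> in auto)
    finally show ?thesis using diff by simp
  qed
qed

text \<open>By symmetry of the normal law, twice the mean of the sigmoid is the mean of its sum with
  the reflected sigmoid. That sum increases with the absolute value of its argument, so the
  integrand is nonnegative for every z, and the gap comes from z in [1, 2].\<close>

lemma std_normal_sigmoid_gap:
  assumes "0 \<le> s" "s \<le> t" "2 * t \<le> X"
  shows "gap_const X * measure std_normal {1..2} * (t\<^sup>2 - s\<^sup>2)
     \<le> 2 * ((\<integral>z. sigmoid (t * z - 1) \<partial>std_normal) - (\<integral>z. sigmoid (s * z - 1) \<partial>std_normal))"
proof -
  interpret prob_space std_normal by (rule prob_space_std_normal)
  define q where "q x = sigmoid (x - 1) + sigmoid (- x - 1)" for x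
  have int: "integrable std_normal (\<lambda>z. sigmoid (c * z - 1))" for c
  proof (rule integrable_const_bound[where B = 1])
    show "AE z in std_normal. norm (sigmoid (c * z - 1)) \<le> 1"
      by (rule AE_I2) (use sigmoid_pos less_imp_le[OF sigmoid_less_1] in \<open>auto simp: abs_of_pos\<close>)
  qed measurable
  have int_q: "integrable std_normal (\<lambda>z. q (c * z))" for c
    using Bochner_Integration.integrable_add[OF int[of c] int[of "- c"]] by (simp add: q_def)
  have q_int: "(\<integral>z. q (c * z) \<partial>std_normal) = 2 * (\<integral>z. sigmoid (c * z - 1) \<partial>std_normal)" for c
  proof -
    have "(\<integral>z. q (c * z) \<partial>std_normal) = (\<integral>z. sigmoid (c * z - 1) \<partial>std_normal) + (\<integral>z. sigmoid (- c * z - 1) \<partial>std_normal)"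
      unfolding q_def using Bochner_Integration.integral_add[OF int[of c] int[of "- c"]] by simp
    also have "(\<integral>z. sigmoid (- c * z - 1) \<partial>std_normal) = (\<integral>z. sigmoid (c * z - 1) \<partial>std_normal)"
      using std_normal_reflect[of "\<lambda>z. sigmoid (c * z - 1)"] by simp
    finally show ?thesis by simp
  qed
  have q_abs: "q \<bar>x\<bar> = q x" for x by (cases "0 \<le> x") (auto simp: q_def)
  have ts: "0 \<le> t\<^sup>2 - s\<^sup>2" using assms by (simp add: power_mono)
  have point: "gap_const X * (t\<^sup>2 - s\<^sup>2) * indicator {1..2} z \<le> q (t * z) - q (s * z)" for z
  proof -
    have "\<bar>s * z\<bar> \<le> \<bar>t * z\<bar>" using assms by (auto simp: abs_mult intro: mult_right_mono)
    note mono = sigmoid_even_part_diff[OF abs_ge_zero this, folded q_def, unfolded q_abs]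
    show ?thesis
    proof (cases "z \<in> {1..2}")
      case True
      have "t * z \<le> t * 2" using True assms by (intro mult_left_mono) auto
      then have X: "\<bar>t * z\<bar> \<le> X" using True assms by (simp add: abs_mult)
      have "1 \<le> z\<^sup>2" using True by simp
      then have "(t\<^sup>2 - s\<^sup>2) * 1 \<le> (t\<^sup>2 - s\<^sup>2) * z\<^sup>2" by (rule mult_left_mono[OF _ ts])
      also have "\<dots> = \<bar>t * z\<bar>\<^sup>2 - \<bar>s * z\<bar>\<^sup>2" by (simp add: power_mult_distrib algebra_simps)
      finally have "gap_const X * (t\<^sup>2 - s\<^sup>2) \<le> gap_const X * (\<bar>t * z\<bar>\<^sup>2 - \<bar>s * z\<bar>\<^sup>2)"
        using gap_const_pos[of X] by (intro mult_left_mono) auto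
      then show ?thesis using mono(2)[OF X] True by simp
    next
      case False
      then show ?thesis using mono(1) by simp
    qed
  qed
  have "gap_const X * measure std_normal {1..2} * (t\<^sup>2 - s\<^sup>2)
      = (\<integral>z. gap_const X * (t\<^sup>2 - s\<^sup>2) * indicator {1..2} z \<partial>std_normal)"
    by simp
  also have "\<dots> \<le> (\<integral>z. q (t * z) - q (s * z) \<partial>std_normal)"
    by (rule integral_mono[OF _ _ point]) (use int_q in \<open>auto simp: emeasure_eq_measure\<close>)
  also have "\<dots> = 2 * ((\<integral>z. sigmoid (t * z - 1) \<partial>std_normal) - (\<integral>z. sigmoid (s * z - 1) \<partial>std_normal))"
    using int_q q_int by simp
  finally show ?thesis .
qed

section \<open>The W-GAN estimator\<close>

lemma DNN_lipschitz_class: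
  assumes "0 \<le> B" "2 \<le> L"
  shows "lipschitz_class p (DNN p B L) B"
proof
  show "DNN p B L \<noteq> {}" unfolding DNN_l1_hull using l1_hull_zero by blast
qed (use DNN_props[OF assms] assms(1) in auto)

text \<open>The mean of the squared \<open>slope_weight\<close> is of order p^2, which the
  denominator in \<open>first_layer_bound\<close> is scaled to cancel. The constants are 464 = 16 +
  14 * 32 and 28 = 14 * 2.\<close>

lemma expected_first_layer_bound:
  assumes S: "S \<in> Theta p M1 M2" "1 \<le> p" "0 < M1" "M1 \<le> M2" and n: "1 \<le> n" and "0 \<le> B"
  shows "integrable (PiM {..<n} (\<lambda>_. gaussian p S)) (first_layer_bound p B n)"
    and "(\<integral>y. first_layer_bound p B n y \<partial>PiM {..<n} (\<lambda>_. gaussian p S))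
       \<le> (464 + 28 * B ^ 4 * M2\<^sup>2) * sqrt (real n * real p)"
proof -
  let ?Q = "gaussian p S"
  let ?P = "PiM {..<n} (\<lambda>_. ?Q)"
  define C where "C = 32 + 2 * B ^ 4 * M2\<^sup>2"
  define a where "a = sqrt (real n * real p)"
  have a0: "0 < a" and aa: "a * a = real n * real p" using n S(2) by (auto simp: a_def)
  interpret Q: prob_space ?Q by (rule prob_space_gaussian)
  interpret P: prob_space ?P by (intro prob_space_PiM prob_space_gaussian)
  note e4 = gaussian_enorm_4[OF S]
  have e_meas: "enorm p \<in> borel_measurable ?Q"
    using enorm_measurable measurable_cong_sets[OF sets_gaussian] by blast
  have m_le: "(slope_weight p B y)\<^sup>2 \<le> 32 + B ^ 4 / 2 * (enorm p y) ^ 4" for y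
  proof -
    have "(4 + u / 2)\<^sup>2 \<le> 32 + u\<^sup>2 / 2" for u :: real
      using zero_le_power2[of "4 - u / 2"] by (simp add: power2_eq_square algebra_simps)
    from this[of "B\<^sup>2 * (enorm p y)\<^sup>2"] show ?thesis
      by (simp add: slope_weight_def power_mult_distrib)
  qed
  have bound_int: "integrable ?Q (\<lambda>y. 32 + B ^ 4 / 2 * (enorm p y) ^ 4)"
    by (intro Bochner_Integration.integrable_add integrable_mult_right e4) simp
  have m_int: "integrable ?Q (\<lambda>y. (slope_weight p B y)\<^sup>2)"
  proof (rule Bochner_Integration.integrable_bound[OF bound_int])
    show "(\<lambda>y. (slope_weight p B y)\<^sup>2) \<in> borel_measurable ?Q" unfolding slope_weight_def using e_meas by measurable
  qed (use m_le in \<open>auto intro!: AE_I2 order_trans[OF _ abs_ge_self]\<close>)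
  have "(\<integral>y. (slope_weight p B y)\<^sup>2 \<partial>?Q) \<le> (\<integral>y. 32 + B ^ 4 / 2 * (enorm p y) ^ 4 \<partial>?Q)"
    by (rule integral_mono[OF m_int bound_int]) (rule m_le)
  also have "\<dots> = 32 + B ^ 4 / 2 * (\<integral>y. (enorm p y) ^ 4 \<partial>?Q)"
    using e4(1) by (simp add: Q.prob_space)
  also have "\<dots> \<le> 32 + B ^ 4 / 2 * (3 * (real p)\<^sup>2 * M2\<^sup>2)"
    by (intro add_left_mono mult_left_mono e4(2)) simp
  also have "\<dots> \<le> C * (real p)\<^sup>2"
  proof -
    have "32 * 1 \<le> 32 * (real p)\<^sup>2" using S(2) by (intro mult_left_mono) auto
    moreover have "B ^ 4 / 2 * (3 * (real p)\<^sup>2 * M2\<^sup>2) \<le> 2 * B ^ 4 * M2\<^sup>2 * (real p)\<^sup>2"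
    proof -
      have "0 \<le> B ^ 4 * M2\<^sup>2 * (real p)\<^sup>2" by simp
      then show ?thesis by (simp add: field_simps)
    qed
    ultimately show ?thesis unfolding C_def distrib_right by linarith
  qed
  finally have Em: "(\<integral>y. (slope_weight p B y)\<^sup>2 \<partial>?Q) \<le> C * (real p)\<^sup>2" .
  have comp_int: "integrable ?P (\<lambda>Y. (slope_weight p B (Y i))\<^sup>2)" if "i < n" for i
    by (rule integrable_PiM_component[OF prob_space_gaussian _ m_int]) (use that in simp)
  have comp_Em: "(\<integral>Y. (slope_weight p B (Y i))\<^sup>2 \<partial>?P) \<le> C * (real p)\<^sup>2" if "i < n" for i
    using integral_PiM_component[OF prob_space_gaussian, of i "{..<n}" "\<lambda>y. (slope_weight p B y)\<^sup>2" p S] m_int that Em by auto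
  have sum_int: "integrable ?P (\<lambda>Y. \<Sum>i<n. (slope_weight p B (Y i))\<^sup>2)"
    by (intro Bochner_Integration.integrable_sum comp_int) simp
  have flb: "first_layer_bound p B n = (\<lambda>Y. 16 * a + 14 / (real p * a) * (\<Sum>i<n. (slope_weight p B (Y i))\<^sup>2))"
    by (simp add: first_layer_bound_def a_def fun_eq_iff)
  show "integrable ?P (first_layer_bound p B n)"
    unfolding flb by (intro Bochner_Integration.integrable_add integrable_mult_right sum_int) simp
  have "(\<integral>Y. first_layer_bound p B n Y \<partial>?P)
      = 16 * a + 14 / (real p * a) * (\<Sum>i<n. (\<integral>Y. (slope_weight p B (Y i))\<^sup>2 \<partial>?P))"
  proof -
    have "(\<integral>Y. (\<Sum>i<n. (slope_weight p B (Y i))\<^sup>2) \<partial>?P) = (\<Sum>i<n. (\<integral>Y. (slope_weight p B (Y i))\<^sup>2 \<partial>?P))"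
      by (intro Bochner_Integration.integral_sum comp_int) simp
    then show ?thesis unfolding flb using sum_int by (simp add: P.prob_space)
  qed
  also have "\<dots> \<le> 16 * a + 14 / (real p * a) * (\<Sum>i<n. C * (real p)\<^sup>2)"
    by (intro add_left_mono mult_left_mono sum_mono comp_Em) (use a0 in auto)
  also have "14 / (real p * a) * (\<Sum>i<n. C * (real p)\<^sup>2) = 14 * C * ((real n * real p) / a)"
    using S(2) by (simp add: power2_eq_square)
  also have "(real n * real p) / a = a" using a0 by (simp add: aa[symmetric])
  finally show "(\<integral>Y. first_layer_bound p B n Y \<partial>?P) \<le> (464 + 28 * B ^ 4 * M2\<^sup>2) * sqrt (real n * real p)"
    by (simp add: C_def a_def algebra_simps)
qed

section \<open>Deviation of the empirical measure over the network class\<close>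

definition deviation :: "nat \<Rightarrow> real \<Rightarrow> nat \<Rightarrow> nat \<Rightarrow> (nat \<Rightarrow> nat \<Rightarrow> real) \<Rightarrow> (nat \<Rightarrow> nat \<Rightarrow> real) \<Rightarrow> real" where
  "deviation p B L n S X =
     lipschitz_class.Phi (DNN p B L) n (\<lambda>_. 1) (\<lambda>f. real n * (\<integral>x. f x \<partial>gaussian p S)) X"

lemma expected_deviation:
  assumes S: "S \<in> Theta p M1 M2" "1 \<le> p" "0 < M1" "M1 \<le> M2" and n: "1 \<le> n" and B: "0 \<le> B" and L: "2 \<le> L"
  shows "(\<integral>X. deviation p B L n S X \<partial>PiM {..<n} (\<lambda>_. gaussian p S))
     \<le> 2 ^ L * (464 + 28 * B ^ 4 * M2\<^sup>2) * sqrt (real n * real p)"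
proof -
  interpret lipschitz_class p "DNN p B L" B by (rule DNN_lipschitz_class[OF B L])
  let ?P = "PiM {..<n} (\<lambda>_. gaussian p S)"
  note E = expected_first_layer_bound[OF S n B]
  have "(\<integral>X. deviation p B L n S X \<partial>?P) \<le> 2 * (\<integral>y. 2 ^ (L - 2) * first_layer_bound p B n y \<partial>?P)"
    unfolding deviation_def
    by (rule symmetrization[OF prob_space_gaussian sets_gaussian rsup_DNN[OF S(2) n B L]])
       (intro integrable_mult_right E)
  also have "\<dots> = 2 ^ (L - 1) * (\<integral>y. first_layer_bound p B n y \<partial>?P)"
  proof -
    have "L - 1 = Suc (L - 2)" using L by simp
    then show ?thesis by simp
  qed
  also have "\<dots> \<le> 2 ^ L * ((464 + 28 * B ^ 4 * M2\<^sup>2) * sqrt (real n * real p))"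
    by (rule mult_mono[OF power_increasing E(2)])
       (auto intro!: integral_nonneg simp: first_layer_bound_def sum_nonneg)
  finally show ?thesis by (simp add: mult.assoc)
qed

text \<open>The Wasserstein distance is an infimum over couplings; the strict inequality supplies a
  coupling of cost below \<open>e\<close> whether or not the infimum is attained.\<close>

lemma expected_deviation_contaminated:
  assumes S: "S \<in> Theta p M1 M2" "1 \<le> p" "0 < M1" "M1 \<le> M2" and n: "1 \<le> n" and B: "0 \<le> B" and L: "2 \<le> L"
    and P: "prob_space P" "sets P = sets (Rp p)" and W: "wasserstein1 p P (gaussian p S) < ennreal e" and "0 \<le> e"
  shows "(\<integral>X. deviation p B L n S X \<partial>PiM {..<n} (\<lambda>_. P))
     \<le> 2 ^ L * (464 + 28 * B ^ 4 * M2\<^sup>2) * sqrt (real n * real p) + B * (real n * e)"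
proof -
  interpret lipschitz_class p "DNN p B L" B by (rule DNN_lipschitz_class[OF B L])
  obtain \<pi> where \<pi>: "\<pi> \<in> couplings p P (gaussian p S)"
    "(\<integral>\<^sup>+ z. ennreal (enorm p (\<lambda>i. fst z i - snd z i)) \<partial>\<pi>) < ennreal e"
    using W unfolding wasserstein1_def by (auto simp: INF_less_iff)
  have bd: "bounded_on_F (\<lambda>f. real n * (\<integral>x. f x \<partial>gaussian p S))"
    unfolding bounded_on_F_def
    by (rule exI[of _ "real n"])
       (use F_integral_abs_le[OF _ sets_gaussian prob_space_gaussian] in \<open>auto simp: abs_mult intro: mult_left_le\<close>)
  have "(\<integral>X. deviation p B L n S X \<partial>PiM {..<n} (\<lambda>_. P))
      \<le> (\<integral>X. deviation p B L n S X \<partial>PiM {..<n} (\<lambda>_. gaussian p S)) + B * (real n * e)"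
    unfolding deviation_def
    by (rule Phi_coupling[OF \<pi>(1) P prob_space_gaussian sets_gaussian less_imp_le[OF \<pi>(2)] \<open>0 \<le> e\<close> bd])
  then show ?thesis using expected_deviation[OF S n B L] by linarith
qed

lemma deviation_tail:
  fixes \<epsilon> :: real and S :: "nat \<Rightarrow> nat \<Rightarrow> real"
  assumes "0 \<le> B" "2 \<le> L" "1 \<le> n" "1 \<le> p" and P: "prob_space P" "sets P = sets (Rp p)"
  defines "A \<equiv> {X \<in> space (PiM {..<n} (\<lambda>_. P)). deviation p B L n S X
      \<le> (\<integral>X. deviation p B L n S X \<partial>PiM {..<n} (\<lambda>_. P)) + sqrt (8 * real n * (real p + real n * \<epsilon>\<^sup>2))}"
  shows "A \<in> sets (PiM {..<n} (\<lambda>_. P))"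
    and "1 - exp (- (real p + real n * \<epsilon>\<^sup>2)) \<le> measure (PiM {..<n} (\<lambda>_. P)) A"
proof -
  interpret lipschitz_class p "DNN p B L" B by (rule DNN_lipschitz_class[OF assms(1,2)])
  let ?\<gamma> = "\<lambda>f. real n * (\<integral>x. f x \<partial>gaussian p S)"
  let ?t = "sqrt (8 * real n * (real p + real n * \<epsilon>\<^sup>2))"
  have \<gamma>: "\<bar>?\<gamma> f\<bar> \<le> real n" if "f \<in> DNN p B L" for f
    using F_integral_abs_le[OF that sets_gaussian prob_space_gaussian] by (auto simp: abs_mult intro: mult_left_le)
  then have bd: "bounded_on_F ?\<gamma>" unfolding bounded_on_F_def by blast
  have dev: "deviation p B L n S = Phi n (\<lambda>_. 1) ?\<gamma>" by (simp add: deviation_def fun_eq_iff)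
  have meas[measurable]: "deviation p B L n S \<in> borel_measurable (PiM {..<n} (\<lambda>_. P))"
    unfolding dev by (rule Phi_measurable[OF bd P(2)])
  show "A \<in> sets (PiM {..<n} (\<lambda>_. P))" unfolding A_def by measurable
  have pos: "0 < real p + real n * \<epsilon>\<^sup>2" using assms(4) by (intro add_pos_nonneg) auto
  \<comment> \<open>Replacing one observation changes a sum of values in [-1, 1] by at most 2. The
    level \<open>?t\<close> makes the resulting exponent t^2 / (8 n) equal to p + n
    \<epsilon>^2.\<close>
  have "1 - exp (- ?t\<^sup>2 / (2 * real n * 2\<^sup>2)) \<le> measure (PiM {..<n} (\<lambda>_. P)) A"
    unfolding A_def
  proof (rule bounded_differences_tail[OF P(1), where K = "real n + real n"])
    show "0 < ?t" using assms(3) pos by simp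
    fix X
    show "\<bar>deviation p B L n S X\<bar> \<le> real n + real n"
      using Phi_le[of ?\<gamma> "real n", OF \<gamma>, where m = n and c = "\<lambda>_. 1" and X = X]
        Phi_nonneg[OF bd, where m = n and c = "\<lambda>_. 1" and X = X] by (simp add: dev)
    fix i x assume i: "i < n"
    show "\<bar>deviation p B L n S X - deviation p B L n S (X(i := x))\<bar> \<le> 2"
      unfolding dev
    proof (rule Phi_diff[OF bd])
      fix f assume f: "f \<in> DNN p B L"
      have "(\<Sum>k<n. 1 * (f (X k) - f ((X(i := x)) k))) = (\<Sum>k<n. if k = i then f (X i) - f x else 0)"
        by (rule sum.cong) auto
      also have "\<dots> = f (X i) - f x" using i by simp
      finally show "\<bar>\<Sum>k<n. 1 * (f (X k) - f ((X(i := x)) k))\<bar> \<le> 2"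
        using F_abs_le[OF f, of "X i"] F_abs_le[OF f, of x] by simp
    qed
  qed (use assms(3) meas in auto)
  also have "- ?t\<^sup>2 / (2 * real n * 2\<^sup>2) = - (real p + real n * \<epsilon>\<^sup>2)"
    using assms(3) pos by (simp add: field_simps)
  finally show "1 - exp (- (real p + real n * \<epsilon>\<^sup>2)) \<le> measure (PiM {..<n} (\<lambda>_. P)) A" .
qed

text \<open>The two Gaussians are compared through the empirical measure: one deviation is paid
  directly at the true covariance, the other through the minimality of \<open>S\<close>.\<close>

lemma wgan_estimate_discrepancy:
  assumes est: "is_wgan_estimate p M1 M2 B L n X S" and Sstar: "Sstar \<in> Theta p M1 M2"
    and "0 \<le> B" "2 \<le> L" "1 \<le> n" and f: "f \<in> DNN p B L"
  shows "(\<integral>x. f x \<partial>gaussian p Sstar) - (\<integral>x. f x \<partial>gaussian p S) \<le> 2 * (deviation p B L n Sstar X / real n)"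
proof -
  interpret lipschitz_class p "DNN p B L" B by (rule DNN_lipschitz_class[OF assms(3,4)])
  let ?\<gamma> = "\<lambda>f. real n * (\<integral>x. f x \<partial>gaussian p Sstar)"
  let ?D = "deviation p B L n Sstar X / real n"
  have n0: "0 < real n" using assms(5) by simp
  have E1: "\<bar>\<integral>x. f x \<partial>gaussian p S\<bar> \<le> 1" if "f \<in> DNN p B L" for f S
    by (rule F_integral_abs_le[OF that sets_gaussian prob_space_gaussian])
  have "\<bar>?\<gamma> f\<bar> \<le> real n" if "f \<in> DNN p B L" for f
    using E1[OF that] by (auto simp: abs_mult intro: mult_left_le)
  then have bd: "bounded_on_F ?\<gamma>" unfolding bounded_on_F_def by blast
  have dev: "\<bar>(\<Sum>i<n. f (X i)) / real n - (\<integral>x. f x \<partial>gaussian p Sstar)\<bar> \<le> ?D" if "f \<in> DNN p B L" for f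
  proof -
    have "\<bar>(\<Sum>i<n. 1 * f (X i)) - ?\<gamma> f\<bar> \<le> deviation p B L n Sstar X"
      unfolding deviation_def by (rule Phi_upper[OF bd that])
    moreover have "(\<Sum>i<n. f (X i)) / real n - (\<integral>x. f x \<partial>gaussian p Sstar) = ((\<Sum>i<n. 1 * f (X i)) - ?\<gamma> f) / real n"
      using n0 by (simp add: field_simps)
    ultimately show ?thesis using n0 by (simp add: abs_divide divide_right_mono)
  qed
  have bdd: "bdd_above ((\<lambda>f. (\<Sum>i<n. f (X i)) / real n - (\<integral>x. f x \<partial>gaussian p S)) ` DNN p B L)"
  proof (rule bdd_above_abs_bounded)
    fix f assume f: "f \<in> DNN p B L"
    have "\<bar>(\<Sum>i<n. f (X i)) / real n - (\<integral>x. f x \<partial>gaussian p Sstar)\<bar> \<le> ?D" by (rule dev[OF f])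
    then show "\<bar>(\<Sum>i<n. f (X i)) / real n - (\<integral>x. f x \<partial>gaussian p S)\<bar> \<le> ?D + 2"
      using E1[OF f, of S] E1[OF f, of Sstar] by linarith
  qed
  have "wgan_obj p B L n X Sstar \<le> ?D"
    unfolding wgan_obj_def
  proof (rule cSUP_least[OF F_nonempty])
    fix f assume "f \<in> DNN p B L"
    from dev[OF this] show "(\<Sum>i<n. f (X i)) / real n - (\<integral>x. f x \<partial>gaussian p Sstar) \<le> ?D" by linarith
  qed
  moreover have "wgan_obj p B L n X S \<le> wgan_obj p B L n X Sstar"
    using est Sstar by (simp add: is_wgan_estimate_def)
  moreover have "(\<Sum>i<n. f (X i)) / real n - (\<integral>x. f x \<partial>gaussian p S) \<le> wgan_obj p B L n X S"
    unfolding wgan_obj_def by (rule cSUP_upper[OF f bdd])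
  ultimately show ?thesis using dev[OF f] by linarith
qed

lemma spec_norm_le_discrepancy:
  assumes S: "S \<in> Theta p M1 M2" and Sstar: "Sstar \<in> Theta p M1 M2"
    and p: "1 \<le> p" and M: "0 < M1" "M1 \<le> M2" and B: "0 < B" and L: "2 \<le> L"
    and gap: "\<And>f. f \<in> DNN p B L \<Longrightarrow> (\<integral>x. f x \<partial>gaussian p Sstar) - (\<integral>x. f x \<partial>gaussian p S) \<le> 2 * d"
  defines "\<kappa> \<equiv> gap_const (2 * (B * sqrt M2)) * measure std_normal {1..2}"
  shows "spec_norm p (mat_diff S Sstar) \<le> 4 / (\<kappa> * B\<^sup>2) * d"
proof -
  have \<kappa>0: "0 < \<kappa>" unfolding \<kappa>_def by (intro mult_pos_pos gap_const_pos std_normal_12_pos)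
  have "(\<lambda>_. 0) \<in> DNN p B L" unfolding DNN_l1_hull by (rule l1_hull_zero)
  from gap[OF this] have d0: "0 \<le> d" by simp
  have unit: "\<bar>bil p S u u - bil p Sstar u u\<bar> \<le> 4 / (\<kappa> * B\<^sup>2) * d" if u: "(\<Sum>i<p. (u i)\<^sup>2) = 1" for u
  proof -
    \<comment> \<open>The longest admissible weight vector in direction u. The neuron argument then
      has standard deviation at most \<open>B * sqrt M2\<close>, and z runs up to 2 in the window,
      whence the argument of \<open>gap_const\<close> in \<open>\<kappa>\<close>.\<close>
    define w where "w = (\<lambda>i. B * u i)"
    have w2: "(\<Sum>i<p. (w i)\<^sup>2) = B\<^sup>2" by (simp add: w_def power_mult_distrib sum_distrib_left[symmetric] u)
    have bw: "bil p T w w = B\<^sup>2 * bil p T u u" for T unfolding w_def by (rule bil_cmult)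
    define r where "r T = sqrt (bil p T w w)" for T
    have r: "0 \<le> r T" "(r T)\<^sup>2 = B\<^sup>2 * bil p T u u" "r T \<le> B * sqrt M2" if T: "T \<in> Theta p M1 M2" for T
    proof -
      have b: "0 \<le> bil p T u u" "bil p T u u \<le> M2"
        using Theta_bounds(2,3)[OF T p, of u] M(1) unfolding u by auto
      show "0 \<le> r T" "(r T)\<^sup>2 = B\<^sup>2 * bil p T u u" using b by (auto simp: r_def bw)
      show "r T \<le> B * sqrt M2" using b B by (simp add: r_def bw real_sqrt_mult)
    qed
    define g where "g T = (\<integral>z. sigmoid (r T * z - 1) \<partial>std_normal)" for T
    let ?f = "\<lambda>x. sigmoid (neuron p (w, -1) x)"
    have f_mem: "?f \<in> DNN p B L" "(\<lambda>x. - ?f x) \<in> DNN p B L"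
      using sigmoid_neuron_in_DNN[of B L p "(w, -1)"] B L w2 by (simp_all add: enorm_def)
    have f_int: "(\<integral>x. ?f x \<partial>gaussian p T) = g T" if T: "T \<in> Theta p M1 M2" for T
    proof -
      have "(\<lambda>u. sigmoid (u - 1)) \<in> borel_measurable borel" by measurable
      from integral_gaussian_marginal(1)[OF T p M(1) _ this, of w] show ?thesis
        using w2 B by (simp add: neuron_def g_def r_def)
    qed
    have g_diff: "\<bar>g Sstar - g S\<bar> \<le> 2 * d"
      using gap[OF f_mem(1)] gap[OF f_mem(2)] f_int[OF S] f_int[OF Sstar] by simp
    have "\<kappa> * \<bar>(r S)\<^sup>2 - (r Sstar)\<^sup>2\<bar> \<le> 2 * \<bar>g Sstar - g S\<bar>"
    proof (cases "r S \<le> r Sstar")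
      case True
      have "\<kappa> * ((r Sstar)\<^sup>2 - (r S)\<^sup>2) \<le> 2 * (g Sstar - g S)"
        unfolding \<kappa>_def g_def by (rule std_normal_sigmoid_gap[OF _ True]) (use r[OF S] r[OF Sstar] in auto)
      moreover have "(r S)\<^sup>2 \<le> (r Sstar)\<^sup>2" using True r(1)[OF S] by (rule power_mono)
      ultimately show ?thesis by (simp add: abs_if)
    next
      case False
      then have le: "r Sstar \<le> r S" by simp
      have "\<kappa> * ((r S)\<^sup>2 - (r Sstar)\<^sup>2) \<le> 2 * (g S - g Sstar)"
        unfolding \<kappa>_def g_def by (rule std_normal_sigmoid_gap[OF _ le]) (use r[OF S] r[OF Sstar] in auto)
      moreover have "(r Sstar)\<^sup>2 \<le> (r S)\<^sup>2" using le r(1)[OF Sstar] by (rule power_mono)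
      ultimately show ?thesis by (simp add: abs_if)
    qed
    moreover have "\<bar>(r S)\<^sup>2 - (r Sstar)\<^sup>2\<bar> = B\<^sup>2 * \<bar>bil p S u u - bil p Sstar u u\<bar>"
      unfolding r(2)[OF S] r(2)[OF Sstar] right_diff_distrib[symmetric] by (simp add: abs_mult)
    \<comment> \<open>The 4 combines the factor 2 of the gap estimate with the discrepancy 2
      d.\<close>
    ultimately have "(\<kappa> * B\<^sup>2) * \<bar>bil p S u u - bil p Sstar u u\<bar> \<le> 4 * d"
      using g_diff by (simp add: mult.assoc)
    then show ?thesis using \<kappa>0 B by (simp add: field_simps)
  qed
  show ?thesis
  proof (rule spec_norm_le)
    show "symmetric_mat p (mat_diff S Sstar)"
      using Theta_bounds(1)[OF S p] Theta_bounds(1)[OF Sstar p] by (simp add: symmetric_mat_def mat_diff_def)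
    show "0 \<le> 4 / (\<kappa> * B\<^sup>2) * d" using \<kappa>0 d0 by simp
    fix u :: "nat \<Rightarrow> real"
    have diff: "bil p (mat_diff S Sstar) u u = bil p S u u - bil p Sstar u u"
      by (simp add: bil_def mat_diff_def sum_subtractf algebra_simps)
    define q where "q = (\<Sum>i<p. (u i)\<^sup>2)"
    show "\<bar>bil p (mat_diff S Sstar) u u\<bar> \<le> 4 / (\<kappa> * B\<^sup>2) * d * (\<Sum>i<p. (u i)\<^sup>2)"
    proof (cases "q = 0")
      case True
      then have "\<And>i. i < p \<Longrightarrow> u i = 0" by (simp add: q_def sum_nonneg_eq_0_iff)
      then show ?thesis by (simp add: bil_def)
    next
      case False
      then have q: "0 < q" using sum_nonneg[of "{..<p}" "\<lambda>i. (u i)\<^sup>2"] by (simp add: q_def less_le)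
      let ?u = "\<lambda>i. (1 / sqrt q) * u i"
      have "(\<Sum>i<p. (?u i)\<^sup>2) = 1"
        unfolding power_mult_distrib sum_distrib_left[symmetric] q_def[symmetric] using q by (simp add: power_divide)
      from unit[OF this] have "\<bar>(bil p S u u - bil p Sstar u u) / q\<bar> \<le> 4 / (\<kappa> * B\<^sup>2) * d"
        unfolding bil_cmult using q by (simp add: power_divide diff_divide_distrib)
      then show ?thesis unfolding diff q_def[symmetric] using q by (simp add: abs_divide pos_divide_le_eq)
    qed
  qed
qed

theorem theorem9:
  "\<exists>c > (0::real). \<forall>M1 M2::real. 0 < M1 \<and> M1 \<le> M2 \<longrightarrow>
   (\<exists>C' > (0::real). \<forall>(p::nat) (n::nat) (L::nat) (\<epsilon>::real) Sstar (P :: (nat \<Rightarrow> real) measure).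
      1 \<le> p \<longrightarrow> 1 \<le> n \<longrightarrow> 2 \<le> L \<longrightarrow> 0 \<le> \<epsilon> \<longrightarrow>
      Sstar \<in> Theta p M1 M2 \<longrightarrow>
      prob_space P \<longrightarrow> sets P = sets (Rp p) \<longrightarrow>
      wasserstein1 p P (gaussian p Sstar) \<le> ennreal \<epsilon> \<longrightarrow>
      2 ^ L * (real p / real n) + \<epsilon>\<^sup>2 \<le> c \<longrightarrow>
      (\<exists>A \<in> sets (PiM {..<n} (\<lambda>_. P)).
         measure (PiM {..<n} (\<lambda>_. P)) A \<ge> 1 - exp (- (real p + real n * \<epsilon>\<^sup>2)) \<and>
         (\<forall>X \<in> A. \<forall>S. is_wgan_estimate p M1 M2 (1 / M1) L n X S \<longrightarrow>
            spec_norm p (mat_diff S Sstar)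
              \<le> C' * max (2 ^ L * sqrt (real p / real n)) \<epsilon>)))"
proof (rule exI[of _ 1], intro conjI allI impI)
  fix M1 M2 :: real assume M: "0 < M1 \<and> M1 \<le> M2"
  define B where "B = 1 / M1"
  define \<kappa> where "\<kappa> = gap_const (2 * (B * sqrt M2)) * measure std_normal {1..2}"
  define C where "C = 464 + 28 * B ^ 4 * M2\<^sup>2"
  have B: "0 < B" using M by (simp add: B_def)
  have \<kappa>0: "0 < \<kappa>" unfolding \<kappa>_def by (intro mult_pos_pos gap_const_pos std_normal_12_pos)
  have C0: "0 < C" unfolding C_def by (intro add_pos_nonneg) auto
  show "\<exists>C' > (0::real). \<forall>(p::nat) (n::nat) (L::nat) (\<epsilon>::real) Sstar (P :: (nat \<Rightarrow> real) measure).
      1 \<le> p \<longrightarrow> 1 \<le> n \<longrightarrow> 2 \<le> L \<longrightarrow> 0 \<le> \<epsilon> \<longrightarrow>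
      Sstar \<in> Theta p M1 M2 \<longrightarrow>
      prob_space P \<longrightarrow> sets P = sets (Rp p) \<longrightarrow>
      wasserstein1 p P (gaussian p Sstar) \<le> ennreal \<epsilon> \<longrightarrow>
      2 ^ L * (real p / real n) + \<epsilon>\<^sup>2 \<le> 1 \<longrightarrow>
      (\<exists>A \<in> sets (PiM {..<n} (\<lambda>_. P)).
         measure (PiM {..<n} (\<lambda>_. P)) A \<ge> 1 - exp (- (real p + real n * \<epsilon>\<^sup>2)) \<and>
         (\<forall>X \<in> A. \<forall>S. is_wgan_estimate p M1 M2 (1 / M1) L n X S \<longrightarrow>
            spec_norm p (mat_diff S Sstar)
              \<le> C' * max (2 ^ L * sqrt (real p / real n)) \<epsilon>))"
  \<comment> \<open>In the last factor, C comes from the Gaussian mean, 2 B from transport at cost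
    \<epsilon> + sqrt (p / n), which is at most twice the rate, and 4 from the fluctuation around
    the mean.\<close>
  proof (rule exI[of _ "4 / (\<kappa> * B\<^sup>2) * (C + 2 * B + 4)"], intro conjI allI impI)
    show "0 < 4 / (\<kappa> * B\<^sup>2) * (C + 2 * B + 4)" using \<kappa>0 B C0 by simp
    fix p n L :: nat and \<epsilon> :: real and Sstar and P :: "(nat \<Rightarrow> real) measure"
    assume p: "1 \<le> p" and n: "1 \<le> n" and L: "2 \<le> L" and \<epsilon>: "0 \<le> \<epsilon>" and Sstar: "Sstar \<in> Theta p M1 M2"
      and P: "prob_space P" "sets P = sets (Rp p)" and W: "wasserstein1 p P (gaussian p Sstar) \<le> ennreal \<epsilon>"
    define \<delta> where "\<delta> = sqrt (real p / real n)"
    define m where "m = max (2 ^ L * \<delta>) \<epsilon>"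
    have \<delta>0: "0 < \<delta>" using p n by (simp add: \<delta>_def)
    have m_ge: "2 ^ L * \<delta> \<le> m" "\<epsilon> \<le> m" by (simp_all add: m_def)
    have "1 * \<delta> \<le> 2 ^ L * \<delta>" using \<delta>0 by (intro mult_right_mono) auto
    then have m: "\<delta> \<le> m" "\<epsilon> \<le> m" "2 ^ L * \<delta> \<le> m" "0 \<le> m" using \<delta>0 m_ge by linarith+
    define A where "A = {X \<in> space (PiM {..<n} (\<lambda>_. P)). deviation p B L n Sstar X
      \<le> (\<integral>X. deviation p B L n Sstar X \<partial>PiM {..<n} (\<lambda>_. P)) + sqrt (8 * real n * (real p + real n * \<epsilon>\<^sup>2))}"
    \<comment> \<open>The slack \<delta> buys the strict inequality; it is at most the target rate
      and only affects the constant.\<close>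
    have "wasserstein1 p P (gaussian p Sstar) < ennreal (\<epsilon> + \<delta>)"
      by (rule le_less_trans[OF W]) (use \<epsilon> \<delta>0 in \<open>auto intro: ennreal_lessI\<close>)
    then have mean: "(\<integral>X. deviation p B L n Sstar X \<partial>PiM {..<n} (\<lambda>_. P))
        \<le> 2 ^ L * C * sqrt (real n * real p) + B * (real n * (\<epsilon> + \<delta>))"
      unfolding C_def using M B \<epsilon> \<delta>0
      by (intro expected_deviation_contaminated[OF Sstar p _ _ n _ L P]) auto
    have "sqrt (real n * real p) = real n * \<delta>"
    proof -
      have "real n * real p = (real n)\<^sup>2 * (real p / real n)" using n by (simp add: power2_eq_square)
      then show ?thesis unfolding \<delta>_def by (simp only: real_sqrt_mult) simp
    qed
    with mean have mean: "(\<integral>X. deviation p B L n Sstar X \<partial>PiM {..<n} (\<lambda>_. P))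
        \<le> real n * (C * (2 ^ L * \<delta>) + B * (\<epsilon> + \<delta>))" by (simp add: algebra_simps)
    have "sqrt (8 * real n * (real p + real n * \<epsilon>\<^sup>2)) = real n * sqrt (8 * (\<delta>\<^sup>2 + \<epsilon>\<^sup>2))"
    proof -
      have "8 * real n * (real p + real n * \<epsilon>\<^sup>2) = (real n)\<^sup>2 * (8 * (\<delta>\<^sup>2 + \<epsilon>\<^sup>2))"
        using n by (simp add: \<delta>_def power2_eq_square field_simps)
      then show ?thesis by (simp only: real_sqrt_mult) simp
    qed
    also have "\<dots> \<le> real n * (4 * m)"
    proof (rule mult_left_mono)
      have "\<delta>\<^sup>2 \<le> m\<^sup>2" "\<epsilon>\<^sup>2 \<le> m\<^sup>2" using m \<epsilon> \<delta>0 by (auto intro: power_mono)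
      then have "8 * (\<delta>\<^sup>2 + \<epsilon>\<^sup>2) \<le> (4 * m)\<^sup>2" by (simp add: power_mult_distrib)
      then show "sqrt (8 * (\<delta>\<^sup>2 + \<epsilon>\<^sup>2)) \<le> 4 * m" using m(4) by (intro real_le_lsqrt) auto
    qed simp
    finally have dev: "deviation p B L n Sstar X / real n \<le> (C + 2 * B + 4) * m" if "X \<in> A" for X
    proof -
      assume t: "sqrt (8 * real n * (real p + real n * \<epsilon>\<^sup>2)) \<le> real n * (4 * m)"
      have "deviation p B L n Sstar X \<le> real n * (C * (2 ^ L * \<delta>) + B * (\<epsilon> + \<delta>) + 4 * m)"
        using that mean t by (simp add: A_def algebra_simps)
      then have "deviation p B L n Sstar X / real n \<le> C * (2 ^ L * \<delta>) + B * (\<epsilon> + \<delta>) + 4 * m"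
        using n by (simp add: pos_divide_le_eq mult.commute)
      also have "\<dots> \<le> C * m + B * (m + m) + 4 * m"
        using m C0 B by (intro add_mono mult_left_mono) auto
      finally show ?thesis by (simp add: algebra_simps)
    qed
    show "\<exists>A \<in> sets (PiM {..<n} (\<lambda>_. P)).
         measure (PiM {..<n} (\<lambda>_. P)) A \<ge> 1 - exp (- (real p + real n * \<epsilon>\<^sup>2)) \<and>
         (\<forall>X \<in> A. \<forall>S. is_wgan_estimate p M1 M2 (1 / M1) L n X S \<longrightarrow>
            spec_norm p (mat_diff S Sstar)
              \<le> 4 / (\<kappa> * B\<^sup>2) * (C + 2 * B + 4) * max (2 ^ L * sqrt (real p / real n)) \<epsilon>)"
    proof (intro bexI[of _ A] conjI ballI allI impI)
      show "A \<in> sets (PiM {..<n} (\<lambda>_. P))"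
        unfolding A_def by (rule deviation_tail(1)) (use B L n p P in auto)
      show "1 - exp (- (real p + real n * \<epsilon>\<^sup>2)) \<le> measure (PiM {..<n} (\<lambda>_. P)) A"
        unfolding A_def by (rule deviation_tail(2)) (use B L n p P in auto)
      fix X S assume X: "X \<in> A" and est: "is_wgan_estimate p M1 M2 (1 / M1) L n X S"
      have S: "S \<in> Theta p M1 M2" using est by (simp add: is_wgan_estimate_def)
      have "spec_norm p (mat_diff S Sstar) \<le> 4 / (\<kappa> * B\<^sup>2) * (deviation p B L n Sstar X / real n)"
        unfolding \<kappa>_def
        by (rule spec_norm_le_discrepancy[OF S Sstar p _ _ B L])
           (use M wgan_estimate_discrepancy[OF est[folded B_def] Sstar _ L n] B in auto)
      also have "\<dots> \<le> 4 / (\<kappa> * B\<^sup>2) * ((C + 2 * B + 4) * m)"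
        by (rule mult_left_mono[OF dev[OF X]]) (use \<kappa>0 in simp)
      finally show "spec_norm p (mat_diff S Sstar)
          \<le> 4 / (\<kappa> * B\<^sup>2) * (C + 2 * B + 4) * max (2 ^ L * sqrt (real p / real n)) \<epsilon>"
        by (simp only: m_def \<delta>_def mult.assoc)
    qed
  qed
qed simp

end
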